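(* Suppose $\theta_i=\theta$ for all $i\in[N]$. If $$\underline{\lambda}_i>\theta\,\frac{e_{(3)}}{1-2e_{(3)}},\qquad\forall i\in[N],$$ then $c$ is concave on $\Lambda$ and coincides with the optimal value function of the corresponding MDP, i.e. $c(\boldsymbol{\lambda})=c^{\mathrm{MDP}}(\boldsymbol{\lambda})$ for all $\boldsymbol{\lambda}\in\Lambda$.
   Context: Fix an integer $N\ge 1$ and write $[N]=\{1,\dots,N\}$. Costs $c_{(i)}>0$ and $c_{(i,j)}>0$ ($i,j\in[N]$) are given with $c_{(i)}=c_{(i,i)}\le c_{(i,j)}=c_{(j,i)}$ for all $i,j\in[N]$. The parameters $\theta_i>0$ ($i\in[N]$) are given. The domain is the box $\Lambda=[\underline{\boldsymbol{\lambda}},\overline{\boldsymbol{\lambda}}]=\{\boldsymbol{\lambda}\in\mathbb{R}^N:\underline{\lambda}_i\le\lambda_i\le\overline{\lambda}_i\ \forall i\}$ with $\underline{\lambda}_i>0$ for all $i$. For $\boldsymbol{\lambda}\in\Lambda$, $c(\boldsymbol{\lambda})$ is the optimal value of the linear program in variables $\boldsymbol{x}=(x_{i,j})_{i,j\in[N]}$, $\boldsymbol{y}=(y_i)_{i\in[N]}$: minimize $\sum_{i,j\in[N]}c_{(i,j)}x_{i,j}+\sum_{i\in[N]}c_{(i)}y_i$ subject to $\sum_{j\in[N]}x_{j,i}+\sum_{j\in[N]}x_{i,j}+y_i=\lambda_i$ for all $i\in[N]$; $\theta_i x_{i,j}\le\lambda_j y_i$ for all $i,j\in[N]$; $x_{i,j}\ge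 0$ for all $i,j\in[N]$; $y_i\ge 0$ for all $i\in[N]$. Matching efficiency: $e_{i,j}=1-c_{(i,j)}/(c_{(i)}+c_{(j)})$ for $i,j\in[N]$ (so $e_{i,i}=0.5$ and $e_{i,j}\le 0.5$). For each $i$, let $e_{i,(1)}\ge e_{i,(2)}\ge\dots\ge e_{i,(N)}$ be the values $e_{i,1},\dots,e_{i,N}$ sorted in descending order. For a positive integer $k$, the $k$-th critical matching efficiency is $e_{(k)}=\max_{i\in[N]}e_{i,(k)}$ if $k\le N$, and $e_{(k)}=0$ if $k>N$. Standing assumption in the homogeneous-patience case: $e_{(k)}<0.5$ for all $k\ge 2$. MDP: demands of type $i\in[N]$ arrive according to independent Poisson processes with rates $\lambda_i$; a type-$i$ demand has an independent exponential sojourn time with rate $\theta_i$. The state $\mathbf{s}=(s_1,\dots,s_N)\in\mathbb{Z}_{\ge 0}^N$ records the numbers of waiting demands of each type; the system starts empty. A stationary matching policy $\boldsymbol{\phi}=(\phi_i)_{i\in[N]}$, $\phi_i:\mathbb{Z}_{\ge 0}^N\to[N]\cup\{0\}$, decides, when a type-$i$ demand arrives in state $\mathbf{s}$, either to match it immediately with a waiting demand of type $j=\phi_i(\mathbf{s})$ with $s_j>0$ (both leave, and cost $c_{(i,j)}$ is incurred), or (if $\phi_i(\mathbf{s})=0$) to let it wait. If a waiting type-$i$ demand's sojourn time expires before it is matched, it leaves and a cost $c_{(i)}$ is incurred. Let $C^{\boldsymbol{\lambda},\boldsymbol{\phi}}(T)$ be the total cost incurred by time $T$. The optimal value function is the minimum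 expected long-run average cost $c^{\mathrm{MDP}}(\boldsymbol{\lambda})=\inf_{\boldsymbol{\phi}}\limsup_{T\to\infty}\frac{1}{T}\mathbb{E}[C^{\boldsymbol{\lambda},\boldsymbol{\phi}}(T)]$. *)

theory Defs
  imports "HOL-Probability.Probability"
begin

text \<open>
  The demand types \<open>[N]\<close> are the elements of a finite type \<open>'n\<close>. Throughout, \<open>c1 i\<close> is the cost
  \<open>c\<^sub>(\<^sub>i\<^sub>)\<close> of a single demand, \<open>c2 i j\<close> the cost \<open>c\<^sub>(\<^sub>i\<^sub>,\<^sub>j\<^sub>)\<close> of a match, \<open>th i\<close> the rate of the
  sojourn times and \<open>lam $ i\<close> the arrival rate.
\<close>

subsection \<open>The linear program\<close>

definition lp_feasible ::
  "('n::finite \<Rightarrow> real) \<Rightarrow> real ^ 'n \<Rightarrow> ('n \<Rightarrow> 'n \<Rightarrow> real) \<Rightarrow> ('n \<Rightarrow> real) \<Rightarrow> bool" where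
  "lp_feasible th lam x y \<longleftrightarrow>
     (\<forall>i. (\<Sum>j\<in>UNIV. x j i) + (\<Sum>j\<in>UNIV. x i j) + y i = lam $ i) \<and>
     (\<forall>i j. th i * x i j \<le> lam $ j * y i) \<and>
     (\<forall>i j. x i j \<ge> 0) \<and> (\<forall>i. y i \<ge> 0)"

definition lp_cost ::
  "('n::finite \<Rightarrow> real) \<Rightarrow> ('n \<Rightarrow> 'n \<Rightarrow> real) \<Rightarrow> ('n \<Rightarrow> 'n \<Rightarrow> real) \<Rightarrow> ('n \<Rightarrow> real) \<Rightarrow> real" where
  "lp_cost c1 c2 x y = (\<Sum>i\<in>UNIV. \<Sum>j\<in>UNIV. c2 i j * x i j) + (\<Sum>i\<in>UNIV. c1 i * y i)"

definition lp_value ::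
  "('n::finite \<Rightarrow> real) \<Rightarrow> ('n \<Rightarrow> 'n \<Rightarrow> real) \<Rightarrow> ('n \<Rightarrow> real) \<Rightarrow> real ^ 'n \<Rightarrow> real" where
  "lp_value c1 c2 th lam = Inf {lp_cost c1 c2 x y | x y. lp_feasible th lam x y}"

subsection \<open>Matching efficiencies\<close>

definition efficiency ::
  "('n \<Rightarrow> real) \<Rightarrow> ('n \<Rightarrow> 'n \<Rightarrow> real) \<Rightarrow> 'n \<Rightarrow> 'n \<Rightarrow> real" where
  "efficiency c1 c2 i j = 1 - c2 i j / (c1 i + c1 j)"

text \<open>Ranks count from 1, and equal efficiencies are listed with repetition.\<close>

definition ranked_efficiency ::
  "('n::finite \<Rightarrow> real) \<Rightarrow> ('n \<Rightarrow> 'n \<Rightarrow> real) \<Rightarrow> 'n \<Rightarrow> nat \<Rightarrow> real" where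
  "ranked_efficiency c1 c2 i k =
     rev (sorted_list_of_multiset (image_mset (efficiency c1 c2 i) (mset_set UNIV))) ! (k - 1)"

definition critical_efficiency ::
  "('n::finite \<Rightarrow> real) \<Rightarrow> ('n \<Rightarrow> 'n \<Rightarrow> real) \<Rightarrow> nat \<Rightarrow> real" where
  "critical_efficiency c1 c2 k =
     (if k \<le> CARD('n) then Max (range (\<lambda>i. ranked_efficiency c1 c2 i k)) else 0)"

subsection \<open>The Markov decision process\<close>

text \<open>
  A policy sees the type of the arriving demand and the numbers of waiting demands (the arriving
  one not included); \<open>None\<close>, the value 0 of the mathematical notation, lets the demand wait.
\<close>

type_synonym 'n policy = "'n \<Rightarrow> ('n \<Rightarrow> nat) \<Rightarrow> 'n option"

definition admissible_policies :: "'n policy set" where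
  "admissible_policies = {\<phi>. \<forall>i s j. \<phi> i s = Some j \<longrightarrow> s j > 0}"

text \<open>
  A sample point assigns to the \<open>k\<close>-th demand of type \<open>i\<close> (\<open>k = 0, 1, \<dots>\<close>) the time elapsed since
  the previous arrival of type \<open>i\<close> (since time 0 if \<open>k = 0\<close>) and its sojourn time. All of these are
  independent and exponentially distributed, so that the arrivals of the different types form
  independent Poisson processes.
\<close>

type_synonym 'n sample = "'n \<times> nat \<Rightarrow> real \<times> real"

definition demand_space :: "('n::finite \<Rightarrow> real) \<Rightarrow> real ^ 'n \<Rightarrow> 'n sample measure" where
  "demand_space th lam =
     (\<Pi>\<^sub>M (i, k)\<in>UNIV. density lborel (exponential_density (lam $ i)) \<Otimes>\<^sub>M
                     density lborel (exponential_density (th i)))"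

definition arrival_time :: "'n sample \<Rightarrow> 'n \<Rightarrow> nat \<Rightarrow> real" where
  "arrival_time \<omega> i k = (\<Sum>m\<le>k. fst (\<omega> (i, m)))"

definition expiry_time :: "'n sample \<Rightarrow> 'n \<Rightarrow> nat \<Rightarrow> real" where
  "expiry_time \<omega> i k = arrival_time \<omega> i k + snd (\<omega> (i, k))"

text \<open>
  A configuration \<open>(a, q)\<close> records the number \<open>a i\<close> of past arrivals of type \<open>i\<close> and the list \<open>q i\<close>
  of the indices of the waiting demands of type \<open>i\<close>, in the order of their arrival. The next
  event is the earliest among the next arrival of each type and the expiry of each waiting demand
  (two of these coincide only with probability zero). Among the waiting demands of the type
  selected by the policy, the one that has waited longest is matched.
\<close>

type_synonym 'n config = "('n \<Rightarrow> nat) \<times> ('n \<Rightarrow> nat list)"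

datatype 'n event = Arrival 'n | Expiry 'n nat

fun pending_events :: "'n config \<Rightarrow> 'n event set" where
  "pending_events (a, q) = range Arrival \<union> {Expiry i k | i k. k \<in> set (q i)}"

fun event_time :: "'n sample \<Rightarrow> 'n config \<Rightarrow> 'n event \<Rightarrow> real" where
  "event_time \<omega> (a, q) (Arrival i) = arrival_time \<omega> i (a i)"
| "event_time \<omega> (a, q) (Expiry i k) = expiry_time \<omega> i k"

definition next_event :: "'n sample \<Rightarrow> 'n config \<Rightarrow> 'n event" where
  "next_event \<omega> \<sigma> = arg_min_on (event_time \<omega> \<sigma>) (pending_events \<sigma>)"

fun event_effect :: "'n policy \<Rightarrow> 'n config \<Rightarrow> 'n event \<Rightarrow> 'n config" where
  "event_effect \<phi> (a, q) (Arrival i) =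
     (a(i := Suc (a i)),
      case \<phi> i (\<lambda>j. length (q j)) of None \<Rightarrow> q(i := q i @ [a i]) | Some j \<Rightarrow> q(j := tl (q j)))"
| "event_effect \<phi> (a, q) (Expiry i k) = (a, q(i := remove1 k (q i)))"

fun event_cost ::
  "('n \<Rightarrow> real) \<Rightarrow> ('n \<Rightarrow> 'n \<Rightarrow> real) \<Rightarrow> 'n policy \<Rightarrow> 'n config \<Rightarrow> 'n event \<Rightarrow> real" where
  "event_cost c1 c2 \<phi> (a, q) (Arrival i) =
     (case \<phi> i (\<lambda>j. length (q j)) of None \<Rightarrow> 0 | Some j \<Rightarrow> c2 i j)"
| "event_cost c1 c2 \<phi> (a, q) (Expiry i k) = c1 i"

primrec config_after :: "'n policy \<Rightarrow> 'n sample \<Rightarrow> nat \<Rightarrow> 'n config" where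
  "config_after \<phi> \<omega> 0 = (\<lambda>i. 0, \<lambda>i. [])"
| "config_after \<phi> \<omega> (Suc n) =
     event_effect \<phi> (config_after \<phi> \<omega> n) (next_event \<omega> (config_after \<phi> \<omega> n))"

definition total_cost ::
  "('n \<Rightarrow> real) \<Rightarrow> ('n \<Rightarrow> 'n \<Rightarrow> real) \<Rightarrow> 'n policy \<Rightarrow> real \<Rightarrow> 'n sample \<Rightarrow> ennreal" where
  "total_cost c1 c2 \<phi> T \<omega> =
     (\<Sum>n. let \<sigma> = config_after \<phi> \<omega> n; v = next_event \<omega> \<sigma>
           in if event_time \<omega> \<sigma> v \<le> T then ennreal (event_cost c1 c2 \<phi> \<sigma> v) else 0)"

definition average_cost ::
  "('n::finite \<Rightarrow> real) \<Rightarrow> ('n \<Rightarrow> 'n \<Rightarrow> real) \<Rightarrow> ('n \<Rightarrow> real) \<Rightarrow> real ^ 'n \<Rightarrow> 'n policy \<Rightarrow> ereal" where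
  "average_cost c1 c2 th lam \<phi> =
     Limsup at_top (\<lambda>T. enn2ereal (\<integral>\<^sup>+\<omega>. total_cost c1 c2 \<phi> T \<omega> \<partial>demand_space th lam) / ereal T)"

definition mdp_value ::
  "('n::finite \<Rightarrow> real) \<Rightarrow> ('n \<Rightarrow> 'n \<Rightarrow> real) \<Rightarrow> ('n \<Rightarrow> real) \<Rightarrow> real ^ 'n \<Rightarrow> ereal" where
  "mdp_value c1 c2 th lam = (INF \<phi>\<in>admissible_policies. average_cost c1 c2 th lam \<phi>)"

end

theory Submission
  imports Defs
begin

text \<open>
  With equal patience the shadow prices of \<open>\<theta> x\<^bsub>i,j\<^esub> \<le> \<lambda>\<^sub>j y\<^sub>i\<close> and \<open>\<theta> x\<^bsub>j,i\<^esub> \<le> \<lambda>\<^sub>i y\<^sub>j\<close> coincide, and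
  the dual program asks for prices \<open>g\<close> with
  \<open>\<theta> (c\<^bsub>(i)\<^esub> - g\<^sub>i) = (\<Sum>\<^sub>j \<lambda>\<^sub>j max 0 (g\<^sub>i + g\<^sub>j - c\<^bsub>(i,j)\<^esub>))\<close>.
  The bound on the arrival rates forces \<open>g\<^sub>i + g\<^sub>j \<le> c\<^bsub>(i,j)\<^esub>\<close> whenever \<open>i \<noteq> j\<close> and
  \<open>e\<^bsub>i,j\<^esub> \<le> e\<^bsub>(3)\<^esub>\<close>, and each type has at most one partner \<open>j \<noteq> i\<close> with \<open>e\<^bsub>i,j\<^esub> > e\<^bsub>(3)\<^esub>\<close>. The linear program therefore splits
  into single types and pairs, so its value is a minimum of finitely many explicit concave
  functions, one for each admissible pairing.

  For the decision process, resampling a single exponential clock gives the intensities of matches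
  and expiries: the expected number of arrivals of type \<open>j\<close> matched with a waiting \<open>i\<close> is \<open>\<lambda>\<^sub>j\<close> times the
  expected time during which the policy prescribes this match, and the expected number of
  expiries is \<open>\<theta>\<close> times the integral of the expected queue length. Hence the expected flows up to
  time \<open>T\<close>, divided by \<open>T\<close>, satisfy the constraints of the program up to an error \<open>O(1/T)\<close>, and weak
  duality bounds the cost of every policy from below. The policy that matches greedily within the optimal
  pairing keeps at most one demand waiting in each pair, so all its constraints are tight.
\<close>

subsection \<open>Duality for the linear program\<close>

text \<open>The constant e/(1 - 2e) comes from pricing a type alone. Then \<theta> (c - g) =
  \<lambda> (2 g - c), so g = c (\<theta> + \<lambda>)/(\<theta> + 2 \<lambda>), and for e < 1/2
  this is below (1 - e) c exactly when \<lambda> > \<theta> e/(1 - 2e). A partner only lowers the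
  price, so a pair whose stand-alone prices do not exceed its matching cost never violates the dual
  constraint, and a pair whose prices do exceed it has efficiency above e. For e the third critical
  efficiency, each type itself, with efficiency 1/2, is one of at most two types above e, which
  leaves room for a single genuine partner; more partners would couple the price equations along
  longer chains.

  For the process, only expectations up to a finite time are used, never a stationary law. Two
  points shape the statements. Demands still waiting at time T disturb the balance, so duality is
  stated for a right-hand side that may differ from the arrival rates. A decision taken when a clock
  rings must not depend on that clock, so states are read off just before the event, which also
  fixes all intervals as left-open and right-closed.\<close>

lemma lp_cost_duality_gap:
  fixes x :: "'n::finite \<Rightarrow> 'n \<Rightarrow> real"
  assumes "\<And>i. (\<Sum>j\<in>UNIV. x j i) + (\<Sum>j\<in>UNIV. x i j) + y i = b i"
  shows "lp_cost c1 c2 x y - (\<Sum>i\<in>UNIV. g i * b i) =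
    (\<Sum>i\<in>UNIV. \<Sum>j\<in>UNIV. (c2 i j - (g i + g j - t * k i j)) * x i j) +
    (\<Sum>i\<in>UNIV. (c1 i - g i - (\<Sum>j\<in>UNIV. l j * k i j)) * y i) +
    (\<Sum>i\<in>UNIV. \<Sum>j\<in>UNIV. k i j * (l j * y i - t * x i j))"
proof -
  have "(\<Sum>i\<in>UNIV. g i * b i) = (\<Sum>i\<in>UNIV. \<Sum>j\<in>UNIV. g i * x j i) +
      (\<Sum>i\<in>UNIV. \<Sum>j\<in>UNIV. g i * x i j) + (\<Sum>i\<in>UNIV. g i * y i)"
    unfolding assms[symmetric] by (simp add: distrib_left sum.distrib sum_distrib_left)
  also have "(\<Sum>i\<in>UNIV. \<Sum>j\<in>UNIV. g i * x j i) = (\<Sum>i\<in>UNIV. \<Sum>j\<in>UNIV. g j * x i j)"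
    by (rule sum.swap)
  finally show ?thesis
    by (simp add: lp_cost_def algebra_simps sum.distrib sum_subtractf sum_distrib_left
        sum_distrib_right)
qed

text \<open>Dual feasibility makes each of the three sums in \<open>lp_cost_duality_gap\<close>
  nonnegative. The right-hand side \<open>b\<close> is separate from the rates \<open>l\<close>, so
  that flows with a disturbed balance are covered as well.\<close>

lemma lp_weak_duality:
  fixes x :: "'n::finite \<Rightarrow> 'n \<Rightarrow> real"
  assumes b: "\<And>i. (\<Sum>j\<in>UNIV. x j i) + (\<Sum>j\<in>UNIV. x i j) + y i = b i"
    and "\<And>i j. 0 \<le> x i j" "\<And>i. 0 \<le> y i" "\<And>i j. t * x i j \<le> l j * y i"
    and "\<And>i j. 0 \<le> k i j" "\<And>i j. g i + g j - t * k i j \<le> c2 i j"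
    and "\<And>i. g i + (\<Sum>j\<in>UNIV. l j * k i j) \<le> c1 i"
  shows "(\<Sum>i\<in>UNIV. g i * b i) \<le> lp_cost c1 c2 x y"
proof -
  have "0 \<le> lp_cost c1 c2 x y - (\<Sum>i\<in>UNIV. g i * b i)"
    unfolding lp_cost_duality_gap[OF b, where t = t and l = l and k = k]
    using assms(2-)
    by (intro add_nonneg_nonneg sum_nonneg mult_nonneg_nonneg) (simp_all add: algebra_simps)
  then show ?thesis by simp
qed

subsection \<open>Matching within pairs\<close>

locale cost_model =
  fixes c1 :: "'n::finite \<Rightarrow> real" and c2 :: "'n \<Rightarrow> 'n \<Rightarrow> real" and \<theta> :: real
  assumes c1_pos: "0 < c1 i" and c1_le: "c1 i \<le> c2 i j" and c2_diag: "c2 i i = c1 i"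
    and c2_sym: "c2 i j = c2 j i" and \<theta>_pos: "0 < \<theta>"
begin

lemma c1_le': "c1 j \<le> c2 i j"
  using c1_le[of j i] c2_sym[of i j] by simp

text \<open>
  The dual price of a type that is only matched with itself, and the prices of two types that
  are matched both with themselves and with each other.
\<close>

definition own_price :: "real ^ 'n \<Rightarrow> 'n \<Rightarrow> real" where
  "own_price lam i = c1 i * (\<theta> + lam $ i) / (\<theta> + 2 * lam $ i)"

text \<open>If matching \<open>i\<close> with \<open>j\<close> yields surplus \<open>s\<close>, the
  price equation lowers the own price of \<open>i\<close> by
  \<open>lam $ j * s / (\<theta> + 2 * lam $ i)\<close>, and symmetrically for \<open>j\<close>.
  Inserting both into \<open>s = g\<^sub>i + g\<^sub>j - c2 i j\<close> and solving for
  \<open>s\<close> gives this quotient.\<close>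

definition match_surplus :: "real ^ 'n \<Rightarrow> 'n \<Rightarrow> 'n \<Rightarrow> real" where
  "match_surplus lam i j = (own_price lam i + own_price lam j - c2 i j) /
     (1 + lam $ j / (\<theta> + 2 * lam $ i) + lam $ i / (\<theta> + 2 * lam $ j))"

definition price :: "('n \<Rightarrow> 'n) \<Rightarrow> real ^ 'n \<Rightarrow> 'n \<Rightarrow> real" where
  "price m lam i = (if m i = i then own_price lam i
     else own_price lam i - lam $ m i * match_surplus lam i (m i) / (\<theta> + 2 * lam $ i))"

text \<open>Inside the group of \<open>i\<close> the multiplier is chosen so that the dual
  constraint is tight; outside it vanishes, since no flow is intended there.\<close>

definition shadow_price :: "('n \<Rightarrow> 'n) \<Rightarrow> real ^ 'n \<Rightarrow> 'n \<Rightarrow> 'n \<Rightarrow> real" where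
  "shadow_price m lam i j =
     (if j = i \<or> j = m i then (price m lam i + price m lam j - c2 i j) / \<theta> else 0)"

text \<open>Summing over the set \<open>{i, m i}\<close> treats an unpaired type,
  \<open>m i = i\<close>, as a group of one without counting it twice.\<close>

definition group_rate :: "('n \<Rightarrow> 'n) \<Rightarrow> real ^ 'n \<Rightarrow> 'n \<Rightarrow> real" where
  "group_rate m lam i = (\<Sum>j\<in>{i, m i}. lam $ j)"

text \<open>This is the stationary probability that a demand of type \<open>i\<close> waits when
  each group holds at most one demand and matches greedily. With group rate \<open>G\<close> the
  empty group has probability \<open>(\<theta> + G) / (\<theta> + 2 * G)\<close>, is left for state
  \<open>i\<close> at rate \<open>lam $ i\<close>, and is reentered at rate
  \<open>\<theta> + G\<close>.\<close>

definition occupancy :: "('n \<Rightarrow> 'n) \<Rightarrow> real ^ 'n \<Rightarrow> 'n \<Rightarrow> real" where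
  "occupancy m lam i = lam $ i / (\<theta> + 2 * group_rate m lam i)"

definition pair_flow :: "('n \<Rightarrow> 'n) \<Rightarrow> real ^ 'n \<Rightarrow> 'n \<Rightarrow> 'n \<Rightarrow> real" where
  "pair_flow m lam i j = (if j = i \<or> j = m i then lam $ j * occupancy m lam i else 0)"

definition pair_value :: "('n \<Rightarrow> 'n) \<Rightarrow> real ^ 'n \<Rightarrow> real" where
  "pair_value m lam = (\<Sum>i\<in>UNIV. price m lam i * lam $ i)"

lemma sum_group:
  fixes m :: "'n \<Rightarrow> 'n"
  shows "(\<Sum>j\<in>UNIV. if j = i \<or> j = m i then f j else 0) = (\<Sum>j\<in>{i, m i}. f j :: real)"
proof -
  have "(\<Sum>j\<in>{i, m i}. f j) = (\<Sum>j\<in>{i, m i}. if j = i \<or> j = m i then f j else 0)"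
    by (intro sum.cong) auto
  also have "\<dots> = (\<Sum>j\<in>UNIV. if j = i \<or> j = m i then f j else 0)"
    by (rule sum.mono_neutral_left) auto
  finally show ?thesis ..
qed

context
  fixes m :: "'n \<Rightarrow> 'n" and lam :: "real ^ 'n"
  assumes inv: "m (m i) = i" and lam: "0 < lam $ i"
begin

lemma \<theta>_lam_pos: "0 < \<theta> + 2 * lam $ i"
  using \<theta>_pos lam[of i] by simp

lemma match_surplus_sym: "match_surplus lam i j = match_surplus lam j i"
  by (simp add: match_surplus_def c2_sym[of i j] ac_simps)

lemma own_price_eq: "\<theta> * (c1 i - own_price lam i) = lam $ i * (2 * own_price lam i - c1 i)"
  using \<theta>_lam_pos[of i] by (simp add: own_price_def field_simps)

lemma own_price_excess:
  "own_price lam i + own_price lam j - c2 i j =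
     match_surplus lam i j * (1 + lam $ j / (\<theta> + 2 * lam $ i) + lam $ i / (\<theta> + 2 * lam $ j))"
proof -
  have "0 < lam $ j / (\<theta> + 2 * lam $ i)" "0 < lam $ i / (\<theta> + 2 * lam $ j)"
    by (simp_all add: \<theta>_lam_pos lam)
  then have "0 < 1 + lam $ j / (\<theta> + 2 * lam $ i) + lam $ i / (\<theta> + 2 * lam $ j)"
    by simp
  then show ?thesis by (simp add: match_surplus_def)
qed

lemma match_surplus_eq:
  assumes "m i \<noteq> i"
  shows "price m lam i + price m lam (m i) - c2 i (m i) = match_surplus lam i (m i)"
proof -
  have "price m lam i + price m lam (m i) - c2 i (m i) = own_price lam i + own_price lam (m i) - c2 i (m i)
    - match_surplus lam i (m i) * (lam $ m i / (\<theta> + 2 * lam $ i) + lam $ i / (\<theta> + 2 * lam $ m i))"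
    using assms inv[of i] match_surplus_sym[of "m i" i] by (auto simp: price_def algebra_simps)
  then show ?thesis unfolding own_price_excess by (simp add: algebra_simps)
qed

text \<open>For an arbitrary involution this is the dual price equation with the positive parts
  dropped and the sum restricted to the group of \<open>i\<close>. The signs of the surpluses are
  settled only for the optimal pairing.\<close>

lemma price_eq:
  "\<theta> * (c1 i - price m lam i) = (\<Sum>j\<in>{i, m i}. lam $ j * (price m lam i + price m lam j - c2 i j))"
proof (cases "m i = i")
  case True
  then show ?thesis using own_price_eq[of i] by (simp add: price_def c2_diag)
next
  case False
  define r where "r = lam $ m i * match_surplus lam i (m i) / (\<theta> + 2 * lam $ i)"
  have p: "price m lam i = own_price lam i - r"
    using False by (simp add: price_def r_def)
  have "lam $ m i * match_surplus lam i (m i) = r * (\<theta> + 2 * lam $ i)"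
    using \<theta>_lam_pos[of i] by (simp add: r_def)
  then have "\<theta> * (c1 i - price m lam i) =
      lam $ i * (2 * price m lam i - c1 i) + lam $ m i * match_surplus lam i (m i)"
    using own_price_eq[of i] unfolding p by (simp add: algebra_simps)
  then show ?thesis using False match_surplus_eq[OF False] by (simp add: c2_diag)
qed

lemma shadow_price_eq: "price m lam i + (\<Sum>j\<in>UNIV. lam $ j * shadow_price m lam i j) = c1 i"
proof -
  have "(\<Sum>j\<in>UNIV. lam $ j * shadow_price m lam i j) =
      (\<Sum>j\<in>{i, m i}. lam $ j * (price m lam i + price m lam j - c2 i j)) / \<theta>"
    unfolding sum_group[symmetric] sum_divide_distrib
    by (intro sum.cong) (auto simp: shadow_price_def)
  also have "\<dots> = c1 i - price m lam i"
    unfolding price_eq[symmetric] using \<theta>_pos by simp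
  finally show ?thesis by simp
qed

lemma group_rate_partner: "group_rate m lam (m i) = group_rate m lam i"
  by (simp add: group_rate_def inv insert_commute)

lemma group_rate_pos: "0 < group_rate m lam i"
  unfolding group_rate_def using lam by (intro sum_pos) auto

lemma occupancy_pos: "0 < occupancy m lam i"
  unfolding occupancy_def using lam[of i] \<theta>_pos group_rate_pos[of i] by (intro divide_pos_pos) auto

text \<open>A type is matched equally often while waiting and upon arrival: both totals equal
  \<open>group_rate * occupancy\<close>. The balance therefore reduces to
  \<open>occupancy * (\<theta> + 2 * group_rate) = lam $ i\<close>, and the flow constraints inside
  a group are tight.\<close>

lemma pair_flow_feasible: "lp_feasible (\<lambda>_. \<theta>) lam (pair_flow m lam) (\<lambda>i. \<theta> * occupancy m lam i)"
  unfolding lp_feasible_def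
proof (intro conjI allI)
  fix i j
  show "0 \<le> pair_flow m lam i j" "0 \<le> \<theta> * occupancy m lam i"
    "\<theta> * pair_flow m lam i j \<le> lam $ j * (\<theta> * occupancy m lam i)"
    using lam[of j] occupancy_pos[of i] \<theta>_pos by (simp_all add: pair_flow_def)
  have out: "(\<Sum>j\<in>UNIV. pair_flow m lam i j) = group_rate m lam i * occupancy m lam i"
    unfolding pair_flow_def sum_group[of i m] group_rate_def sum_distrib_right ..
  have "(\<Sum>j\<in>UNIV. pair_flow m lam j i) = (\<Sum>j\<in>{i, m i}. lam $ i * occupancy m lam j)"
  proof -
    have "j = i \<or> j = m i \<longleftrightarrow> i = j \<or> i = m j" for j using inv by metis
    then show ?thesis unfolding sum_group[symmetric] pair_flow_def by simp
  qed
  also have "\<dots> = lam $ i * ((\<Sum>j\<in>{i, m i}. lam $ j) / (\<theta> + 2 * group_rate m lam i))"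
    unfolding sum_divide_distrib sum_distrib_left
    by (intro sum.cong) (auto simp: occupancy_def group_rate_partner)
  also have "\<dots> = group_rate m lam i * occupancy m lam i"
    by (simp add: group_rate_def occupancy_def)
  finally have "(\<Sum>j\<in>UNIV. pair_flow m lam j i) = group_rate m lam i * occupancy m lam i" .
  moreover have "occupancy m lam i * (\<theta> + 2 * group_rate m lam i) = lam $ i"
    using \<theta>_pos group_rate_pos[of i] by (simp add: occupancy_def)
  ultimately show "(\<Sum>j\<in>UNIV. pair_flow m lam j i) + (\<Sum>j\<in>UNIV. pair_flow m lam i j) +
      \<theta> * occupancy m lam i = lam $ i"
    using out by (simp add: algebra_simps)
qed

text \<open>Complementary slackness for the prices.\<close>

lemma saturated_cost:
  assumes b: "\<And>i. (\<Sum>j\<in>UNIV. x j i) + (\<Sum>j\<in>UNIV. x i j) + y i = b i"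
    and "\<And>i j. j = i \<or> j = m i \<Longrightarrow> \<theta> * x i j = lam $ j * y i"
    and "\<And>i j. j \<noteq> i \<Longrightarrow> j \<noteq> m i \<Longrightarrow> x i j = 0"
  shows "lp_cost c1 c2 x y = (\<Sum>i\<in>UNIV. price m lam i * b i)"
proof -
  have z1: "(c2 i j - (price m lam i + price m lam j - \<theta> * shadow_price m lam i j)) * x i j = 0" for i j
    using assms(3)[of j i] \<theta>_pos by (auto simp: shadow_price_def)
  have z2: "c1 i - price m lam i - (\<Sum>j\<in>UNIV. lam $ j * shadow_price m lam i j) = 0" for i
    using shadow_price_eq[of i] by simp
  have z3: "shadow_price m lam i j * (lam $ j * y i - \<theta> * x i j) = 0" for i j
    using assms(2)[of j i] by (auto simp: shadow_price_def)
  have "lp_cost c1 c2 x y - (\<Sum>i\<in>UNIV. price m lam i * b i) = 0"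
    unfolding lp_cost_duality_gap[OF b, where t = \<theta> and l = "\<lambda>j. lam $ j" and k = "shadow_price m lam"]
    by (simp only: z1 z2 z3 mult_zero_left sum.neutral_const add_0_right)
  then show ?thesis by simp
qed

lemma pair_flow_cost:
  "lp_cost c1 c2 (pair_flow m lam) (\<lambda>i. \<theta> * occupancy m lam i) = pair_value m lam"
  unfolding pair_value_def using pair_flow_feasible
  by (intro saturated_cost) (auto simp: lp_feasible_def pair_flow_def)

end

end

subsection \<open>Concavity\<close>

text \<open>
  The cost of a pair is the quotient of a quadratic form \<open>Q\<close> in \<open>(\<theta>, x, y)\<close> by the linear form
  \<open>L = \<theta> + 2 (x + y)\<close>. Such a quotient is concave where \<open>L\<close> is positive as soon as \<open>Q\<close> is
  negative semidefinite on the kernel of \<open>L\<close>, which is the role of \<open>c \<le> a + b\<close>.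
\<close>

lemma pair_cost_concave:
  fixes a b c \<theta> u v x1 y1 x2 y2 :: real
  assumes c: "a \<le> c" "b \<le> c" "c \<le> a + b" and \<theta>: "0 < \<theta>"
    and xy: "0 \<le> x1" "0 \<le> y1" "0 \<le> x2" "0 \<le> y2" and uv: "0 \<le> u" "0 \<le> v" "u + v = 1"
  defines "N \<equiv> \<lambda>x y. \<theta> * (a * x + b * y) + a * x * x + b * y * y + 2 * c * x * y"
    and "L \<equiv> \<lambda>x y. \<theta> + 2 * (x + y)"
  shows "u * (N x1 y1 / L x1 y1) + v * (N x2 y2 / L x2 y2) \<le>
    N (u * x1 + v * x2) (u * y1 + v * y2) / L (u * x1 + v * x2) (u * y1 + v * y2)"
proof -
  let ?x = "u * x1 + v * x2" and ?y = "u * y1 + v * y2"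
  \<comment> \<open>Scaling each point \<open>(\<theta>, x, y)\<close> by the value of
    \<open>L\<close> at the other and subtracting gives a vector in the kernel of \<open>L\<close>;
    \<open>w1\<close> and \<open>w2\<close> are its last two coordinates.\<close>
  define w1 w2 where "w1 = L x2 y2 * x1 - L x1 y1 * x2" and "w2 = L x2 y2 * y1 - L x1 y1 * y2"
  have a: "0 \<le> a" "0 \<le> b" using c by linarith+
  have pos: "0 < L x1 y1" "0 < L x2 y2" "0 < L ?x ?y"
    using \<theta> xy uv by (auto simp: L_def intro!: add_pos_nonneg)
  have v: "v = 1 - u" using uv by simp
  \<comment> \<open>On the kernel of \<open>L\<close> the first coordinate is
    \<open>- 2 * (w1 + w2)\<close>, and this expression is minus the quadratic form there. It is
    nonnegative because \<open>0 \<le> a + b - c \<le> min a b\<close>.\<close>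
  have "0 \<le> a * w1 * w1 + b * w2 * w2 + 2 * (a + b - c) * w1 * w2"
  proof -
    have "\<bar>w1 * w2\<bar> * (a + b - c) \<le> \<bar>w1 * w2\<bar> * min a b"
      using c by (intro mult_left_mono) auto
    also have "\<bar>w1 * w2\<bar> * min a b \<le> (w1 * w1 + w2 * w2) / 2 * min a b"
    proof (rule mult_right_mono)
      have "0 \<le> (w1 - w2) * (w1 - w2)" "0 \<le> (w1 + w2) * (w1 + w2)" by simp_all
      then show "\<bar>w1 * w2\<bar> \<le> (w1 * w1 + w2 * w2) / 2" by (simp add: algebra_simps abs_le_iff)
    qed (use a in simp)
    also have "\<dots> \<le> (a * (w1 * w1) + b * (w2 * w2)) / 2"
      using mult_right_mono[of "min a b" a "w1 * w1"] mult_right_mono[of "min a b" b "w2 * w2"]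
      by (simp add: algebra_simps)
    finally have "\<bar>w1 * w2\<bar> * (a + b - c) \<le> (a * (w1 * w1) + b * (w2 * w2)) / 2" .
    moreover have "- (\<bar>w1 * w2\<bar> * (a + b - c)) \<le> w1 * w2 * (a + b - c)"
      using mult_right_mono[of "- \<bar>w1 * w2\<bar>" "w1 * w2" "a + b - c"] c by (simp add: abs_le_iff)
    ultimately show ?thesis by (simp add: algebra_simps)
  qed
  then have "0 \<le> u * v * (a * w1 * w1 + b * w2 * w2 + 2 * (a + b - c) * w1 * w2)"
    using uv by simp
  \<comment> \<open>Clearing the three denominators of the concavity inequality leaves exactly
    \<open>u * v\<close> times minus the form at the kernel vector.\<close>
  also have "\<dots> = N ?x ?y * L x1 y1 * L x2 y2 - L ?x ?y * (u * N x1 y1 * L x2 y2 + v * N x2 y2 * L x1 y1)"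
    unfolding w1_def w2_def N_def L_def v by algebra
  finally have "(u * N x1 y1 * L x2 y2 + v * N x2 y2 * L x1 y1) * L ?x ?y \<le> N ?x ?y * (L x1 y1 * L x2 y2)"
    by (simp add: ac_simps)
  then have "(u * N x1 y1 * L x2 y2 + v * N x2 y2 * L x1 y1) / (L x1 y1 * L x2 y2) \<le> N ?x ?y / L ?x ?y"
    using pos by (simp add: divide_le_eq le_divide_eq)
  moreover have "u * (N x1 y1 / L x1 y1) + v * (N x2 y2 / L x2 y2) =
      (u * N x1 y1 * L x2 y2 + v * N x2 y2 * L x1 y1) / (L x1 y1 * L x2 y2)"
    using pos by (simp add: field_simps)
  ultimately show ?thesis by simp
qed

context cost_model
begin

text \<open>All costs are charged to the demand that was waiting, whether it expires or is matched
  by an arrival in its group.\<close>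

definition type_cost :: "('n \<Rightarrow> 'n) \<Rightarrow> real ^ 'n \<Rightarrow> 'n \<Rightarrow> real" where
  "type_cost m lam i = occupancy m lam i * (\<theta> * c1 i + (\<Sum>j\<in>{i, m i}. lam $ j * c2 i j))"

text \<open>Adding each type to its partner visits every type twice, hence the factor 2. This groups
  the costs by pairs without choosing a representative of each pair.\<close>

lemma pair_value_eq_type_cost:
  assumes inv: "\<And>i. m (m i) = i" and lam: "\<And>i. 0 < lam $ i"
  shows "2 * pair_value m lam = (\<Sum>i\<in>UNIV. type_cost m lam i + type_cost m lam (m i))"
proof -
  have "pair_value m lam = (\<Sum>i\<in>UNIV. \<Sum>j\<in>UNIV. c2 i j * pair_flow m lam i j) +
      (\<Sum>i\<in>UNIV. c1 i * (\<theta> * occupancy m lam i))"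
    unfolding pair_flow_cost[OF assms, symmetric] lp_cost_def ..
  also have "\<dots> = (\<Sum>i\<in>UNIV. (\<Sum>j\<in>{i, m i}. c2 i j * (lam $ j * occupancy m lam i)) + c1 i * (\<theta> * occupancy m lam i))"
  proof -
    have "(\<Sum>j\<in>UNIV. c2 i j * pair_flow m lam i j) = (\<Sum>j\<in>{i, m i}. c2 i j * (lam $ j * occupancy m lam i))" for i
      unfolding sum_group[symmetric] pair_flow_def by (intro sum.cong) auto
    then show ?thesis by (simp add: sum.distrib)
  qed
  also have "\<dots> = (\<Sum>i\<in>UNIV. type_cost m lam i)"
    by (intro sum.cong) (simp_all add: type_cost_def algebra_simps sum_distrib_left)
  finally have v: "pair_value m lam = (\<Sum>i\<in>UNIV. type_cost m lam i)" .
  have "bij m" using inv by (intro o_bij[of m]) (auto simp: fun_eq_iff)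
  then have "(\<Sum>i\<in>UNIV. type_cost m lam (m i)) = (\<Sum>i\<in>UNIV. type_cost m lam i)"
    by (rule sum.reindex_bij_betw)
  then show ?thesis using v by (simp add: sum.distrib)
qed

lemma pair_value_concave:
  assumes inv: "\<And>i. m (m i) = i" and eff: "\<And>i. c2 i (m i) \<le> c1 i + c1 (m i)"
    and lam: "\<And>i. 0 < lam $ i" and mu: "\<And>i. 0 < mu $ i" and uv: "0 \<le> u" "0 \<le> v" "u + v = 1"
  shows "u * pair_value m lam + v * pair_value m mu \<le> pair_value m (u *\<^sub>R lam + v *\<^sub>R mu)"
proof -
  let ?nu = "u *\<^sub>R lam + v *\<^sub>R mu"
  have nu: "0 < ?nu $ i" for i
  proof (cases "u = 0")
    case True
    then show ?thesis using uv mu[of i] by simp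
  next
    case False
    then show ?thesis using uv lam[of i] mu[of i] by (simp add: add_pos_nonneg less_imp_le)
  qed
  have "u * (type_cost m lam i + type_cost m lam (m i)) + v * (type_cost m mu i + type_cost m mu (m i)) \<le>
      type_cost m ?nu i + type_cost m ?nu (m i)" for i
  proof (cases "m i = i")
    case True
    \<comment> \<open>A single type is the degenerate pair with \<open>a = b = c\<close> and second
      rate 0; the zero terms are written out to match \<open>pair_cost_concave\<close>.\<close>
    have t: "type_cost m l i = (\<theta> * (c1 i * l $ i + c1 i * 0) + c1 i * l $ i * l $ i + c1 i * 0 * 0 + 2 * c1 i * l $ i * 0) /
        (\<theta> + 2 * (l $ i + 0))" for l
      using True by (simp add: type_cost_def occupancy_def group_rate_def c2_diag algebra_simps)
    have "u * type_cost m lam i + v * type_cost m mu i \<le> type_cost m ?nu i"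
      using pair_cost_concave[of "c1 i" "c1 i" "c1 i" \<theta> "lam $ i" 0 "mu $ i" 0 u v]
        c1_pos[of i] \<theta>_pos lam[of i] mu[of i] uv unfolding t by simp
    then show ?thesis using True by (simp add: algebra_simps)
  next
    case False
    let ?j = "m i"
    have t: "type_cost m l i + type_cost m l ?j =
        (\<theta> * (c1 i * l $ i + c1 ?j * l $ ?j) + c1 i * l $ i * l $ i + c1 ?j * l $ ?j * l $ ?j +
          2 * c2 i ?j * l $ i * l $ ?j) / (\<theta> + 2 * (l $ i + l $ ?j))" for l
      using False inv[of i] c2_sym[of ?j i]
      by (auto simp: type_cost_def occupancy_def group_rate_def c2_diag add_divide_distrib[symmetric]
          algebra_simps)
    show ?thesis
      using pair_cost_concave[of "c1 i" "c2 i ?j" "c1 ?j" \<theta> "lam $ i" "lam $ ?j" "mu $ i" "mu $ ?j" u v]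
        c1_le[of i ?j] c1_le'[of ?j i] eff[of i] \<theta>_pos lam[of i] mu[of i] lam[of ?j] mu[of ?j] uv
      unfolding t by simp
  qed
  then have "(\<Sum>i\<in>UNIV. u * (type_cost m lam i + type_cost m lam (m i)) + v * (type_cost m mu i + type_cost m mu (m i)))
      \<le> (\<Sum>i\<in>UNIV. type_cost m ?nu i + type_cost m ?nu (m i))"
    by (rule sum_mono)
  then have "u * (2 * pair_value m lam) + v * (2 * pair_value m mu) \<le> 2 * pair_value m ?nu"
    using pair_value_eq_type_cost[OF inv lam] pair_value_eq_type_cost[OF inv mu]
      pair_value_eq_type_cost[OF inv nu]
    by (simp only: sum.distrib[of "\<lambda>i. u * _ i" "\<lambda>i. v * _ i"] sum_distrib_left[symmetric])
  then show ?thesis by simp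
qed

subsection \<open>The optimal pairing\<close>

text \<open>The test uses own prices, which are upper bounds for the final prices, so a pair that
  fails it can be left unmatched at no cost to dual feasibility. The case \<open>j = i\<close> is
  excluded because a type always has a positive surplus with itself.\<close>

definition profitable :: "real ^ 'n \<Rightarrow> 'n \<Rightarrow> 'n \<Rightarrow> bool" where
  "profitable lam i j \<longleftrightarrow> j \<noteq> i \<and> c2 i j < own_price lam i + own_price lam j"

text \<open>The description is meaningful where profitable partners are unique; a type without one
  is its own partner, which makes the map an involution.\<close>

definition optimal_partner :: "real ^ 'n \<Rightarrow> 'n \<Rightarrow> 'n" where
  "optimal_partner lam i = (if \<exists>j. profitable lam i j then THE j. profitable lam i j else i)"

lemma profitable_sym: "profitable lam i j \<Longrightarrow> profitable lam j i"
  by (auto simp: profitable_def c2_sym[of i j] ac_simps)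

context
  fixes lam :: "real ^ 'n"
  assumes lam: "\<And>i. 0 < lam $ i"
    and unique: "\<And>i j k. profitable lam i j \<Longrightarrow> profitable lam i k \<Longrightarrow> j = k"
begin

lemma optimal_partner_eq: "profitable lam i j \<Longrightarrow> optimal_partner lam i = j"
  unfolding optimal_partner_def using unique by (auto intro!: the_equality)

lemma profitable_optimal_partner: "optimal_partner lam i \<noteq> i \<Longrightarrow> profitable lam i (optimal_partner lam i)"
  using optimal_partner_eq[of i] optimal_partner_def[of lam i] by metis

lemma optimal_partner_inv: "optimal_partner lam (optimal_partner lam i) = i"
proof (cases "optimal_partner lam i = i")
  case False
  from optimal_partner_eq[OF profitable_sym[OF profitable_optimal_partner[OF False]]] show ?thesis .
qed simp

abbreviation (input) "opt \<equiv> optimal_partner lam"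

lemma own_price_less: "own_price lam i < c1 i"
  using lam[of i] \<theta>_pos c1_pos[of i] by (simp add: own_price_def field_simps)

text \<open>Own prices lie below the single costs, so a profitable match costs less than two single
  departures. This supplies the hypothesis \<open>c \<le> a + b\<close> of
  \<open>pair_cost_concave\<close>.\<close>

lemma optimal_partner_efficient: "c2 i (opt i) \<le> c1 i + c1 (opt i)"
proof (cases "opt i = i")
  case True
  then show ?thesis using c1_pos[of i] by (simp add: c2_diag)
next
  case False
  from profitable_optimal_partner[OF this] show ?thesis
    using own_price_less[of i] own_price_less[of "opt i"] by (simp add: profitable_def)
qed

lemma match_surplus_nonneg: "opt i \<noteq> i \<Longrightarrow> 0 \<le> match_surplus lam i (opt i)"
proof -
  assume "opt i \<noteq> i"
  then have "0 \<le> own_price lam i + own_price lam (opt i) - c2 i (opt i)"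
    using profitable_optimal_partner[of i] by (simp add: profitable_def)
  moreover have "0 \<le> lam $ j / (\<theta> + 2 * lam $ k)" for j k
    using lam[of j] \<theta>_lam_pos[OF optimal_partner_inv lam, of k] by simp
  ultimately show ?thesis
    unfolding match_surplus_def
    by (simp only: divide_nonneg_nonneg add_nonneg_nonneg zero_le_one)
qed

lemma price_le_own_price: "price opt lam i \<le> own_price lam i"
proof (cases "opt i = i")
  case False
  have "0 \<le> lam $ opt i * match_surplus lam i (opt i) / (\<theta> + 2 * lam $ i)"
    using match_surplus_nonneg[OF False] lam[of "opt i"] \<theta>_lam_pos[OF optimal_partner_inv lam, of i]
    by (intro divide_nonneg_nonneg mult_nonneg_nonneg) (simp_all add: less_imp_le)
  then show ?thesis using False by (simp add: price_def)
qed (simp add: price_def)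

text \<open>The shadow price of matching a type with itself is proportional to
  \<open>2 * price - c1\<close>. Its sign is not obvious when a partner has lowered the price; it
  follows from the fact that a match costs at least either single cost.\<close>

lemma half_cost_le_price: "c1 i \<le> 2 * price opt lam i"
proof (cases "opt i = i")
  case True
  have "c1 i * (\<theta> + 2 * lam $ i) \<le> 2 * (c1 i * (\<theta> + lam $ i))"
    using c1_pos[of i] \<theta>_pos by (simp add: algebra_simps)
  then show ?thesis
    using \<theta>_lam_pos[OF optimal_partner_inv lam, of i] True
    by (simp add: price_def own_price_def le_divide_eq)
next
  case False
  let ?j = "opt i"
  define a b c x y where "a = c1 i" and "b = c1 ?j" and "c = c2 i ?j" and "x = lam $ i" and "y = lam $ ?j"
  define g h where "g = price opt lam i" and "h = price opt lam ?j"
  have pos: "0 < x" "0 < y" "0 < \<theta>" "0 < a" using lam \<theta>_pos c1_pos by (simp_all add: x_def y_def a_def)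
  have cab: "a \<le> c" "b \<le> c" using c1_le c1_le' by (simp_all add: a_def b_def c_def)
  have e1: "\<theta> * (a - g) = x * (2 * g - a) + y * (g + h - c)"
    using price_eq[OF optimal_partner_inv lam, of i] False
    by (simp add: a_def b_def c_def x_def y_def g_def h_def c2_diag)
  have e2: "\<theta> * (b - h) = y * (2 * h - b) + x * (h + g - c)"
    using price_eq[OF optimal_partner_inv lam, of ?j] False optimal_partner_inv[of i] c2_sym[of ?j i]
    by (simp add: a_def b_def c_def x_def y_def g_def h_def c2_diag)
  \<comment> \<open>Cramer's rule for the two price equations, linear in \<open>g\<close> and
    \<open>h\<close>: the factor in front of \<open>2 * g - a\<close> is their determinant, and the
    right side is visibly nonnegative since \<open>a, b \<le> c\<close>.\<close>
  have "(\<theta> + (x + y)) * (\<theta> + 2 * (x + y)) * (2 * g - a) =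
      2 * (y * (\<theta> + y) * (c - b) + y * y * (c - a)) + a * (\<theta> * \<theta> + \<theta> * (x + y))"
    using e1 e2 by algebra
  moreover have "0 \<le> 2 * (y * (\<theta> + y) * (c - b) + y * y * (c - a)) + a * (\<theta> * \<theta> + \<theta> * (x + y))"
    using pos cab by (intro add_nonneg_nonneg mult_nonneg_nonneg) auto
  ultimately have "0 \<le> (\<theta> + (x + y)) * (\<theta> + 2 * (x + y)) * (2 * g - a)" by simp
  moreover have "0 < (\<theta> + (x + y)) * (\<theta> + 2 * (x + y))" using pos by simp
  ultimately have "0 \<le> 2 * g - a" using zero_le_mult_iff not_less by (metis less_asym')
  then show ?thesis by (simp add: a_def g_def)
qed

lemma shadow_price_nonneg: "0 \<le> shadow_price opt lam i j"
proof -
  have "0 \<le> price opt lam i + price opt lam j - c2 i j" if "j = i \<or> j = opt i"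
  proof (cases "j = i")
    case True
    then show ?thesis using half_cost_le_price[of i] by (simp add: c2_diag)
  next
    case False
    then have "j = opt i" "opt i \<noteq> i" using that by auto
    then show ?thesis
      using match_surplus_eq[OF optimal_partner_inv lam, of i] match_surplus_nonneg[of i] by simp
  qed
  then show ?thesis using \<theta>_pos by (simp add: shadow_price_def)
qed

text \<open>Inside a group equality holds by the choice of the multiplier. Outside, the pair is not
  profitable at own prices, and the actual prices are no larger.\<close>

lemma price_constraint: "price opt lam i + price opt lam j - \<theta> * shadow_price opt lam i j \<le> c2 i j"
proof (cases "j = i \<or> j = opt i")
  case True
  then show ?thesis using \<theta>_pos by (simp add: shadow_price_def)
next
  case False
  then have "\<not> profitable lam i j" using optimal_partner_eq[of i j] by blast
  then show ?thesis
    using False price_le_own_price[of i] price_le_own_price[of j]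
    by (simp add: shadow_price_def profitable_def)
qed

text \<open>With \<open>b = lam\<close> this bounds the program from below; with \<open>b\<close>
  the expected arrivals minus the demands left over at time \<open>T\<close> it bounds the cost of a
  policy.\<close>

lemma optimal_lower_bound:
  assumes "\<And>i. (\<Sum>j\<in>UNIV. x j i) + (\<Sum>j\<in>UNIV. x i j) + y i = b i"
    and "\<And>i j. 0 \<le> x i j" "\<And>i. 0 \<le> y i" "\<And>i j. \<theta> * x i j \<le> lam $ j * y i"
  shows "(\<Sum>i\<in>UNIV. price opt lam i * b i) \<le> lp_cost c1 c2 x y"
  using assms shadow_price_nonneg price_constraint
  by (rule lp_weak_duality) (simp add: shadow_price_eq[OF optimal_partner_inv lam])

section \<open>The value of the program as a minimum over pairings\<close>

lemma lp_value_ge: "pair_value opt lam \<le> lp_value c1 c2 (\<lambda>_. \<theta>) lam"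
  unfolding lp_value_def
proof (rule cInf_greatest)
  show "{lp_cost c1 c2 x y |x y. lp_feasible (\<lambda>_. \<theta>) lam x y} \<noteq> {}"
    using pair_flow_feasible[OF optimal_partner_inv lam] by blast
  show "pair_value opt lam \<le> z" if "z \<in> {lp_cost c1 c2 x y |x y. lp_feasible (\<lambda>_. \<theta>) lam x y}" for z
    using that optimal_lower_bound unfolding lp_feasible_def pair_value_def by auto
qed

end

text \<open>Every pairing yields a feasible point, optimal or not. This allows one fixed pairing to
  be compared at different arrival rates.\<close>

lemma lp_value_le:
  assumes inv: "\<And>i. m (m i) = i" and lam: "\<And>i. 0 < lam $ i"
  shows "lp_value c1 c2 (\<lambda>_. \<theta>) lam \<le> pair_value m lam"
  unfolding lp_value_def
proof (rule cInf_lower)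
  show "pair_value m lam \<in> {lp_cost c1 c2 x y |x y. lp_feasible (\<lambda>_. \<theta>) lam x y}"
    using pair_flow_feasible[OF assms] pair_flow_cost[OF assms] by force
  have "0 \<le> lp_cost c1 c2 x y" if "lp_feasible (\<lambda>_. \<theta>) lam x y" for x y
    using that c1_pos order.trans[OF less_imp_le[OF c1_pos] c1_le] unfolding lp_feasible_def lp_cost_def
    by (intro add_nonneg_nonneg sum_nonneg mult_nonneg_nonneg) (auto intro: less_imp_le)
  then show "bdd_below {lp_cost c1 c2 x y |x y. lp_feasible (\<lambda>_. \<theta>) lam x y}"
    by (intro bdd_belowI[of _ 0]) auto
qed

lemma lp_value_eq:
  assumes "\<And>i. 0 < lam $ i"
    and "\<And>i j k. profitable lam i j \<Longrightarrow> profitable lam i k \<Longrightarrow> j = k"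
  shows "lp_value c1 c2 (\<lambda>_. \<theta>) lam = pair_value (optimal_partner lam) lam"
  using lp_value_le[OF optimal_partner_inv[OF assms] assms(1)] lp_value_ge[OF assms]
  by (intro antisym) auto

text \<open>The pairing optimal at the intermediate point gives the exact value there and an upper
  bound at both end points, so concavity of its own cost is enough.\<close>

lemma concave_on_lp_value:
  assumes S: "convex S" "\<And>lam i. lam \<in> S \<Longrightarrow> 0 < lam $ i"
    and unique: "\<And>lam i j k. lam \<in> S \<Longrightarrow> profitable lam i j \<Longrightarrow> profitable lam i k \<Longrightarrow> j = k"
  shows "concave_on S (lp_value c1 c2 (\<lambda>_. \<theta>))"
  unfolding concave_on_iff
proof (intro conjI ballI allI impI S(1))
  fix lam mu and u v :: real
  assume l: "lam \<in> S" "mu \<in> S" and uv: "0 \<le> u" "0 \<le> v" "u + v = 1"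
  let ?nu = "u *\<^sub>R lam + v *\<^sub>R mu"
  have nu: "?nu \<in> S" using S(1) l uv by (simp add: convex_def)
  define m where "m = optimal_partner ?nu"
  have inv: "m (m i) = i" for i unfolding m_def by (rule optimal_partner_inv[OF S(2)[OF nu] unique[OF nu]])
  have eff: "c2 i (m i) \<le> c1 i + c1 (m i)" for i
    unfolding m_def by (rule optimal_partner_efficient[OF S(2)[OF nu] unique[OF nu]])
  have "u * lp_value c1 c2 (\<lambda>_. \<theta>) lam + v * lp_value c1 c2 (\<lambda>_. \<theta>) mu \<le>
      u * pair_value m lam + v * pair_value m mu"
    using lp_value_le[OF inv] S(2) l uv by (intro add_mono mult_left_mono) auto
  also have "\<dots> \<le> pair_value m ?nu"
    using S(2) l uv by (intro pair_value_concave inv eff) auto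
  also have "\<dots> = lp_value c1 c2 (\<lambda>_. \<theta>) ?nu"
    unfolding m_def using lp_value_eq[OF S(2)[OF nu] unique[OF nu]] by simp
  finally show "u * lp_value c1 c2 (\<lambda>_. \<theta>) lam + v * lp_value c1 c2 (\<lambda>_. \<theta>) mu \<le>
      lp_value c1 c2 (\<lambda>_. \<theta>) ?nu" .
qed

end

subsection \<open>Critical efficiencies\<close>

text \<open>In a descending list, an entry at position \<open>k - 1\<close> that is at most
  \<open>v\<close> keeps all later entries at most \<open>v\<close>, leaving only
  \<open>k - 1\<close> places for entries above \<open>v\<close>.\<close>

lemma nth_descending_gt:
  fixes A :: "'a :: linorder multiset"
  assumes "k \<le> size (filter_mset (\<lambda>x. v < x) A)" "1 \<le> k"
  shows "v < rev (sorted_list_of_multiset A) ! (k - 1)"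
proof (rule ccontr)
  define xs where "xs = rev (sorted_list_of_multiset A)"
  assume "\<not> ?thesis"
  then have le: "xs ! (k - 1) \<le> v" by (simp add: xs_def)
  have s: "sorted_wrt (\<ge>) xs" by (simp add: xs_def sorted_wrt_rev)
  have A: "mset xs = A" by (simp add: xs_def)
  then have k: "k \<le> length (filter (\<lambda>x. v < x) xs)" using assms(1) by (metis mset_filter size_mset)
  have "filter (\<lambda>x. v < x) (drop (k - 1) xs) = []"
  proof (rule filter_False, rule ballI)
    fix x assume "x \<in> set (drop (k - 1) xs)"
    then obtain n where n: "n < length (drop (k - 1) xs)" "x = drop (k - 1) xs ! n"
      by (auto simp: in_set_conv_nth)
    then have "x \<le> xs ! (k - 1)"
      using s by (cases "n = 0") (auto simp: sorted_wrt_iff_nth_less)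
    then show "\<not> v < x" using le by simp
  qed
  then have "length (filter (\<lambda>x. v < x) xs) \<le> k - 1"
    using append_take_drop_id[of "k - 1" xs] length_filter_le[of "\<lambda>x. v < x" "take (k - 1) xs"]
    by (metis filter_append append_Nil2 length_take min.boundedE)
  then show False using k assms(2) by simp
qed

text \<open>With \<open>k\<close> efficiencies above the critical one, the \<open>k\<close>-th
  ranked efficiency of \<open>i\<close> would exceed the maximum over all types. The set
  \<open>J\<close> itself guarantees \<open>k \<le> CARD('n)\<close>, so the critical efficiency is
  that maximum and not the default 0.\<close>

lemma efficiencies_above_critical:
  fixes c1 :: "'n::finite \<Rightarrow> real"
  assumes "card J = k" "1 \<le> k" "\<And>j. j \<in> J \<Longrightarrow> critical_efficiency c1 c2 k < efficiency c1 c2 i j"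
  shows False
proof -
  let ?v = "critical_efficiency c1 c2 k" and ?e = "efficiency c1 c2 i"
  have k: "k \<le> CARD('n)" using card_mono[of UNIV J] assms(1) by simp
  have "J \<subseteq> {j. ?v < ?e j}" using assms(3) by auto
  then have "k \<le> card {j. ?v < ?e j}" using assms(1) card_mono[of "{j. ?v < ?e j}" J] by simp
  also have "card {j. ?v < ?e j} = size (filter_mset (\<lambda>x. ?v < x) (image_mset ?e (mset_set UNIV)))"
    by (simp add: filter_mset_image_mset)
  finally have "?v < ranked_efficiency c1 c2 i k"
    unfolding ranked_efficiency_def using assms(2) by (intro nth_descending_gt)
  also have "\<dots> \<le> ?v"
    using k by (simp add: critical_efficiency_def)
  finally show False by simp
qed

text \<open>Two distinct profitable partners together with \<open>i\<close> itself would be three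
  types whose efficiency with \<open>i\<close> exceeds the third critical one.\<close>

lemma (in cost_model) profitable_unique:
  assumes e: "critical_efficiency c1 c2 3 < 1 / 2"
    and lam: "0 < lam $ i" "0 < lam $ j" "0 < lam $ k"
    and big: "\<And>l. l \<in> {i, j, k} \<Longrightarrow>
      \<theta> * (critical_efficiency c1 c2 3 / (1 - 2 * critical_efficiency c1 c2 3)) < lam $ l"
    and p: "profitable lam i j" "profitable lam i k"
  shows "j = k"
proof (rule ccontr)
  assume "j \<noteq> k"
  define v where "v = critical_efficiency c1 c2 3"
  have v: "0 < 1 - 2 * v" using e by (simp add: v_def)
  have own: "own_price lam l < (1 - v) * c1 l" if "l \<in> {i, j, k}" for l
  proof -
    have l: "0 < lam $ l" using that lam by auto
    \<comment> \<open>The hypothesis on the arrival rate, rearranged below to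
      \<open>(\<theta> + lam) / (\<theta> + 2 * lam) < 1 - v\<close>; the left side is the own price
      per unit of single cost.\<close>
    have "\<theta> * v < lam $ l * (1 - 2 * v)"
      using big[OF that] v unfolding v_def[symmetric] by (simp add: field_simps)
    then have "\<theta> + lam $ l < (1 - v) * (\<theta> + 2 * lam $ l)" by (simp add: algebra_simps)
    then have "c1 l * (\<theta> + lam $ l) < c1 l * ((1 - v) * (\<theta> + 2 * lam $ l))"
      using c1_pos[of l] by simp
    then show ?thesis
      using l \<theta>_pos by (simp add: own_price_def divide_less_eq ac_simps)
  qed
  have eff: "v < efficiency c1 c2 i l" if "profitable lam i l" "l \<in> {i, j, k}" for l
  proof -
    have "c2 i l < (1 - v) * (c1 i + c1 l)"
      using own[of i] own[OF that(2)] that(1) by (simp add: profitable_def algebra_simps)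
    moreover have "0 < c1 i + c1 l" using c1_pos by (intro add_pos_pos)
    ultimately have "c2 i l / (c1 i + c1 l) < 1 - v" by (simp only: pos_divide_less_eq)
    then show ?thesis by (simp add: efficiency_def)
  qed
  have "v < efficiency c1 c2 i i"
    using e c1_pos[of i] by (simp add: efficiency_def c2_diag v_def)
  moreover have "card {i, j, k} = 3"
    using p \<open>j \<noteq> k\<close> by (auto simp: profitable_def)
  ultimately show False
    using eff p efficiencies_above_critical[of "{i, j, k}" 3 c1 c2 i] by (auto simp: v_def)
qed

subsection \<open>Sample paths\<close>

definition queue_lengths :: "'n config \<Rightarrow> 'n \<Rightarrow> nat" where
  "queue_lengths \<sigma> = (\<lambda>j. length (snd \<sigma> j))"

definition nth_event :: "'n policy \<Rightarrow> 'n sample \<Rightarrow> nat \<Rightarrow> 'n event" where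
  "nth_event \<phi> \<omega> n = next_event \<omega> (config_after \<phi> \<omega> n)"

definition nth_time :: "'n policy \<Rightarrow> 'n sample \<Rightarrow> nat \<Rightarrow> real" where
  "nth_time \<phi> \<omega> n = event_time \<omega> (config_after \<phi> \<omega> n) (nth_event \<phi> \<omega> n)"

text \<open>The configuration at time \<open>t\<close>, events at time \<open>t\<close> itself being excluded.\<close>

definition config_before :: "'n policy \<Rightarrow> 'n sample \<Rightarrow> real \<Rightarrow> 'n config" where
  "config_before \<phi> \<omega> t = config_after \<phi> \<omega> (LEAST n. t \<le> nth_time \<phi> \<omega> n)"

lemma pending_events_alt:
  "pending_events \<sigma> = range Arrival \<union> {Expiry i k | i k. k \<in> set (snd \<sigma> i)}"
  by (cases \<sigma>) simp

lemma event_time_alt: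
  "event_time \<omega> \<sigma> (Arrival i) = arrival_time \<omega> i (fst \<sigma> i)"
  "event_time \<omega> \<sigma> (Expiry i k) = expiry_time \<omega> i k"
  by (cases \<sigma>, simp, cases \<sigma>, simp)

lemma event_effect_alt:
  "event_effect \<phi> \<sigma> (Arrival i) = ((fst \<sigma>)(i := Suc (fst \<sigma> i)),
     case \<phi> i (queue_lengths \<sigma>) of
       None \<Rightarrow> (snd \<sigma>)(i := snd \<sigma> i @ [fst \<sigma> i])
     | Some j \<Rightarrow> (snd \<sigma>)(j := tl (snd \<sigma> j)))"
  "event_effect \<phi> \<sigma> (Expiry i k) = (fst \<sigma>, (snd \<sigma>)(i := remove1 k (snd \<sigma> i)))"
  by (cases \<sigma>, simp add: queue_lengths_def split: option.split, cases \<sigma>, simp)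

lemma event_cost_alt:
  "event_cost c1 c2 \<phi> \<sigma> (Arrival i) = (case \<phi> i (queue_lengths \<sigma>) of None \<Rightarrow> 0 | Some j \<Rightarrow> c2 i j)"
  "event_cost c1 c2 \<phi> \<sigma> (Expiry i k) = c1 i"
  by (cases \<sigma>, simp add: queue_lengths_def split: option.split, cases \<sigma>, simp)

lemma finite_pending_events [simp]: "finite (pending_events (\<sigma> :: 'n::finite config))"
proof -
  have "{Expiry i k | i k. k \<in> set (snd \<sigma> i)} = (\<Union>i. Expiry i ` set (snd \<sigma> i))" by auto
  then show ?thesis by (simp add: pending_events_alt)
qed

lemma pending_events_nonempty [simp]: "pending_events \<sigma> \<noteq> {}"
  by (simp add: pending_events_alt)

lemma config_after_Suc:
  "config_after \<phi> \<omega> (Suc n) = event_effect \<phi> (config_after \<phi> \<omega> n) (nth_event \<phi> \<omega> n)"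
  by (simp add: nth_event_def)

declare config_after.simps(2) [simp del]

lemma nth_event_pending:
  "nth_event \<phi> \<omega> n \<in> pending_events (config_after \<phi> \<omega> n :: 'n::finite config)"
  unfolding nth_event_def next_event_def by (intro arg_min_if_finite) auto

lemma nth_time_le:
  fixes \<phi> :: "'n::finite policy"
  assumes "v \<in> pending_events (config_after \<phi> \<omega> n)"
  shows "nth_time \<phi> \<omega> n \<le> event_time \<omega> (config_after \<phi> \<omega> n) v"
  using arg_min_if_finite(2)[of "pending_events (config_after \<phi> \<omega> n)"
      "event_time \<omega> (config_after \<phi> \<omega> n)"] assms
  unfolding nth_time_def nth_event_def next_event_def by (auto simp: not_less)

lemma nth_time_le_arrival:
  fixes \<phi> :: "'n::finite policy"
  shows "nth_time \<phi> \<omega> n \<le> arrival_time \<omega> i (fst (config_after \<phi> \<omega> n) i)"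
  using nth_time_le[of "Arrival i" \<phi> \<omega> n] by (simp add: pending_events_alt event_time_alt)

lemma nth_time_le_expiry:
  fixes \<phi> :: "'n::finite policy"
  assumes "k \<in> set (snd (config_after \<phi> \<omega> n) i)"
  shows "nth_time \<phi> \<omega> n \<le> expiry_time \<omega> i k"
  using nth_time_le[of "Expiry i k" \<phi> \<omega> n] assms by (auto simp add: pending_events_alt event_time_alt)

lemma nth_time_eq:
  "nth_event \<phi> \<omega> n = Arrival i \<Longrightarrow>
     nth_time \<phi> \<omega> n = arrival_time \<omega> i (fst (config_after \<phi> \<omega> n) i)"
  "nth_event \<phi> \<omega> n = Expiry i k \<Longrightarrow> nth_time \<phi> \<omega> n = expiry_time \<omega> i k"
  by (simp_all add: nth_time_def event_time_alt)

lemma expiring_is_waiting: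
  "nth_event \<phi> \<omega> n = Expiry i k \<Longrightarrow> k \<in> set (snd (config_after \<phi> \<omega> n :: 'n::finite config) i)"
  using nth_event_pending[of \<phi> \<omega> n] by (auto simp: pending_events_alt)

subsection \<open>The past does not depend on later clocks\<close>

text \<open>Truncation at \<open>t\<close> expresses equal information strictly before
  \<open>t\<close>: two times must be equal unless both are at least \<open>t\<close>. All potential
  expiries are compared, including those of demands that a policy would have matched.\<close>

definition agree_until :: "real \<Rightarrow> 'n sample \<Rightarrow> 'n sample \<Rightarrow> bool" where
  "agree_until t \<omega> \<omega>' \<longleftrightarrow> (\<forall>i k. min (arrival_time \<omega> i k) t = min (arrival_time \<omega>' i k) t \<and>
     min (expiry_time \<omega> i k) t = min (expiry_time \<omega>' i k) t)"

lemma agree_until_sym: "agree_until t \<omega> \<omega>' \<Longrightarrow> agree_until t \<omega>' \<omega>"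
  by (simp add: agree_until_def)

lemma agree_until_event_time:
  assumes "agree_until t \<omega> \<omega>'"
  shows "min (event_time \<omega> \<sigma> v) t = min (event_time \<omega>' \<sigma> v) t"
  using assms by (cases v) (simp_all add: event_time_alt agree_until_def)

text \<open>\<open>arg_min_on\<close> chooses among the minimisers, so the two predicates of being a
  minimiser are shown to coincide. A value below \<open>t\<close> somewhere forces all minimisers
  below \<open>t\<close>, where the functions agree.\<close>

lemma arg_min_on_cong_below:
  fixes f g :: "'a \<Rightarrow> real"
  assumes fg: "\<And>x. x \<in> P \<Longrightarrow> min (f x) t = min (g x) t" and z: "z \<in> P" "f z < t"
  shows "arg_min_on f P = arg_min_on g P"
proof -
  have eq: "f x < t \<longleftrightarrow> g x < t" "f x < t \<Longrightarrow> g x = f x" if "x \<in> P" for x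
    using fg[OF that] by (auto simp: min_def split: if_splits)
  have sub: "is_arg_min f (\<lambda>x. x \<in> P) x \<Longrightarrow> is_arg_min g (\<lambda>x. x \<in> P) x"
    if eq: "\<And>x. x \<in> P \<Longrightarrow> f x < t \<longleftrightarrow> g x < t" "\<And>x. x \<in> P \<Longrightarrow> f x < t \<Longrightarrow> g x = f x"
      and z: "f z < t" for f g :: "'a \<Rightarrow> real" and x
  proof -
    assume x: "is_arg_min f (\<lambda>x. x \<in> P) x"
    then have xP: "x \<in> P" and le: "\<And>y. y \<in> P \<Longrightarrow> f x \<le> f y"
      by (auto simp: is_arg_min_def not_less)
    have xt: "f x < t" using le[OF \<open>z \<in> P\<close>] z by simp
    have "g x \<le> g y" if "y \<in> P" for y
    proof (cases "f y < t")
      case True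
      then show ?thesis using eq(2)[OF that] eq(2)[OF xP xt] le[OF that] by simp
    next
      case False
      then have "\<not> g y < t" using eq(1)[OF that] by simp
      then show ?thesis using eq(2)[OF xP xt] xt by simp
    qed
    then show "is_arg_min g (\<lambda>x. x \<in> P) x" using xP by (auto simp: is_arg_min_def not_less)
  qed
  have gz: "g z < t" using eq(1)[OF z(1)] z(2) by simp
  have "is_arg_min f (\<lambda>x. x \<in> P) = is_arg_min g (\<lambda>x. x \<in> P)"
  proof (intro ext iffI)
    fix x
    show "is_arg_min g (\<lambda>x. x \<in> P) x" if "is_arg_min f (\<lambda>x. x \<in> P) x"
      by (rule sub[OF eq z(2) that])
    show "is_arg_min f (\<lambda>x. x \<in> P) x" if "is_arg_min g (\<lambda>x. x \<in> P) x"
      by (rule sub[OF _ _ gz that]) (use eq in blast, use eq in metis)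
  qed
  then show ?thesis
    unfolding arg_min_on_def arg_min_def by simp
qed

lemma agree_until_event:
  fixes \<sigma> :: "'n::finite config"
  assumes ag: "agree_until t \<omega> \<omega>'" and "event_time \<omega> \<sigma> (next_event \<omega> \<sigma>) < t"
  shows "next_event \<omega>' \<sigma> = next_event \<omega> \<sigma>"
    "event_time \<omega>' \<sigma> (next_event \<omega>' \<sigma>) = event_time \<omega> \<sigma> (next_event \<omega> \<sigma>)"
proof -
  have "next_event \<omega> \<sigma> \<in> pending_events \<sigma>"
    unfolding next_event_def by (intro arg_min_if_finite) auto
  from arg_min_on_cong_below[where f = "event_time \<omega> \<sigma>" and g = "event_time \<omega>' \<sigma>" and t = t,
      OF agree_until_event_time[OF ag] this assms(2)]
  show "next_event \<omega>' \<sigma> = next_event \<omega> \<sigma>"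
    by (simp add: next_event_def)
  then show "event_time \<omega>' \<sigma> (next_event \<omega>' \<sigma>) = event_time \<omega> \<sigma> (next_event \<omega> \<sigma>)"
    using agree_until_event_time[OF ag, of \<sigma> "next_event \<omega> \<sigma>"] assms(2)
    by (auto simp: min_def split: if_splits)
qed

lemma agree_until_config:
  fixes \<phi> :: "'n::finite policy"
  assumes ag: "agree_until t \<omega> \<omega>'" and "\<forall>m<n. nth_time \<phi> \<omega> m < t"
  shows "config_after \<phi> \<omega>' n = config_after \<phi> \<omega> n \<and> (\<forall>m<n. nth_time \<phi> \<omega>' m = nth_time \<phi> \<omega> m)"
  using assms(2)
proof (induction n)
  case (Suc n)
  then have IH: "config_after \<phi> \<omega>' n = config_after \<phi> \<omega> n"
    "\<forall>m<n. nth_time \<phi> \<omega>' m = nth_time \<phi> \<omega> m" and "nth_time \<phi> \<omega> n < t" by auto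
  then show ?case
    using agree_until_event[OF ag, of "config_after \<phi> \<omega> n"]
    by (auto simp: config_after_Suc nth_time_def nth_event_def less_Suc_eq)
qed auto

text \<open>This is shown for every sample point, as the intensity formulas demand locality
  everywhere. Event times may fail to increase at irregular points, so the argument follows the
  first index whose time reaches \<open>t\<close>.\<close>

lemma agree_until_config_before:
  fixes \<phi> :: "'n::finite policy"
  assumes ag: "agree_until t \<omega> \<omega>'"
  shows "config_before \<phi> \<omega> t = config_before \<phi> \<omega>' t"
proof -
  have *: "\<exists>m\<le>n. t \<le> nth_time \<phi> \<omega> m" if ag: "agree_until t \<omega> \<omega>'" and "t \<le> nth_time \<phi> \<omega>' n"
    for n and \<omega> \<omega>' :: "'n sample"
  proof (rule ccontr)
    assume "\<not> ?thesis"
    then have "\<forall>m<Suc n. nth_time \<phi> \<omega> m < t" by (metis not_le less_Suc_eq_le)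
    with agree_until_config[OF ag this] that(2) show False by auto
  qed
  have **: "(LEAST n. t \<le> nth_time \<phi> \<omega> n) = n"
    if ag: "agree_until t \<omega> \<omega>'" and n: "t \<le> nth_time \<phi> \<omega>' n" "n = (LEAST n. t \<le> nth_time \<phi> \<omega>' n)"
    for n and \<omega> \<omega>' :: "'n sample"
  proof -
    have "\<forall>m<n. nth_time \<phi> \<omega>' m < t" using n(2) not_less_Least not_le by blast
    then have "\<forall>m<n. nth_time \<phi> \<omega> m < t"
      using agree_until_config[OF agree_until_sym[OF ag]] by metis
    moreover obtain m where "m \<le> n" "t \<le> nth_time \<phi> \<omega> m" using *[OF ag n(1)] by auto
    ultimately have "t \<le> nth_time \<phi> \<omega> n" by (metis le_neq_implies_less not_le)
    then show ?thesis
      using \<open>\<forall>m<n. nth_time \<phi> \<omega> m < t\<close> by (intro Least_equality) (auto simp: not_le[symmetric])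
  qed
  show ?thesis
  proof (cases "\<exists>n. t \<le> nth_time \<phi> \<omega> n")
    case True
    define n where "n = (LEAST n. t \<le> nth_time \<phi> \<omega> n)"
    have "t \<le> nth_time \<phi> \<omega> n" unfolding n_def using True by (rule LeastI_ex)
    from **[OF agree_until_sym[OF ag] this n_def] have "(LEAST n. t \<le> nth_time \<phi> \<omega>' n) = n" .
    moreover have "\<forall>m<n. nth_time \<phi> \<omega> m < t" using n_def not_less_Least not_le by blast
    ultimately show ?thesis
      using agree_until_config[OF ag, of n \<phi>] by (simp add: config_before_def n_def)
  next
    case False
    \<comment> \<open>No event reaches \<open>t\<close>, so both \<open>LEAST\<close> terms range
      over predicates that are false everywhere and denote the same unspecified index, at which the
      configurations agree.\<close>
    then have lt: "nth_time \<phi> \<omega> m < t" for m by (auto simp: not_le)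
    then have "nth_time \<phi> \<omega>' m = nth_time \<phi> \<omega> m" for m
      using agree_until_config[OF ag, of "Suc m" \<phi>] by auto
    then show ?thesis
      using agree_until_config[OF ag, of _ \<phi>] lt by (simp add: config_before_def)
  qed
qed

subsection \<open>Regular sample points\<close>

definition positive_clocks :: "'n sample \<Rightarrow> bool" where
  "positive_clocks \<omega> \<longleftrightarrow> (\<forall>p. 0 < fst (\<omega> p) \<and> 0 < snd (\<omega> p))"

definition no_ties :: "'n sample \<Rightarrow> bool" where
  "no_ties \<omega> \<longleftrightarrow> inj (case_sum (case_prod (arrival_time \<omega>)) (case_prod (expiry_time \<omega>)))"

lemma no_tiesD:
  assumes "no_ties \<omega>"
  shows "arrival_time \<omega> i k = arrival_time \<omega> j l \<Longrightarrow> i = j \<and> k = l"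
    "expiry_time \<omega> i k = expiry_time \<omega> j l \<Longrightarrow> i = j \<and> k = l"
    "arrival_time \<omega> i k \<noteq> expiry_time \<omega> j l"
  using injD[OF assms[unfolded no_ties_def], of "Inl (i, k)" "Inl (j, l)"]
    injD[OF assms[unfolded no_ties_def], of "Inr (i, k)" "Inr (j, l)"]
    injD[OF assms[unfolded no_ties_def], of "Inl (i, k)" "Inr (j, l)"] by auto

lemma arrival_time_Suc: "arrival_time \<omega> i (Suc k) = arrival_time \<omega> i k + fst (\<omega> (i, Suc k))"
  by (simp add: arrival_time_def)

definition prev_arrival_time :: "'n sample \<Rightarrow> 'n \<Rightarrow> nat \<Rightarrow> real" where
  "prev_arrival_time \<omega> i k = (case k of 0 \<Rightarrow> 0 | Suc l \<Rightarrow> arrival_time \<omega> i l)"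

lemma arrival_time_eq_prev: "arrival_time \<omega> i k = prev_arrival_time \<omega> i k + fst (\<omega> (i, k))"
  by (cases k) (simp_all add: prev_arrival_time_def arrival_time_def)

definition count_events ::
  "('n config \<Rightarrow> 'n event \<Rightarrow> bool) \<Rightarrow> 'n policy \<Rightarrow> real \<Rightarrow> 'n sample \<Rightarrow> ennreal" where
  "count_events P \<phi> T \<omega> = (\<Sum>n. of_bool (nth_time \<phi> \<omega> n \<le> T \<and>
     P (config_after \<phi> \<omega> n) (nth_event \<phi> \<omega> n)))"

text \<open>Events at time \<open>T\<close> itself are included here, unlike in
  \<open>config_before\<close>, to match the counts of events with time at most
  \<open>T\<close>.\<close>

definition final_queue :: "'n policy \<Rightarrow> real \<Rightarrow> 'n sample \<Rightarrow> 'n \<Rightarrow> nat" where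
  "final_queue \<phi> T \<omega> = queue_lengths (config_after \<phi> \<omega> (LEAST n. T < nth_time \<phi> \<omega> n))"

text \<open>Tonelli for sums, read off from the integral over counting measure.\<close>

lemma suminf_swap_ennreal: "(\<Sum>n. \<Sum>k. f n k) = (\<Sum>k. \<Sum>n. f n k :: ennreal)"
  using nn_integral_suminf[of "\<lambda>k n. f n k" "count_space UNIV"]
  by (simp add: nn_integral_count_space_nat)

lemma suminf_single:
  fixes f :: "nat \<Rightarrow> ennreal"
  assumes "\<And>n. n \<noteq> m \<Longrightarrow> f n = 0"
  shows "(\<Sum>n. f n) = f m"
  using suminf_finite[of "{m}" f] assms by simp

locale regular_sample =
  fixes \<omega> :: "'n::finite sample" and \<phi> :: "'n policy"
  assumes pos: "positive_clocks \<omega>"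
    and no_ties: "no_ties \<omega>"
    and unbounded: "\<And>i t. \<exists>k. t \<le> arrival_time \<omega> i k"
    and adm: "\<phi> \<in> admissible_policies"
begin

abbreviation "\<sigma> \<equiv> config_after \<phi> \<omega>"
abbreviation "evt \<equiv> nth_event \<phi> \<omega>"
abbreviation "tm \<equiv> nth_time \<phi> \<omega>"

lemma arrival_time_strict_mono: "strict_mono (arrival_time \<omega> i)"
  using pos by (auto simp: strict_mono_Suc_iff arrival_time_Suc positive_clocks_def)

lemma arrival_time_pos: "0 < arrival_time \<omega> i k"
  unfolding arrival_time_def using pos by (intro sum_pos) (auto simp: positive_clocks_def)

lemma arrival_before_expiry: "arrival_time \<omega> i k < expiry_time \<omega> i k"
  using pos by (simp add: expiry_time_def positive_clocks_def)

lemma policy_Some_nonempty: "\<phi> i (queue_lengths s) = Some j \<Longrightarrow> snd s j \<noteq> []"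
  using adm unfolding admissible_policies_def queue_lengths_def by fastforce

lemma fst_mono: "m \<le> n \<Longrightarrow> fst (\<sigma> m) i \<le> fst (\<sigma> n) i"
proof (induction rule: dec_induct)
  case (step n)
  then show ?case by (cases "evt n") (auto simp: config_after_Suc event_effect_alt)
qed auto

lemma queue_wf: "distinct (snd (\<sigma> n) i) \<and> (\<forall>k\<in>set (snd (\<sigma> n) i). k < fst (\<sigma> n) i)"
proof (induction n)
  case (Suc n)
  show ?case
  proof (cases "evt n")
    case (Arrival j)
    have tl: "k \<in> set (tl q) \<Longrightarrow> k \<in> set q" for k :: nat and q by (cases q) auto
    show ?thesis
    proof (cases "\<phi> j (queue_lengths (\<sigma> n))")
      case None
      then show ?thesis using Suc Arrival
        by (fastforce simp: config_after_Suc event_effect_alt)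
    next
      case (Some l)
      then show ?thesis using Suc Arrival
        by (auto simp: config_after_Suc event_effect_alt distinct_tl dest!: tl intro: less_SucI)
    qed
  next
    case (Expiry j k)
    then show ?thesis using Suc
      by (auto simp: config_after_Suc event_effect_alt dest: notin_set_remove1)
  qed
qed simp

text \<open>A demand expiring at step \<open>Suc n\<close> either waited already at step
  \<open>n\<close>, so that its expiry was a candidate there, or it arrived at step \<open>n\<close>
  and has a positive sojourn time.\<close>

lemma tm_mono_Suc: "tm n \<le> tm (Suc n)"
proof (cases "evt (Suc n)")
  case (Arrival i)
  have "tm n \<le> arrival_time \<omega> i (fst (\<sigma> n) i)" by (rule nth_time_le_arrival)
  also have "\<dots> \<le> arrival_time \<omega> i (fst (\<sigma> (Suc n)) i)"
    using fst_mono[of n "Suc n"] by (simp add: strict_mono_less_eq[OF arrival_time_strict_mono])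
  finally show ?thesis using nth_time_eq(1)[OF Arrival] by simp
next
  case (Expiry i k)
  then have k: "k \<in> set (snd (\<sigma> (Suc n)) i)" by (rule expiring_is_waiting)
  have "tm n \<le> expiry_time \<omega> i k"
  proof (cases "k \<in> set (snd (\<sigma> n) i)")
    case True
    then show ?thesis by (rule nth_time_le_expiry)
  next
    case False
    have tl: "k \<in> set (tl q) \<Longrightarrow> k \<in> set q" for q by (cases q) auto
    have "k = fst (\<sigma> n) i \<and> evt n = Arrival i"
    proof (cases "evt n")
      case (Arrival j)
      then show ?thesis using k False
        by (cases "\<phi> j (queue_lengths (\<sigma> n))")
          (auto simp: config_after_Suc event_effect_alt split: if_splits dest: tl)
    next
      case (Expiry j l)
      then show ?thesis using k False
        by (auto simp: config_after_Suc event_effect_alt split: if_splits dest: notin_set_remove1)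
    qed
    then have "tm n = arrival_time \<omega> i k" using nth_time_eq(1)[of \<phi> \<omega> n i] by simp
    then show ?thesis using arrival_before_expiry[of i k] by simp
  qed
  then show ?thesis using nth_time_eq(2)[OF Expiry] by simp
qed

text \<open>Equal times would mean the same clock ringing twice, but an arrival advances its counter
  and an expired demand, listed only once, has left its queue.\<close>

lemma tm_neq_Suc: "tm n \<noteq> tm (Suc n)"
proof
  assume eq: "tm n = tm (Suc n)"
  show False
  proof (cases "evt n")
    case (Arrival i)
    note e = nth_time_eq(1)[OF this]
    have f: "fst (\<sigma> (Suc n)) i = Suc (fst (\<sigma> n) i)"
      using Arrival by (simp add: config_after_Suc event_effect_alt)
    show False
    proof (cases "evt (Suc n)")
      case (Arrival j)
      then have "arrival_time \<omega> i (fst (\<sigma> n) i) = arrival_time \<omega> j (fst (\<sigma> (Suc n)) j)"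
        using e eq nth_time_eq(1)[OF Arrival] by simp
      then have "i = j" "fst (\<sigma> n) i = fst (\<sigma> (Suc n)) j"
        using no_tiesD(1)[OF no_ties] by blast+
      then show False using f by simp
    next
      case (Expiry j l)
      then show False using e eq nth_time_eq(2)[OF Expiry] no_tiesD(3)[OF no_ties] by metis
    qed
  next
    case (Expiry i k)
    note e = nth_time_eq(2)[OF this]
    have f: "k \<notin> set (snd (\<sigma> (Suc n)) i)"
      using Expiry queue_wf by (simp add: config_after_Suc event_effect_alt)
    show False
    proof (cases "evt (Suc n)")
      case (Arrival j)
      then show False using e eq nth_time_eq(1)[OF Arrival] no_tiesD(3)[OF no_ties] by metis
    next
      case (Expiry j l)
      then show False
        using e eq f nth_time_eq(2)[OF Expiry] no_tiesD(2)[OF no_ties] expiring_is_waiting by metis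
    qed
  qed
qed

lemma tm_strict_mono: "strict_mono tm"
  using tm_mono_Suc tm_neq_Suc by (auto simp: strict_mono_Suc_iff less_le)

text \<open>Every event increases twice the number of arrivals minus the number of waiting demands.\<close>

lemma events_le_arrivals: "n + (\<Sum>i\<in>UNIV. queue_lengths (\<sigma> n) i) \<le> 2 * (\<Sum>i\<in>UNIV. fst (\<sigma> n) i)"
proof (induction n)
  case 0
  then show ?case by (simp add: queue_lengths_def)
next
  case (Suc n)
  have split: "(\<Sum>i\<in>UNIV. f i) = f j + (\<Sum>i\<in>UNIV - {j}. f i)" for f :: "'n \<Rightarrow> nat" and j
    by (simp add: sum.remove)
  show ?case
  proof (cases "evt n")
    case (Arrival j)
    have a: "(\<Sum>i\<in>UNIV. fst (\<sigma> (Suc n)) i) = Suc (\<Sum>i\<in>UNIV. fst (\<sigma> n) i)"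
      using Arrival by (simp add: split[of _ j] config_after_Suc event_effect_alt)
    show ?thesis
    proof (cases "\<phi> j (queue_lengths (\<sigma> n))")
      case None
      then have "(\<Sum>i\<in>UNIV. queue_lengths (\<sigma> (Suc n)) i) = Suc (\<Sum>i\<in>UNIV. queue_lengths (\<sigma> n) i)"
        using Arrival by (simp add: split[of _ j] config_after_Suc event_effect_alt queue_lengths_def)
      then show ?thesis using a Suc by simp
    next
      case (Some l)
      then have "(\<Sum>i\<in>UNIV. queue_lengths (\<sigma> (Suc n)) i) \<le> (\<Sum>i\<in>UNIV. queue_lengths (\<sigma> n) i)"
        using Arrival by (intro sum_mono) (simp add: config_after_Suc event_effect_alt queue_lengths_def)
      then show ?thesis using a Suc by simp
    qed
  next
    case (Expiry j k)
    have "k \<in> set (snd (\<sigma> n) j)" using Expiry by (rule expiring_is_waiting)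
    moreover from this have "0 < length (snd (\<sigma> n) j)" by (rule length_pos_if_in_set)
    ultimately have "Suc (\<Sum>i\<in>UNIV. queue_lengths (\<sigma> (Suc n)) i) = (\<Sum>i\<in>UNIV. queue_lengths (\<sigma> n) i)"
      using Expiry
      by (simp add: split[of _ j] config_after_Suc event_effect_alt queue_lengths_def length_remove1)
    then show ?thesis
      using Suc Expiry by (simp add: config_after_Suc event_effect_alt)
  qed
qed

lemma arrival_processed: "k < fst (\<sigma> n) i \<Longrightarrow> \<exists>m<n. evt m = Arrival i \<and> fst (\<sigma> m) i = k"
proof (induction n)
  case (Suc n)
  show ?case
  proof (cases "k < fst (\<sigma> n) i")
    case True
    then show ?thesis using Suc by (auto intro: less_SucI)
  next
    case False
    then show ?thesis using Suc.prems
      by (cases "evt n") (auto simp: config_after_Suc event_effect_alt less_Suc_eq split: if_splits)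
  qed
qed simp

text \<open>Non-explosion: bounded event times would bound every arrival counter, and the number of
  events is at most twice the number of arrivals.\<close>

lemma tm_unbounded: "\<exists>n. t \<le> tm n"
proof (rule ccontr)
  assume "\<not> ?thesis"
  then have lt: "tm n < t" for n by (auto simp: not_le)
  obtain K where K: "t \<le> arrival_time \<omega> i (K i)" for i
    using unbounded[of t] by metis
  have "fst (\<sigma> n) i \<le> K i" for n i
  proof (rule ccontr)
    assume "\<not> ?thesis"
    then obtain m where "evt m = Arrival i" "fst (\<sigma> m) i = K i"
      using arrival_processed[of "K i" n i] by auto
    then show False using nth_time_eq(1)[of \<phi> \<omega> m i] lt[of m] K[of i] by simp
  qed
  then have "n \<le> 2 * (\<Sum>i\<in>UNIV. K i)" for n
    using events_le_arrivals[of n] sum_mono[of UNIV "fst (\<sigma> n)" K] by simp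
  from this[of "Suc (2 * (\<Sum>i\<in>UNIV. K i))"] show False by simp
qed

lemma config_before_tm: "config_before \<phi> \<omega> (tm n) = \<sigma> n"
proof -
  have "(LEAST m. tm n \<le> tm m) = n"
    by (rule Least_equality) (auto simp: strict_mono_less_eq[OF tm_strict_mono])
  then show ?thesis by (simp add: config_before_def)
qed

lemma config_before_cases:
  obtains n where "config_before \<phi> \<omega> t = \<sigma> n" "t \<le> tm n" "\<And>m. m < n \<Longrightarrow> tm m < t"
proof
  show "config_before \<phi> \<omega> t = \<sigma> (LEAST n. t \<le> tm n)" by (simp add: config_before_def)
  show "t \<le> tm (LEAST n. t \<le> tm n)" by (rule LeastI_ex) (rule tm_unbounded)
qed (use not_less_Least not_le in blast)

section \<open>From event numbers to individual demands\<close>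

lemma ex1_arrival: "\<exists>!n. evt n = Arrival i \<and> fst (\<sigma> n) i = k"
proof -
  obtain m where m: "arrival_time \<omega> i k < tm m"
    using tm_unbounded[of "arrival_time \<omega> i k + 1"] less_le_trans[OF less_add_one] by metis
  have "k < fst (\<sigma> m) i"
    using less_le_trans[OF m nth_time_le_arrival[of \<phi> \<omega> m i]]
    by (simp add: strict_mono_less[OF arrival_time_strict_mono])
  then obtain n where n: "evt n = Arrival i" "fst (\<sigma> n) i = k"
    using arrival_processed by blast
  moreover have "n' = n" if "evt n' = Arrival i" "fst (\<sigma> n') i = k" for n'
    using that n strict_mono_eq[OF tm_strict_mono] nth_time_eq(1) by metis
  ultimately show ?thesis by blast
qed

text \<open>The interval, open on the left and closed on the right, is exactly the one during which
  the sojourn clock runs in \<open>clock_intensity\<close>.\<close>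

lemma waiting_bounds:
  assumes "k \<in> set (snd (config_before \<phi> \<omega> t) i)"
  shows "arrival_time \<omega> i k < t" "t \<le> expiry_time \<omega> i k"
proof -
  obtain n where n: "config_before \<phi> \<omega> t = \<sigma> n" "t \<le> tm n" "\<And>m. m < n \<Longrightarrow> tm m < t"
    using config_before_cases[of t] by blast
  with assms have k: "k \<in> set (snd (\<sigma> n) i)" by simp
  then show "t \<le> expiry_time \<omega> i k" using n(2) nth_time_le_expiry by fastforce
  obtain m where "m < n" "evt m = Arrival i" "fst (\<sigma> m) i = k"
    using queue_wf k arrival_processed by blast
  then show "arrival_time \<omega> i k < t" using n(3) nth_time_eq(1) by fastforce
qed

text \<open>Whether a demand expires unmatched is visible in the configuration just before its
  expiry time, which is the form of integrand that \<open>expiry_intensity\<close> accepts.\<close>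

lemma evt_Expiry_iff:
  "(\<exists>n. evt n = Expiry i k) \<longleftrightarrow> k \<in> set (snd (config_before \<phi> \<omega> (expiry_time \<omega> i k)) i)"
proof
  assume "\<exists>n. evt n = Expiry i k"
  then obtain n where n: "evt n = Expiry i k" ..
  then have "config_before \<phi> \<omega> (expiry_time \<omega> i k) = \<sigma> n"
    using config_before_tm[of n] nth_time_eq(2)[OF n] by simp
  then show "k \<in> set (snd (config_before \<phi> \<omega> (expiry_time \<omega> i k)) i)"
    using expiring_is_waiting[OF n] by simp
next
  assume k: "k \<in> set (snd (config_before \<phi> \<omega> (expiry_time \<omega> i k)) i)"
  obtain n where n: "config_before \<phi> \<omega> (expiry_time \<omega> i k) = \<sigma> n" "expiry_time \<omega> i k \<le> tm n"
    using config_before_cases by metis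
  have "tm n = expiry_time \<omega> i k" using n k nth_time_le_expiry[of k \<phi> \<omega> n i] by simp
  then have "evt n = Expiry i k"
  proof (cases "evt n")
    case (Arrival j)
    then show ?thesis
      using \<open>tm n = _\<close> nth_time_eq(1)[OF Arrival] no_tiesD(3)[OF no_ties] by metis
  next
    case (Expiry j l)
    then have "expiry_time \<omega> j l = expiry_time \<omega> i k"
      using \<open>tm n = _\<close> nth_time_eq(2)[OF Expiry] by simp
    then show ?thesis using no_tiesD(2)[OF no_ties] Expiry by blast
  qed
  then show "\<exists>n. evt n = Expiry i k" ..
qed

lemma evt_Expiry_inj: "evt n = Expiry i k \<Longrightarrow> evt m = Expiry i k \<Longrightarrow> m = n"
  using strict_mono_eq[OF tm_strict_mono] nth_time_eq(2) by metis

text \<open>Each arrival ends as the waiting side of a match, as the arriving side, by expiry, or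
  still in the queue. A match of two demands of type \<open>i\<close> enters both double sums, just
  as \<open>x i i\<close> enters the program's balance twice.\<close>

lemma balance:
  "(\<Sum>m<n. of_bool (evt m = Arrival i)) =
     (\<Sum>j\<in>UNIV. \<Sum>m<n. of_bool (evt m = Arrival j \<and> \<phi> j (queue_lengths (\<sigma> m)) = Some i)) +
     (\<Sum>j\<in>UNIV. \<Sum>m<n. of_bool (evt m = Arrival i \<and> \<phi> i (queue_lengths (\<sigma> m)) = Some j)) +
     (\<Sum>m<n. of_bool (\<exists>k. evt m = Expiry i k)) + queue_lengths (\<sigma> n) i"
proof (induction n)
  case (Suc n)
  have delta: "(\<Sum>j\<in>UNIV. of_bool (a = j \<and> P)) = (of_bool P :: nat)" for a :: 'n and P
    by (cases P) (simp_all add: of_bool_def)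
  have "of_bool (evt n = Arrival i) + queue_lengths (\<sigma> n) i =
     (\<Sum>j\<in>UNIV. of_bool (evt n = Arrival j \<and> \<phi> j (queue_lengths (\<sigma> n)) = Some i)) +
     (\<Sum>j\<in>UNIV. of_bool (evt n = Arrival i \<and> \<phi> i (queue_lengths (\<sigma> n)) = Some j)) +
     of_bool (\<exists>k. evt n = Expiry i k) + queue_lengths (\<sigma> (Suc n)) i"
  proof (cases "evt n")
    case (Arrival l)
    have "(\<Sum>j\<in>UNIV. of_bool (l = j \<and> \<phi> j (queue_lengths (\<sigma> n)) = Some i)) =
        (\<Sum>j\<in>UNIV. of_bool (l = j \<and> \<phi> l (queue_lengths (\<sigma> n)) = Some i) :: nat)"
      by (intro sum.cong) auto
    moreover have "(\<Sum>j\<in>UNIV. of_bool (l = i \<and> \<phi> i (queue_lengths (\<sigma> n)) = Some j)) =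
        (of_bool (l = i \<and> \<phi> l (queue_lengths (\<sigma> n)) \<noteq> None) :: nat)"
      by (cases "\<phi> i (queue_lengths (\<sigma> n))") (auto simp: of_bool_def)
    ultimately show ?thesis
      using Arrival policy_Some_nonempty[of l "\<sigma> n"]
      by (cases "\<phi> l (queue_lengths (\<sigma> n))")
        (auto simp: delta config_after_Suc event_effect_alt queue_lengths_def)
  next
    case (Expiry l k)
    have "k \<in> set (snd (\<sigma> n) l)" using Expiry by (rule expiring_is_waiting)
    moreover from this have "0 < length (snd (\<sigma> n) l)" by (rule length_pos_if_in_set)
    ultimately show ?thesis
      using Expiry by (auto simp: config_after_Suc event_effect_alt queue_lengths_def length_remove1)
  qed
  then show ?case using Suc by (simp add: sum.distrib)
qed (simp add: queue_lengths_def)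

text \<open>Each clock belongs to a demand, so the sum over events is rewritten as a sum over
  demands: every event is tagged with its demand index and the two sums are exchanged.\<close>

lemma count_arrivals:
  "count_events (\<lambda>s v. v = Arrival i \<and> P (queue_lengths s)) \<phi> T \<omega> =
     (\<Sum>k. of_bool (arrival_time \<omega> i k \<le> T \<and> P (queue_lengths (config_before \<phi> \<omega> (arrival_time \<omega> i k)))))"
proof -
  let ?f = "\<lambda>n k. of_bool (tm n \<le> T \<and> evt n = Arrival i \<and> P (queue_lengths (\<sigma> n)) \<and> fst (\<sigma> n) i = k) :: ennreal"
  have "count_events (\<lambda>s v. v = Arrival i \<and> P (queue_lengths s)) \<phi> T \<omega> = (\<Sum>n. \<Sum>k. ?f n k)"
    unfolding count_events_def
  proof (intro suminf_cong)
    fix n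
    show "of_bool (tm n \<le> T \<and> evt n = Arrival i \<and> P (queue_lengths (\<sigma> n))) = (\<Sum>k. ?f n k)"
      by (subst suminf_single[where m = "fst (\<sigma> n) i"]) auto
  qed
  also have "\<dots> = (\<Sum>k. \<Sum>n. ?f n k)" by (rule suminf_swap_ennreal)
  also have "\<dots> = (\<Sum>k. of_bool (arrival_time \<omega> i k \<le> T \<and>
      P (queue_lengths (config_before \<phi> \<omega> (arrival_time \<omega> i k)))))"
  proof (intro suminf_cong)
    fix k
    obtain m where m: "evt m = Arrival i" "fst (\<sigma> m) i = k"
      and uniq: "\<And>n. evt n = Arrival i \<Longrightarrow> fst (\<sigma> n) i = k \<Longrightarrow> n = m"
      using ex1_arrival[of i k] by blast
    have t: "tm m = arrival_time \<omega> i k" using nth_time_eq(1)[OF m(1)] m(2) by simp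
    then have "config_before \<phi> \<omega> (arrival_time \<omega> i k) = \<sigma> m" using config_before_tm[of m] by simp
    moreover have "?f n k = 0" if "n \<noteq> m" for n using uniq[of n] that by auto
    then have "(\<Sum>n. ?f n k) = ?f m k" by (rule suminf_single)
    ultimately show "(\<Sum>n. ?f n k) = of_bool (arrival_time \<omega> i k \<le> T \<and>
        P (queue_lengths (config_before \<phi> \<omega> (arrival_time \<omega> i k))))"
      using m t by simp
  qed
  finally show ?thesis .
qed

lemma count_expiries:
  "count_events (\<lambda>s v. \<exists>k. v = Expiry i k) \<phi> T \<omega> =
     (\<Sum>k. of_bool (expiry_time \<omega> i k \<le> T \<and>
        k \<in> set (snd (config_before \<phi> \<omega> (expiry_time \<omega> i k)) i)))"
proof -
  let ?f = "\<lambda>n k. of_bool (tm n \<le> T \<and> evt n = Expiry i k) :: ennreal"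
  have "count_events (\<lambda>s v. \<exists>k. v = Expiry i k) \<phi> T \<omega> = (\<Sum>n. \<Sum>k. ?f n k)"
    unfolding count_events_def
  proof (intro suminf_cong)
    fix n
    show "of_bool (tm n \<le> T \<and> (\<exists>k. evt n = Expiry i k)) = (\<Sum>k. ?f n k)"
    proof (cases "\<exists>k. evt n = Expiry i k")
      case True
      then obtain m where "evt n = Expiry i m" ..
      then show ?thesis by (subst suminf_single[where m = m]) auto
    qed simp
  qed
  also have "\<dots> = (\<Sum>k. \<Sum>n. ?f n k)" by (rule suminf_swap_ennreal)
  also have "\<dots> = (\<Sum>k. of_bool (expiry_time \<omega> i k \<le> T \<and>
        k \<in> set (snd (config_before \<phi> \<omega> (expiry_time \<omega> i k)) i)))"
  proof (intro suminf_cong)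
    fix k
    show "(\<Sum>n. ?f n k) = of_bool (expiry_time \<omega> i k \<le> T \<and>
        k \<in> set (snd (config_before \<phi> \<omega> (expiry_time \<omega> i k)) i))"
    proof (cases "\<exists>n. evt n = Expiry i k")
      case True
      then obtain m where m: "evt m = Expiry i k" ..
      have "?f n k = 0" if "n \<noteq> m" for n using evt_Expiry_inj[OF m, of n] that by auto
      then have "(\<Sum>n. ?f n k) = ?f m k" by (rule suminf_single)
      then show ?thesis
        using m True evt_Expiry_iff[of i k] nth_time_eq(2)[OF m] by simp
    next
      case False
      then show ?thesis using evt_Expiry_iff[of i k] by simp
    qed
  qed
  finally show ?thesis .
qed

lemma final_cases:
  obtains n where "final_queue \<phi> T \<omega> = queue_lengths (\<sigma> n)" "T < tm n" "\<And>m. m < n \<longleftrightarrow> tm m \<le> T"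
proof
  let ?n = "LEAST n. T < tm n"
  show "final_queue \<phi> T \<omega> = queue_lengths (\<sigma> ?n)" by (simp add: final_queue_def)
  have "\<exists>n. T < tm n"
    using tm_unbounded[of "T + 1"] less_le_trans[OF less_add_one] by metis
  then show *: "T < tm ?n" by (rule LeastI_ex)
  show "m < ?n \<longleftrightarrow> tm m \<le> T" for m
  proof
    show "tm m \<le> T" if "m < ?n" using not_less_Least[OF that] by simp
    show "m < ?n" if "tm m \<le> T"
      using le_less_trans[OF that *] by (simp add: strict_mono_less[OF tm_strict_mono])
  qed
qed

lemma count_events_finite:
  assumes "\<And>m. m < n \<longleftrightarrow> tm m \<le> T"
  shows "count_events P \<phi> T \<omega> = of_nat (\<Sum>m<n. of_bool (P (\<sigma> m) (evt m)))"
proof -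
  have "count_events P \<phi> T \<omega> = (\<Sum>m<n. of_bool (tm m \<le> T \<and> P (\<sigma> m) (evt m)))"
    unfolding count_events_def using assms by (intro suminf_finite) auto
  also have "\<dots> = (\<Sum>m<n. of_nat (of_bool (P (\<sigma> m) (evt m))))"
    using assms by (intro sum.cong) (auto simp: of_bool_def)
  finally show ?thesis by simp
qed

lemma count_balance:
  "count_events (\<lambda>s v. v = Arrival i) \<phi> T \<omega> =
     (\<Sum>j\<in>UNIV. count_events (\<lambda>s v. v = Arrival j \<and> \<phi> j (queue_lengths s) = Some i) \<phi> T \<omega>) +
     (\<Sum>j\<in>UNIV. count_events (\<lambda>s v. v = Arrival i \<and> \<phi> i (queue_lengths s) = Some j) \<phi> T \<omega>) +
     count_events (\<lambda>s v. \<exists>k. v = Expiry i k) \<phi> T \<omega> + of_nat (final_queue \<phi> T \<omega> i)"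
proof -
  obtain n where n: "final_queue \<phi> T \<omega> = queue_lengths (\<sigma> n)" "\<And>m. m < n \<longleftrightarrow> tm m \<le> T"
    using final_cases[of T] by metis
  show ?thesis
    unfolding count_events_finite[OF n(2)] n(1) balance[where n = n and i = i] by simp
qed

lemma final_queue_le:
  "of_nat (final_queue \<phi> T \<omega> i) \<le>
     (\<Sum>k. of_bool (arrival_time \<omega> i k \<le> T \<and> T < expiry_time \<omega> i k) :: ennreal)"
proof -
  obtain n where n: "final_queue \<phi> T \<omega> = queue_lengths (\<sigma> n)" "T < tm n" "\<And>m. m < n \<longleftrightarrow> tm m \<le> T"
    using final_cases[of T] by metis
  let ?S = "set (snd (\<sigma> n) i)"
  have *: "arrival_time \<omega> i k \<le> T \<and> T < expiry_time \<omega> i k" if k: "k \<in> ?S" for k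
  proof
    show "T < expiry_time \<omega> i k" using n(2) nth_time_le_expiry[OF k] by simp
    obtain m where "m < n" "evt m = Arrival i" "fst (\<sigma> m) i = k"
      using queue_wf k arrival_processed by blast
    then show "arrival_time \<omega> i k \<le> T" using n(3)[of m] nth_time_eq(1)[of \<phi> \<omega> m i] by simp
  qed
  have "of_nat (final_queue \<phi> T \<omega> i) = of_nat (card ?S)"
    using queue_wf by (simp add: n(1) queue_lengths_def distinct_card)
  also have "\<dots> = (\<Sum>k\<in>?S. of_bool (arrival_time \<omega> i k \<le> T \<and> T < expiry_time \<omega> i k) :: ennreal)"
    using * by simp
  also have "\<dots> \<le> (\<Sum>k. of_bool (arrival_time \<omega> i k \<le> T \<and> T < expiry_time \<omega> i k) :: ennreal)"
    by (rule sum_le_suminf) auto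
  finally show ?thesis .
qed

lemma sum_waiting:
  "(\<Sum>k. of_bool (k \<in> set (snd (config_before \<phi> \<omega> t) i)) :: ennreal) =
     of_nat (queue_lengths (config_before \<phi> \<omega> t) i)"
proof -
  obtain n where n: "config_before \<phi> \<omega> t = \<sigma> n" using config_before_cases[of t] by metis
  have "(\<Sum>k. of_bool (k \<in> set (snd (\<sigma> n) i)) :: ennreal) = of_nat (card (set (snd (\<sigma> n) i)))"
    by (subst suminf_finite[where N = "set (snd (\<sigma> n) i)"]) auto
  also have "\<dots> = of_nat (queue_lengths (\<sigma> n) i)"
    using queue_wf by (simp add: queue_lengths_def distinct_card)
  finally show ?thesis by (simp add: n)
qed

text \<open>The interarrival intervals tile the positive half-line. This turns the intensities of
  the single gaps into one integral over time.\<close>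

lemma sum_interarrival:
  assumes "0 < t"
  shows "(\<Sum>k. of_bool (prev_arrival_time \<omega> i k < t \<and> t \<le> arrival_time \<omega> i k)) = (1 :: ennreal)"
proof -
  obtain m where k: "t \<le> arrival_time \<omega> i m" and k': "\<And>l. l < m \<Longrightarrow> arrival_time \<omega> i l < t"
    using unbounded[of t i] exists_least_iff[of "\<lambda>k. t \<le> arrival_time \<omega> i k"] not_le by blast
  have prev: "prev_arrival_time \<omega> i m < t"
    using assms k' by (auto simp: prev_arrival_time_def split: nat.split)
  have "\<not> (prev_arrival_time \<omega> i l < t \<and> t \<le> arrival_time \<omega> i l)" if "l \<noteq> m" for l
  proof (cases "l < m")
    case True
    then show ?thesis using k'[OF True] by simp
  next
    case False
    with that obtain l' where l': "l = Suc l'" "m \<le> l'" by (cases l) auto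
    then have "arrival_time \<omega> i m \<le> arrival_time \<omega> i l'"
      by (simp add: strict_mono_less_eq[OF arrival_time_strict_mono])
    then show ?thesis using k l'(1) by (simp add: prev_arrival_time_def)
  qed
  then have "(\<Sum>k. of_bool (prev_arrival_time \<omega> i k < t \<and> t \<le> arrival_time \<omega> i k)) =
      (of_bool (prev_arrival_time \<omega> i m < t \<and> t \<le> arrival_time \<omega> i m) :: ennreal)"
    by (intro suminf_single) simp
  also have "\<dots> = 1" using prev k by (simp only: of_bool_def simp_thms if_True)
  finally show ?thesis .
qed

end

subsection \<open>Exponential clocks\<close>

abbreviation expo :: "real \<Rightarrow> real measure" where
  "expo r \<equiv> density lborel (exponential_density r)"

lemma nn_integral_expo:
  assumes "f \<in> borel_measurable borel"
  shows "(\<integral>\<^sup>+z. f z \<partial>expo r) = (\<integral>\<^sup>+z. ennreal (exponential_density r z) * f z \<partial>lborel)"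
  using assms by (intro nn_integral_density) auto

lemma expo_tail_less:
  assumes "0 < r" "0 \<le> u"
  shows "(\<integral>\<^sup>+z. of_bool (u < z) \<partial>expo r) = ennreal (exp (- r * u))"
proof -
  interpret prob_space "expo r" using assms by (intro prob_space_exponential_density)
  have "(\<integral>\<^sup>+z. of_bool (u < z) \<partial>expo r) = (\<integral>\<^sup>+z. indicator (space (expo r) - {..u}) z \<partial>expo r)"
    by (intro nn_integral_cong) (auto simp: indicator_def)
  also have "\<dots> = emeasure (expo r) (space (expo r) - {..u})"
    by (intro nn_integral_indicator) auto
  also have "\<dots> = ennreal (1 - measure (expo r) {..u})"
    by (subst emeasure_eq_measure, subst prob_compl) auto
  also have "measure (expo r) {..u} = 1 - exp (- r * u)"
    using emeasure_erlang_density[of r 0 u] assms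
    by (simp add: measure_def erlang_CDF_0)
  finally show ?thesis by simp
qed

lemma AE_expo_pos:
  assumes "0 < r"
  shows "AE z in expo r. 0 < z"
proof -
  have "AE z in lborel. z \<noteq> (0::real)" by (rule AE_lborel_singleton)
  then show ?thesis
    by (auto simp: AE_density exponential_density_def)
qed

lemma AE_expo_neq: "AE z in expo r. z \<noteq> c"
  using AE_lborel_singleton[of c] by (auto simp: AE_density)

lemma expo_tail_le:
  assumes "0 < r" "0 \<le> u"
  shows "(\<integral>\<^sup>+z. of_bool (u \<le> z) \<partial>expo r) = ennreal (exp (- r * u))"
proof -
  have "(\<integral>\<^sup>+z. of_bool (u \<le> z) \<partial>expo r) = (\<integral>\<^sup>+z. of_bool (u < z) \<partial>expo r)"
    using AE_expo_neq[of u r] by (intro nn_integral_cong_AE) (auto elim!: eventually_mono)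
  then show ?thesis using expo_tail_less[OF assms] by simp
qed

text \<open>Weighting the density of rate \<open>r\<close> by \<open>exp (- z)\<close> gives, up to
  the factor \<open>r / (r + 1)\<close>, the density of rate \<open>r + 1\<close>.\<close>

lemma expo_laplace:
  assumes "0 < r"
  shows "(\<integral>\<^sup>+z. ennreal (exp (- z)) \<partial>expo r) = ennreal (r / (r + 1))"
proof -
  have "(\<integral>\<^sup>+z. ennreal (exp (- z)) \<partial>expo r) =
      (\<integral>\<^sup>+z. ennreal (r / (r + 1)) * ennreal (exponential_density (r + 1) z) \<partial>lborel)"
    unfolding nn_integral_expo[of "\<lambda>z. ennreal (exp (- z))", simplified]
  proof (intro nn_integral_cong)
    fix z :: real
    have "exp (- z * r) * exp (- z) = exp (- z * (r + 1))"
      by (simp add: exp_add[symmetric] algebra_simps)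
    then have "exponential_density r z * exp (- z) = r / (r + 1) * exponential_density (r + 1) z"
      using assms by (simp add: exponential_density_def)
    then show "ennreal (exponential_density r z) * ennreal (exp (- z)) =
        ennreal (r / (r + 1)) * ennreal (exponential_density (r + 1) z)"
      using assms by (simp add: ennreal_mult[symmetric] exponential_density_nonneg)
  qed
  also have "\<dots> = ennreal (r / (r + 1)) * emeasure (expo (r + 1)) (space (expo (r + 1)))"
    by (subst nn_integral_cmult) (auto simp: emeasure_density)
  also have "emeasure (expo (r + 1)) (space (expo (r + 1))) = 1"
    using assms prob_space.emeasure_space_1[OF prob_space_exponential_density[of "r + 1"]] by simp
  finally show ?thesis by simp
qed

text \<open>
  The clock \<open>Z\<close> starts at time \<open>B\<close> and is resampled by \<open>upd\<close>. Until it rings, \<open>H\<close> does not depend on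
  it, so both sides integrate \<open>r exp (- r u) H (upd \<omega> u) (B \<omega> + u)\<close> over \<open>u > 0\<close>.
\<close>

lemma clock_intensity:
  fixes P :: "'a measure" and upd :: "'a \<Rightarrow> real \<Rightarrow> 'a" and H :: "'a \<Rightarrow> real \<Rightarrow> ennreal"
  assumes P: "prob_space P" and r: "0 < r"
    and upd [measurable]: "(\<lambda>x. upd (fst x) (snd x)) \<in> P \<Otimes>\<^sub>M borel \<rightarrow>\<^sub>M P"
    and inv: "\<And>f. f \<in> borel_measurable P \<Longrightarrow>
      (\<integral>\<^sup>+\<omega>. f \<omega> \<partial>P) = (\<integral>\<^sup>+\<omega>. \<integral>\<^sup>+z. f (upd \<omega> z) \<partial>expo r \<partial>P)"
    and B [measurable]: "B \<in> borel_measurable P" and Z [measurable]: "Z \<in> borel_measurable P"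
    and B_upd: "\<And>\<omega> z. B (upd \<omega> z) = B \<omega>" and Z_upd: "\<And>\<omega> z. Z (upd \<omega> z) = z"
    and H [measurable]: "(\<lambda>x. H (fst x) (snd x)) \<in> borel_measurable (P \<Otimes>\<^sub>M borel)"
    and loc: "AE \<omega> in P. \<forall>u z. 0 < u \<longrightarrow> u \<le> z \<longrightarrow> H (upd \<omega> z) (B \<omega> + u) = H (upd \<omega> u) (B \<omega> + u)"
  shows "(\<integral>\<^sup>+\<omega>. H \<omega> (B \<omega> + Z \<omega>) \<partial>P) =
    ennreal r * (\<integral>\<^sup>+\<omega>. \<integral>\<^sup>+t. of_bool (B \<omega> < t \<and> t \<le> B \<omega> + Z \<omega>) * H \<omega> t \<partial>lborel \<partial>P)"
proof -
  interpret P: prob_space P by (rule P)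
  interpret E: prob_space "expo r" by (rule prob_space_exponential_density[OF r])
  interpret L: sigma_finite_measure "lborel :: real measure" by (rule sigma_finite_lborel)
  let ?I = "\<lambda>\<omega>. \<integral>\<^sup>+z. H (upd \<omega> z) (B \<omega> + z) \<partial>expo r"
  let ?J = "\<lambda>\<omega>. \<integral>\<^sup>+z. \<integral>\<^sup>+t. of_bool (B \<omega> < t \<and> t \<le> B \<omega> + z) * H (upd \<omega> z) t \<partial>lborel \<partial>expo r"
  have upd' [measurable]: "(\<lambda>z. upd \<omega> z) \<in> borel \<rightarrow>\<^sub>M P" if "\<omega> \<in> space P" for \<omega>
    using measurable_compose[OF _ upd, of "\<lambda>z. (\<omega>, z)" borel] that by simp
  have H' [measurable (raw)]: "(\<lambda>x. H (f x) (g x)) \<in> borel_measurable N"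
    if "f \<in> N \<rightarrow>\<^sub>M P" "g \<in> borel_measurable N" for f g and N :: "'x measure"
    using measurable_compose[OF measurable_Pair[OF that] H] by simp
  have "(\<integral>\<^sup>+\<omega>. H \<omega> (B \<omega> + Z \<omega>) \<partial>P) = (\<integral>\<^sup>+\<omega>. ?I \<omega> \<partial>P)"
    by (subst inv) (auto simp: B_upd Z_upd)
  also have "\<dots> = (\<integral>\<^sup>+\<omega>. ennreal r * ?J \<omega> \<partial>P)"
  proof (rule nn_integral_cong_AE, use loc AE_space in eventually_elim)
    fix \<omega> assume loc: "\<forall>u z. 0 < u \<longrightarrow> u \<le> z \<longrightarrow> H (upd \<omega> z) (B \<omega> + u) = H (upd \<omega> u) (B \<omega> + u)"
      and [measurable]: "\<omega> \<in> space P"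
    have "?J \<omega> = (\<integral>\<^sup>+z. \<integral>\<^sup>+u. of_bool (0 < u \<and> u \<le> z) * H (upd \<omega> u) (B \<omega> + u) \<partial>lborel \<partial>expo r)"
    proof (rule nn_integral_cong)
      fix z
      have "(\<integral>\<^sup>+t. of_bool (B \<omega> < t \<and> t \<le> B \<omega> + z) * H (upd \<omega> z) t \<partial>lborel) =
          (\<integral>\<^sup>+u. of_bool (0 < u \<and> u \<le> z) * H (upd \<omega> z) (B \<omega> + u) \<partial>lborel)"
        by (subst nn_integral_real_affine[where c = 1 and t = "B \<omega>"]) auto
      also have "\<dots> = (\<integral>\<^sup>+u. of_bool (0 < u \<and> u \<le> z) * H (upd \<omega> u) (B \<omega> + u) \<partial>lborel)"
      proof (intro nn_integral_cong)
        fix u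
        show "of_bool (0 < u \<and> u \<le> z) * H (upd \<omega> z) (B \<omega> + u) =
            of_bool (0 < u \<and> u \<le> z) * H (upd \<omega> u) (B \<omega> + u)"
          using loc[rule_format, of u z] by (auto simp: of_bool_def)
      qed
      finally show "(\<integral>\<^sup>+t. of_bool (B \<omega> < t \<and> t \<le> B \<omega> + z) * H (upd \<omega> z) t \<partial>lborel) =
          (\<integral>\<^sup>+u. of_bool (0 < u \<and> u \<le> z) * H (upd \<omega> u) (B \<omega> + u) \<partial>lborel)" .
    qed
    also have "\<dots> = (\<integral>\<^sup>+z. \<integral>\<^sup>+u. ennreal (exponential_density r z) *
        (of_bool (0 < u \<and> u \<le> z) * H (upd \<omega> u) (B \<omega> + u)) \<partial>lborel \<partial>lborel)"
      by (subst nn_integral_density) (auto intro!: nn_integral_cong simp: nn_integral_cmult)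
    also have "\<dots> = (\<integral>\<^sup>+u. \<integral>\<^sup>+z. ennreal (exponential_density r z) *
        (of_bool (0 < u \<and> u \<le> z) * H (upd \<omega> u) (B \<omega> + u)) \<partial>lborel \<partial>lborel)"
      by (rule lborel_pair.Fubini'[where f = "\<lambda>z u. ennreal (exponential_density r z) *
        (of_bool (0 < u \<and> u \<le> z) * H (upd \<omega> u) (B \<omega> + u))", symmetric]) simp
    also have "\<dots> = (\<integral>\<^sup>+u. of_bool (0 < u) * H (upd \<omega> u) (B \<omega> + u) *
        (\<integral>\<^sup>+z. of_bool (u \<le> z) \<partial>expo r) \<partial>lborel)"
      by (intro nn_integral_cong, subst nn_integral_density)
        (auto simp: nn_integral_cmult[symmetric] ac_simps intro!: nn_integral_cong)
    finally have J: "?J \<omega> = (\<integral>\<^sup>+u. of_bool (0 < u) * H (upd \<omega> u) (B \<omega> + u) *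
        (\<integral>\<^sup>+z. of_bool (u \<le> z) \<partial>expo r) \<partial>lborel)" .
    have "?I \<omega> = (\<integral>\<^sup>+u. ennreal (exponential_density r u) * H (upd \<omega> u) (B \<omega> + u) \<partial>lborel)"
      by (subst nn_integral_density) auto
    \<comment> \<open>The exponential density is \<open>r\<close> times its tail probability. This
      trades the clock ringing at \<open>u\<close> for the clock still running at
      \<open>u\<close>.\<close>
    also have "\<dots> = (\<integral>\<^sup>+u. ennreal r * (of_bool (0 < u) * H (upd \<omega> u) (B \<omega> + u) *
        (\<integral>\<^sup>+z. of_bool (u \<le> z) \<partial>expo r)) \<partial>lborel)"
    proof (rule nn_integral_cong_AE, use AE_lborel_singleton[of "0::real"] in eventually_elim)
      fix u :: real assume "u \<noteq> 0"
      then show "ennreal (exponential_density r u) * H (upd \<omega> u) (B \<omega> + u) =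
          ennreal r * (of_bool (0 < u) * H (upd \<omega> u) (B \<omega> + u) *
            (\<integral>\<^sup>+z. of_bool (u \<le> z) \<partial>expo r))"
      proof (cases "0 < u")
        case True
        then show ?thesis
          unfolding expo_tail_le[OF r less_imp_le[OF True]]
          using r by (simp add: exponential_density_def ennreal_mult ac_simps)
      qed (simp add: exponential_density_def)
    qed
    also have "\<dots> = ennreal r * ?J \<omega>"
      unfolding J by (rule nn_integral_cmult) simp
    finally show "?I \<omega> = ennreal r * ?J \<omega>" .
  qed
  also have "\<dots> = ennreal r * (\<integral>\<^sup>+\<omega>. ?J \<omega> \<partial>P)"
    by (rule nn_integral_cmult) measurable
  also have "(\<integral>\<^sup>+\<omega>. ?J \<omega> \<partial>P) =
      (\<integral>\<^sup>+\<omega>. \<integral>\<^sup>+t. of_bool (B \<omega> < t \<and> t \<le> B \<omega> + Z \<omega>) * H \<omega> t \<partial>lborel \<partial>P)"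
    by (subst (2) inv) (auto simp: B_upd Z_upd)
  finally show ?thesis .
qed

subsection \<open>The space of demands\<close>

locale demand_model =
  fixes lam :: "real ^ 'n::finite" and th :: "'n \<Rightarrow> real"
  assumes lam_pos: "0 < lam $ i" and th_pos: "0 < th i"
begin

abbreviation D :: "'n sample measure" where "D \<equiv> demand_space th lam"

abbreviation clocks :: "'n \<times> nat \<Rightarrow> (real \<times> real) measure" where
  "clocks p \<equiv> expo (lam $ fst p) \<Otimes>\<^sub>M expo (th (fst p))"

lemma D_eq: "D = PiM UNIV clocks"
  by (simp add: demand_space_def case_prod_beta')

lemma prob_space_clocks: "prob_space (clocks p)"
  by (intro prob_space_pair prob_space_exponential_density lam_pos th_pos)

lemma sets_clocks: "sets (clocks p) = sets (borel \<Otimes>\<^sub>M borel)"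
  by (intro sets_pair_measure_cong) simp_all

lemma prob_space_D: "prob_space D"
  unfolding D_eq by (intro prob_space_PiM prob_space_clocks)

lemma space_D [simp]: "space D = UNIV"
  by (simp add: D_eq space_PiM space_pair_measure)

lemma sets_D: "sets D = sets (PiM UNIV (\<lambda>_. borel \<Otimes>\<^sub>M borel))"
  unfolding D_eq by (intro sets_PiM_cong sets_pair_measure_cong) simp_all

lemma measurable_D_iff: "f \<in> N \<rightarrow>\<^sub>M D \<longleftrightarrow> f \<in> N \<rightarrow>\<^sub>M PiM UNIV (\<lambda>_. borel \<Otimes>\<^sub>M borel)"
  by (simp add: measurable_cong_sets[OF refl sets_D])

lemma measurable_clock [measurable]: "(\<lambda>\<omega>. \<omega> p) \<in> D \<rightarrow>\<^sub>M borel \<Otimes>\<^sub>M borel"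
  using measurable_component_singleton[of p UNIV "\<lambda>_. borel \<Otimes>\<^sub>M borel"]
  by (simp add: measurable_cong_sets[OF sets_D refl])

lemma measurable_upd:
  assumes f: "f \<in> N \<rightarrow>\<^sub>M D" and g: "g \<in> N \<rightarrow>\<^sub>M borel \<Otimes>\<^sub>M borel"
  shows "(\<lambda>x. (f x)(p := g x)) \<in> N \<rightarrow>\<^sub>M D"
  using measurable_fun_upd[of UNIV UNIV p f N "\<lambda>_. borel \<Otimes>\<^sub>M borel" g] f g
  by (simp add: measurable_D_iff)

abbreviation set_gap :: "'n \<times> nat \<Rightarrow> 'n sample \<Rightarrow> real \<Rightarrow> 'n sample" where
  "set_gap p \<omega> z \<equiv> fun_upd \<omega> p (z, snd (\<omega> p))"

abbreviation set_sojourn :: "'n \<times> nat \<Rightarrow> 'n sample \<Rightarrow> real \<Rightarrow> 'n sample" where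
  "set_sojourn p \<omega> z \<equiv> fun_upd \<omega> p (fst (\<omega> p), z)"

lemma measurable_clock' [measurable (raw)]:
  "f \<in> N \<rightarrow>\<^sub>M D \<Longrightarrow> (\<lambda>x. f x p) \<in> N \<rightarrow>\<^sub>M borel \<Otimes>\<^sub>M borel"
  using measurable_compose[OF _ measurable_clock] .

lemma measurable_set_gap [measurable]: "(\<lambda>x. set_gap p (fst x) (snd x)) \<in> D \<Otimes>\<^sub>M borel \<rightarrow>\<^sub>M D"
  by (rule measurable_upd) measurable

lemma measurable_set_sojourn [measurable]:
  "(\<lambda>x. set_sojourn p (fst x) (snd x)) \<in> D \<Otimes>\<^sub>M borel \<rightarrow>\<^sub>M D"
  by (rule measurable_upd) measurable

text \<open>Overwriting coordinate \<open>p\<close> by an independent copy preserves the product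
  measure; here \<open>p\<close> already belongs to the index set, so inserting it leaves the index
  set \<open>UNIV\<close> unchanged.\<close>

lemma nn_integral_resample:
  assumes f [measurable]: "f \<in> borel_measurable D"
  shows "(\<integral>\<^sup>+\<omega>. f \<omega> \<partial>D) = (\<integral>\<^sup>+\<omega>. \<integral>\<^sup>+x. f ((\<omega>)(p := x)) \<partial>clocks p \<partial>D)"
proof -
  interpret D: prob_space D by (rule prob_space_D)
  interpret C: prob_space "clocks p" by (rule prob_space_clocks)
  interpret CD: pair_sigma_finite "clocks p" D ..
  have [measurable]: "(\<lambda>(x, X). X(p := x)) \<in> clocks p \<Otimes>\<^sub>M D \<rightarrow>\<^sub>M D"
    unfolding case_prod_beta
    by (rule measurable_upd) (simp_all add: measurable_cong_sets[OF refl sets_clocks, symmetric])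
  have "D = distr (clocks p \<Otimes>\<^sub>M D) D (\<lambda>(x, X). X(p := x))"
    using distr_pair_PiM_eq_PiM[of UNIV clocks p] prob_space_clocks by (simp add: D_eq)
  then have "(\<integral>\<^sup>+\<omega>. f \<omega> \<partial>D) = (\<integral>\<^sup>+\<omega>. f \<omega> \<partial>distr (clocks p \<Otimes>\<^sub>M D) D (\<lambda>(x, X). X(p := x)))"
    by simp
  also have "\<dots> = (\<integral>\<^sup>+y. f ((snd y)(p := fst y)) \<partial>(clocks p \<Otimes>\<^sub>M D))"
    by (subst nn_integral_distr) (auto simp: case_prod_beta)
  also have "\<dots> = (\<integral>\<^sup>+\<omega>. \<integral>\<^sup>+x. f ((\<omega>)(p := x)) \<partial>clocks p \<partial>D)"
    by (subst CD.nn_integral_snd[symmetric]) (simp_all add: case_prod_beta)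
  finally show ?thesis .
qed

lemma nn_integral_set_gap:
  assumes f [measurable]: "f \<in> borel_measurable D"
  shows "(\<integral>\<^sup>+\<omega>. f \<omega> \<partial>D) = (\<integral>\<^sup>+\<omega>. \<integral>\<^sup>+z. f (set_gap p \<omega> z) \<partial>expo (lam $ fst p) \<partial>D)"
proof -
  interpret L: prob_space "expo (lam $ fst p)" by (intro prob_space_exponential_density lam_pos)
  interpret S: prob_space "expo (th (fst p))" by (intro prob_space_exponential_density th_pos)
  interpret LS: pair_sigma_finite "expo (lam $ fst p)" "expo (th (fst p))" ..
  have [measurable]: "(\<lambda>z. f ((\<omega>)(p := (fst z, snd z)))) \<in> borel_measurable (borel \<Otimes>\<^sub>M borel)" for \<omega>
    by (rule measurable_compose[OF _ f], rule measurable_upd) auto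
  have [measurable]: "(\<lambda>x. f ((\<omega>)(p := x))) \<in> borel_measurable (clocks p)" for \<omega>
    by (rule measurable_compose[OF _ f], rule measurable_upd)
      (simp_all add: measurable_ident_sets[OF sets_clocks])
  have [measurable]: "(\<lambda>x. f (set_gap p (fst x) (snd x))) \<in> borel_measurable (D \<Otimes>\<^sub>M expo (lam $ fst p))"
    using measurable_compose[OF measurable_set_gap f] by simp
  have "(\<integral>\<^sup>+\<omega>. \<integral>\<^sup>+z. f (set_gap p \<omega> z) \<partial>expo (lam $ fst p) \<partial>D) =
     (\<integral>\<^sup>+\<omega>. \<integral>\<^sup>+x. \<integral>\<^sup>+z. f ((\<omega>)(p := (z, snd x))) \<partial>expo (lam $ fst p) \<partial>clocks p \<partial>D)"
    by (subst nn_integral_resample[where p = p]) simp_all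
  also have "\<dots> = (\<integral>\<^sup>+\<omega>. \<integral>\<^sup>+x. f ((\<omega>)(p := x)) \<partial>clocks p \<partial>D)"
  proof (rule nn_integral_cong)
    fix \<omega>
    have "(\<lambda>y. f ((\<omega>)(p := (snd y, snd (fst y))))) \<in> borel_measurable (clocks p \<Otimes>\<^sub>M expo (lam $ fst p))"
      by (rule measurable_compose[OF _ f], rule measurable_upd) measurable
    then have [measurable]: "(\<lambda>x. \<integral>\<^sup>+z. f ((\<omega>)(p := (z, snd x))) \<partial>expo (lam $ fst p)) \<in> borel_measurable (clocks p)"
      by (drule_tac L.borel_measurable_nn_integral_fst) simp
    have "(\<integral>\<^sup>+x. \<integral>\<^sup>+z. f ((\<omega>)(p := (z, snd x))) \<partial>expo (lam $ fst p) \<partial>clocks p) =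
      (\<integral>\<^sup>+y. \<integral>\<^sup>+x. \<integral>\<^sup>+z. f ((\<omega>)(p := (z, y))) \<partial>expo (lam $ fst p) \<partial>expo (lam $ fst p) \<partial>expo (th (fst p)))"
      by (subst LS.nn_integral_snd[symmetric]) simp_all
    \<comment> \<open>The gap drawn by the outer integral has been overwritten, so it integrates out
      with total mass one.\<close>
    also have "\<dots> = (\<integral>\<^sup>+y. \<integral>\<^sup>+z. f ((\<omega>)(p := (z, y))) \<partial>expo (lam $ fst p) \<partial>expo (th (fst p)))"
      using L.emeasure_space_1 by simp
    also have "\<dots> = (\<integral>\<^sup>+x. f ((\<omega>)(p := x)) \<partial>clocks p)"
      by (subst LS.nn_integral_snd[symmetric]) simp_all
    finally show "(\<integral>\<^sup>+x. \<integral>\<^sup>+z. f ((\<omega>)(p := (z, snd x))) \<partial>expo (lam $ fst p) \<partial>clocks p) = \<dots>" .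
  qed
  also have "\<dots> = (\<integral>\<^sup>+\<omega>. f \<omega> \<partial>D)" by (rule nn_integral_resample[symmetric]) simp
  finally show ?thesis ..
qed

lemma nn_integral_set_sojourn:
  assumes f [measurable]: "f \<in> borel_measurable D"
  shows "(\<integral>\<^sup>+\<omega>. f \<omega> \<partial>D) = (\<integral>\<^sup>+\<omega>. \<integral>\<^sup>+z. f (set_sojourn p \<omega> z) \<partial>expo (th (fst p)) \<partial>D)"
proof -
  interpret L: prob_space "expo (lam $ fst p)" by (intro prob_space_exponential_density lam_pos)
  interpret S: prob_space "expo (th (fst p))" by (intro prob_space_exponential_density th_pos)
  interpret LS: pair_sigma_finite "expo (lam $ fst p)" "expo (th (fst p))" ..
  have [measurable]: "(\<lambda>z. f ((\<omega>)(p := (fst z, snd z)))) \<in> borel_measurable (borel \<Otimes>\<^sub>M borel)" for \<omega>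
    by (rule measurable_compose[OF _ f], rule measurable_upd) auto
  have [measurable]: "(\<lambda>x. f ((\<omega>)(p := x))) \<in> borel_measurable (clocks p)" for \<omega>
    by (rule measurable_compose[OF _ f], rule measurable_upd)
      (simp_all add: measurable_ident_sets[OF sets_clocks])
  have [measurable]: "(\<lambda>x. f (set_sojourn p (fst x) (snd x))) \<in> borel_measurable (D \<Otimes>\<^sub>M expo (th (fst p)))"
    using measurable_compose[OF measurable_set_sojourn f] by simp
  have "(\<integral>\<^sup>+\<omega>. \<integral>\<^sup>+z. f (set_sojourn p \<omega> z) \<partial>expo (th (fst p)) \<partial>D) =
     (\<integral>\<^sup>+\<omega>. \<integral>\<^sup>+x. \<integral>\<^sup>+z. f ((\<omega>)(p := (fst x, z))) \<partial>expo (th (fst p)) \<partial>clocks p \<partial>D)"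
    by (subst nn_integral_resample[where p = p]) simp_all
  also have "\<dots> = (\<integral>\<^sup>+\<omega>. \<integral>\<^sup>+x. f ((\<omega>)(p := x)) \<partial>clocks p \<partial>D)"
  proof (rule nn_integral_cong)
    fix \<omega>
    have "(\<lambda>y. f ((\<omega>)(p := (fst (fst y), snd y)))) \<in> borel_measurable (clocks p \<Otimes>\<^sub>M expo (th (fst p)))"
      by (rule measurable_compose[OF _ f], rule measurable_upd) measurable
    then have [measurable]: "(\<lambda>x. \<integral>\<^sup>+z. f ((\<omega>)(p := (fst x, z))) \<partial>expo (th (fst p))) \<in> borel_measurable (clocks p)"
      by (drule_tac S.borel_measurable_nn_integral_fst) simp
    have "(\<integral>\<^sup>+x. \<integral>\<^sup>+z. f ((\<omega>)(p := (fst x, z))) \<partial>expo (th (fst p)) \<partial>clocks p) =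
      (\<integral>\<^sup>+y. \<integral>\<^sup>+x. \<integral>\<^sup>+z. f ((\<omega>)(p := (y, z))) \<partial>expo (th (fst p)) \<partial>expo (th (fst p)) \<partial>expo (lam $ fst p))"
      by (subst S.nn_integral_fst[symmetric]) simp_all
    also have "\<dots> = (\<integral>\<^sup>+y. \<integral>\<^sup>+z. f ((\<omega>)(p := (y, z))) \<partial>expo (th (fst p)) \<partial>expo (lam $ fst p))"
      using S.emeasure_space_1 by simp
    also have "\<dots> = (\<integral>\<^sup>+x. f ((\<omega>)(p := x)) \<partial>clocks p)"
      by (subst S.nn_integral_fst[symmetric]) simp_all
    finally show "(\<integral>\<^sup>+x. \<integral>\<^sup>+z. f ((\<omega>)(p := (fst x, z))) \<partial>expo (th (fst p)) \<partial>clocks p) = \<dots>" .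
  qed
  also have "\<dots> = (\<integral>\<^sup>+\<omega>. f \<omega> \<partial>D)" by (rule nn_integral_resample[symmetric]) simp
  finally show ?thesis ..
qed

subsection \<open>Measurability\<close>

lemma measurable_arrival_time [measurable]: "(\<lambda>\<omega>. arrival_time \<omega> i k) \<in> borel_measurable D"
  unfolding arrival_time_def by measurable

lemma measurable_expiry_time [measurable]: "(\<lambda>\<omega>. expiry_time \<omega> i k) \<in> borel_measurable D"
  unfolding expiry_time_def by measurable

lemma measurable_prev_arrival_time [measurable]:
  "(\<lambda>\<omega>. prev_arrival_time \<omega> i k) \<in> borel_measurable D"
  unfolding prev_arrival_time_def by (cases k) auto

lemma measurable_event_time [measurable]: "(\<lambda>\<omega>. event_time \<omega> \<sigma> v) \<in> borel_measurable D"
  by (cases v) (simp_all add: event_time_alt)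

text \<open>The set of minimisers takes finitely many values, each on a measurable set, and the
  chosen event is a fixed function of that set. Ties therefore cause no trouble for
  measurability.\<close>

lemma measurable_next_event [measurable]: "(\<lambda>\<omega>. next_event \<omega> \<sigma>) \<in> D \<rightarrow>\<^sub>M count_space UNIV"
proof -
  let ?P = "pending_events \<sigma>"
  let ?M = "\<lambda>\<omega>. {x. is_arg_min (event_time \<omega> \<sigma>) (\<lambda>x. x \<in> ?P) x}"
  have le: "Measurable.pred D (\<lambda>\<omega>. event_time \<omega> \<sigma> x \<le> event_time \<omega> \<sigma> y)" for x y
    unfolding pred_def by measurable
  have "?M \<in> D \<rightarrow>\<^sub>M count_space (Pow ?P)"
  proof (subst measurable_count_space_eq2)
    show "finite (Pow ?P)" by simp
    have "?M -` {A} \<inter> space D \<in> sets D" if "A \<subseteq> ?P" for A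
    proof -
      have "?M -` {A} \<inter> space D = {\<omega> \<in> space D. \<forall>x\<in>?P. x \<in> A \<longleftrightarrow> (\<forall>y\<in>?P. event_time \<omega> \<sigma> x \<le> event_time \<omega> \<sigma> y)}"
      proof -
        have mem: "x \<in> ?M \<omega> \<longleftrightarrow> x \<in> ?P \<and> (\<forall>y\<in>?P. event_time \<omega> \<sigma> x \<le> event_time \<omega> \<sigma> y)" for \<omega> x
          unfolding is_arg_min_def by (simp add: not_less) blast
        have "?M \<omega> = A \<longleftrightarrow> (\<forall>x\<in>?P. x \<in> A \<longleftrightarrow> (\<forall>y\<in>?P. event_time \<omega> \<sigma> x \<le> event_time \<omega> \<sigma> y))" for \<omega>
          unfolding set_eq_iff mem using that by blast
        then show ?thesis by (simp add: set_eq_iff)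
      qed
      also have "\<dots> \<in> sets D"
        by (rule predE) (intro pred_intros_finite finite_pending_events pred_intros_logic le, simp)
      finally show ?thesis .
    qed
    then show "?M \<in> space D \<rightarrow> Pow ?P \<and> (\<forall>A\<in>Pow ?P. ?M -` {A} \<inter> space D \<in> sets D)"
      by (auto simp: is_arg_min_def)
  qed
  then have "(\<lambda>\<omega>. SOME x. x \<in> ?M \<omega>) \<in> D \<rightarrow>\<^sub>M count_space UNIV"
    by (rule measurable_compose) simp
  then show ?thesis
    by (simp add: next_event_def arg_min_on_def arg_min_def)
qed

end

instance event :: (countable) countable
  by countable_datatype

context demand_model
begin

text \<open>Configurations form a countable type, so a map depending on the configuration reached so
  far can be checked one configuration at a time.\<close>

lemma measurable_config_after [measurable]:
  "(\<lambda>\<omega>. config_after \<phi> \<omega> n) \<in> D \<rightarrow>\<^sub>M count_space UNIV"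
proof (induction n)
  case (Suc n)
  have "(\<lambda>\<omega>. next_event \<omega> (config_after \<phi> \<omega> n)) \<in> D \<rightarrow>\<^sub>M count_space UNIV"
    by (rule measurable_compose_countable[OF measurable_next_event Suc])
  then have "(\<lambda>\<omega>. event_effect \<phi> \<sigma> (next_event \<omega> (config_after \<phi> \<omega> n))) \<in> D \<rightarrow>\<^sub>M count_space UNIV" for \<sigma>
    by (rule measurable_compose) simp
  from measurable_compose_countable[OF this Suc] show ?case
    by (simp add: config_after_Suc nth_event_def)
qed simp

lemma measurable_nth_event [measurable]: "(\<lambda>\<omega>. nth_event \<phi> \<omega> n) \<in> D \<rightarrow>\<^sub>M count_space UNIV"
  unfolding nth_event_def
  by (rule measurable_compose_countable[OF measurable_next_event measurable_config_after])

lemma measurable_nth_time [measurable]: "(\<lambda>\<omega>. nth_time \<phi> \<omega> n) \<in> borel_measurable D"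
  unfolding nth_time_def
  by (rule measurable_compose_countable[OF measurable_compose_countable[OF measurable_event_time
        measurable_nth_event] measurable_config_after])

lemma measurable_config_before [measurable]:
  "(\<lambda>x. config_before \<phi> (fst x) (snd x)) \<in> D \<Otimes>\<^sub>M borel \<rightarrow>\<^sub>M count_space UNIV"
proof -
  have "(\<lambda>x. LEAST n. snd x \<le> nth_time \<phi> (fst x) n) \<in> D \<Otimes>\<^sub>M borel \<rightarrow>\<^sub>M count_space UNIV"
    by measurable
  then show ?thesis
    unfolding config_before_def
    by (rule measurable_compose_countable[rotated]) measurable
qed

lemma measurable_final_queue [measurable]:
  "(\<lambda>\<omega>. final_queue \<phi> T \<omega> i) \<in> D \<rightarrow>\<^sub>M count_space UNIV"
proof -
  have "(\<lambda>\<omega>. LEAST n. T < nth_time \<phi> \<omega> n) \<in> D \<rightarrow>\<^sub>M count_space UNIV"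
    by measurable
  then have "(\<lambda>\<omega>. config_after \<phi> \<omega> (LEAST n. T < nth_time \<phi> \<omega> n)) \<in> D \<rightarrow>\<^sub>M count_space UNIV"
    by (rule measurable_compose_countable[rotated]) measurable
  then show ?thesis
    unfolding final_queue_def by (rule measurable_compose) simp
qed

lemma measurable_count_events [measurable]: "count_events P \<phi> T \<in> borel_measurable D"
proof -
  have "Measurable.pred D (\<lambda>\<omega>. P (config_after \<phi> \<omega> n) (nth_event \<phi> \<omega> n))" for n
    by (rule measurable_compose_countable[OF _ measurable_config_after],
        rule measurable_compose[OF measurable_nth_event]) simp
  note [measurable] = this
  have "(\<lambda>\<omega>. \<Sum>n. of_bool (nth_time \<phi> \<omega> n \<le> T \<and>
     P (config_after \<phi> \<omega> n) (nth_event \<phi> \<omega> n)) :: ennreal) \<in> borel_measurable D"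
    by measurable
  then show ?thesis by (simp add: count_events_def[abs_def])
qed

subsection \<open>Almost all sample points are regular\<close>

text \<open>Fubini for null sets: it suffices that, with all other clocks fixed, almost every value
  of one gap is good.\<close>

lemma AE_set_gap:
  assumes [measurable]: "Measurable.pred D Q"
    and "AE \<omega> in D. AE z in expo (lam $ fst p). Q (set_gap p \<omega> z)"
  shows "AE \<omega> in D. Q \<omega>"
proof -
  have "(\<integral>\<^sup>+\<omega>. of_bool (\<not> Q \<omega>) \<partial>D) =
      (\<integral>\<^sup>+\<omega>. \<integral>\<^sup>+z. of_bool (\<not> Q (set_gap p \<omega> z)) \<partial>expo (lam $ fst p) \<partial>D)"
    by (rule nn_integral_set_gap) measurable
  also have "\<dots> = (\<integral>\<^sup>+\<omega>. 0 \<partial>D)"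
  proof (rule nn_integral_cong_AE, use assms(2) in eventually_elim)
    fix \<omega> assume "AE z in expo (lam $ fst p). Q (set_gap p \<omega> z)"
    then have "(\<integral>\<^sup>+z. of_bool (\<not> Q (set_gap p \<omega> z)) \<partial>expo (lam $ fst p)) =
        (\<integral>\<^sup>+z. 0 \<partial>expo (lam $ fst p))"
      by (intro nn_integral_cong_AE) (auto elim!: eventually_mono)
    then show "(\<integral>\<^sup>+z. of_bool (\<not> Q (set_gap p \<omega> z)) \<partial>expo (lam $ fst p)) = 0" by simp
  qed
  finally have "(\<integral>\<^sup>+\<omega>. of_bool (\<not> Q \<omega>) \<partial>D) = 0" by simp
  then show ?thesis
    by (subst (asm) nn_integral_0_iff_AE) auto
qed

lemma AE_set_sojourn:
  assumes [measurable]: "Measurable.pred D Q"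
    and "AE \<omega> in D. AE z in expo (th (fst p)). Q (set_sojourn p \<omega> z)"
  shows "AE \<omega> in D. Q \<omega>"
proof -
  have "(\<integral>\<^sup>+\<omega>. of_bool (\<not> Q \<omega>) \<partial>D) =
      (\<integral>\<^sup>+\<omega>. \<integral>\<^sup>+z. of_bool (\<not> Q (set_sojourn p \<omega> z)) \<partial>expo (th (fst p)) \<partial>D)"
    by (rule nn_integral_set_sojourn) measurable
  also have "\<dots> = (\<integral>\<^sup>+\<omega>. 0 \<partial>D)"
  proof (rule nn_integral_cong_AE, use assms(2) in eventually_elim)
    fix \<omega> assume "AE z in expo (th (fst p)). Q (set_sojourn p \<omega> z)"
    then have "(\<integral>\<^sup>+z. of_bool (\<not> Q (set_sojourn p \<omega> z)) \<partial>expo (th (fst p))) =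
        (\<integral>\<^sup>+z. 0 \<partial>expo (th (fst p)))"
      by (intro nn_integral_cong_AE) (auto elim!: eventually_mono)
    then show "(\<integral>\<^sup>+z. of_bool (\<not> Q (set_sojourn p \<omega> z)) \<partial>expo (th (fst p))) = 0" by simp
  qed
  finally have "(\<integral>\<^sup>+\<omega>. of_bool (\<not> Q \<omega>) \<partial>D) = 0" by simp
  then show ?thesis
    by (subst (asm) nn_integral_0_iff_AE) auto
qed

lemma AE_positive_clocks: "AE \<omega> in D. positive_clocks \<omega>"
proof -
  have "AE \<omega> in D. 0 < fst (\<omega> p)" for p
    by (rule AE_set_gap[where p = p]) (simp_all add: AE_expo_pos[OF lam_pos])
  moreover have "AE \<omega> in D. 0 < snd (\<omega> p)" for p
    by (rule AE_set_sojourn[where p = p]) (simp_all add: AE_expo_pos[OF th_pos])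
  ultimately show ?thesis
    by (simp add: positive_clocks_def AE_all_countable)
qed

lemma arrival_time_fun_upd:
  "arrival_time (fun_upd \<omega> (i, k) x) j l =
     arrival_time \<omega> j l + (if j = i \<and> k \<le> l then fst x - fst (\<omega> (i, k)) else 0)"
proof (cases "j = i")
  case True
  then show ?thesis
    by (induction l) (auto simp: arrival_time_Suc arrival_time_def[of _ _ 0] le_Suc_eq)
qed (simp add: arrival_time_def)

text \<open>An expiry time moves with its own sojourn time while all other times stay fixed, and an
  arrival time moves with its own gap while arrivals of other types stay fixed. Arrivals of the same
  type can move together; they are separated by positivity of the gaps.\<close>

lemma AE_no_ties: "AE \<omega> in D. no_ties \<omega>"
proof -
  let ?t = "\<lambda>\<omega>. case_sum (case_prod (arrival_time \<omega>)) (case_prod (expiry_time \<omega>))"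
  have [measurable]: "(\<lambda>\<omega>. ?t \<omega> e) \<in> borel_measurable D" for e
    by (cases e) (auto simp: case_prod_beta)
  have pred_neq: "Measurable.pred D (\<lambda>\<omega>. f \<omega> \<noteq> g \<omega>)"
    if "f \<in> borel_measurable D" "g \<in> borel_measurable D" for f g :: "'n sample \<Rightarrow> real"
    unfolding pred_def using that by (rule borel_measurable_neq)
  have neq: "AE z in expo r. a + z \<noteq> b" for a b r
    using AE_expo_neq[of "b - a" r] by (auto elim!: eventually_mono)
  have E: "AE \<omega> in D. expiry_time \<omega> i k \<noteq> ?t \<omega> e" if "e \<noteq> Inr (i, k)" for i k e
  proof (rule AE_set_sojourn[where p = "(i, k)"])
    have "?t (set_sojourn (i, k) \<omega> z) e = ?t \<omega> e" for \<omega> z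
      using that by (auto simp: arrival_time_fun_upd expiry_time_def split: sum.split)
    moreover have "expiry_time (set_sojourn (i, k) \<omega> z) i k = arrival_time \<omega> i k + z" for \<omega> z
      by (simp add: expiry_time_def arrival_time_fun_upd)
    ultimately show "AE \<omega> in D. AE z in expo (th (fst (i, k))).
        expiry_time (set_sojourn (i, k) \<omega> z) i k \<noteq> ?t (set_sojourn (i, k) \<omega> z) e"
      using neq by simp
  qed (rule pred_neq; measurable)
  have A: "AE \<omega> in D. arrival_time \<omega> i k \<noteq> arrival_time \<omega> j l" if "i \<noteq> j" for i k j l
  proof (rule AE_set_gap[where p = "(i, k)"])
    have "arrival_time (set_gap (i, k) \<omega> z) i k = (arrival_time \<omega> i k - fst (\<omega> (i, k))) + z"
      "arrival_time (set_gap (i, k) \<omega> z) j l = arrival_time \<omega> j l" for \<omega> z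
      using that by (simp_all add: arrival_time_fun_upd)
    then show "AE \<omega> in D. AE z in expo (lam $ fst (i, k)).
        arrival_time (set_gap (i, k) \<omega> z) i k \<noteq> arrival_time (set_gap (i, k) \<omega> z) j l"
      using neq by simp
  qed (rule pred_neq; measurable)
  have A': "AE \<omega> in D. arrival_time \<omega> i k \<noteq> arrival_time \<omega> i l" if "k \<noteq> l" for i k l
    using AE_positive_clocks
  proof eventually_elim
    case (elim \<omega>)
    have "strict_mono (arrival_time \<omega> i)"
      using elim by (auto simp: strict_mono_Suc_iff arrival_time_Suc positive_clocks_def)
    then show ?case using that by (simp add: strict_mono_eq)
  qed
  have "AE \<omega> in D. d = e \<or> ?t \<omega> d \<noteq> ?t \<omega> e" for d e :: "('n \<times> nat) + ('n \<times> nat)"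
  proof (cases "d = e")
    case False
    consider i k where "d = Inr (i, k)" | i k where "e = Inr (i, k)"
      | i k j l where "d = Inl (i, k)" "e = Inl (j, l)"
      by (metis old.sum.exhaust surj_pair)
    then have "AE \<omega> in D. ?t \<omega> d \<noteq> ?t \<omega> e"
    proof cases
      case (1 i k)
      then show ?thesis using E[of e i k] False by simp
    next
      case (2 i k)
      then show ?thesis using E[of d i k] False by (auto elim!: eventually_mono)
    next
      case (3 i k j l)
      then show ?thesis using A[of i j k l] A'[of k l i] False by (cases "i = j") simp_all
    qed
    then show ?thesis by simp
  qed simp
  then have "AE \<omega> in D. \<forall>d e. d = e \<or> ?t \<omega> d \<noteq> ?t \<omega> e"
    by (simp add: AE_all_countable)
  then show ?thesis
    by eventually_elim (auto simp: no_ties_def inj_def)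
qed

lemma nn_integral_exp_arrival_time:
  "(\<integral>\<^sup>+\<omega>. ennreal (exp (- arrival_time \<omega> i k)) \<partial>D) = ennreal ((lam $ i / (lam $ i + 1)) ^ Suc k)"
proof -
  have step: "(\<integral>\<^sup>+\<omega>. ennreal (exp (- arrival_time \<omega> i k)) \<partial>D) =
      (\<integral>\<^sup>+\<omega>. ennreal (exp (- prev_arrival_time \<omega> i k)) \<partial>D) * ennreal (lam $ i / (lam $ i + 1))" for k
  proof -
    have p: "prev_arrival_time (set_gap (i, k) \<omega> z) i k = prev_arrival_time \<omega> i k" for \<omega> z
      by (cases k) (simp_all add: prev_arrival_time_def arrival_time_fun_upd)
    have "(\<integral>\<^sup>+\<omega>. ennreal (exp (- arrival_time \<omega> i k)) \<partial>D) =
        (\<integral>\<^sup>+\<omega>. \<integral>\<^sup>+z. ennreal (exp (- prev_arrival_time \<omega> i k)) * ennreal (exp (- z)) \<partial>expo (lam $ i) \<partial>D)"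
      by (subst nn_integral_set_gap[where p = "(i, k)"])
        (simp_all add: arrival_time_eq_prev p ennreal_mult[symmetric] exp_add[symmetric])
    also have "\<dots> = (\<integral>\<^sup>+\<omega>. ennreal (exp (- prev_arrival_time \<omega> i k)) * ennreal (lam $ i / (lam $ i + 1)) \<partial>D)"
      by (intro nn_integral_cong) (simp add: nn_integral_cmult expo_laplace[OF lam_pos])
    finally show ?thesis by (simp add: nn_integral_multc)
  qed
  interpret prob_space D by (rule prob_space_D)
  have pos: "0 \<le> lam $ i / (lam $ i + 1)" using lam_pos[of i] by simp
  show ?thesis
  proof (induction k)
    case 0
    then show ?case using emeasure_space_1 by (subst step) (simp add: prev_arrival_time_def)
  next
    case (Suc k)
    define c where "c = lam $ i / (lam $ i + 1)"
    have "(\<integral>\<^sup>+\<omega>. ennreal (exp (- arrival_time \<omega> i (Suc k))) \<partial>D) = ennreal (c ^ Suc k) * ennreal c"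
      by (simp only: step[of "Suc k"] prev_arrival_time_def nat.case Suc c_def)
    also have "\<dots> = ennreal (c ^ Suc (Suc k))"
      using pos unfolding c_def[symmetric] by (simp add: ennreal_mult[symmetric] ac_simps)
    finally show ?case by (simp only: c_def)
  qed
qed

text \<open>A Chernoff bound: if all arrivals of a type occur before \<open>n\<close>, then
  \<open>exp (- n)\<close> bounds every \<open>exp (- arrival_time)\<close> from below, while the
  expectations of the latter decay geometrically.\<close>

lemma AE_unbounded: "AE \<omega> in D. \<forall>i t. \<exists>k. t \<le> arrival_time \<omega> i k"
proof -
  have "AE \<omega> in D. \<exists>k. real n \<le> arrival_time \<omega> i k" for i n
  proof -
    let ?c = "lam $ i / (lam $ i + 1)"
    let ?B = "\<lambda>\<omega>. of_bool (\<not> (\<exists>k. real n \<le> arrival_time \<omega> i k)) :: ennreal"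
    have "(\<integral>\<^sup>+\<omega>. ennreal (exp (- real n)) * ?B \<omega> \<partial>D) \<le> ennreal (?c ^ Suc k)" for k
      unfolding nn_integral_exp_arrival_time[symmetric]
      by (intro nn_integral_mono) (auto simp: not_le intro!: ennreal_leI less_imp_le)
    moreover have "(\<lambda>k. ennreal (?c ^ Suc k)) \<longlonglongrightarrow> ennreal 0"
      using lam_pos[of i] by (intro tendsto_ennrealI LIMSEQ_Suc LIMSEQ_power_zero) simp
    ultimately have "(\<integral>\<^sup>+\<omega>. ennreal (exp (- real n)) * ?B \<omega> \<partial>D) \<le> ennreal 0"
      by (intro LIMSEQ_le_const) auto
    then have "(\<integral>\<^sup>+\<omega>. ?B \<omega> \<partial>D) = 0" by (simp add: nn_integral_cmult)
    then show ?thesis by (subst (asm) nn_integral_0_iff_AE) auto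
  qed
  then have "AE \<omega> in D. \<forall>i n. \<exists>k. real n \<le> arrival_time \<omega> i k"
    by (simp add: AE_all_countable)
  then show ?thesis
  proof eventually_elim
    case (elim \<omega>)
    show ?case
    proof (intro allI)
      fix i t
      obtain n where "t \<le> real n" using real_arch_simple by blast
      moreover obtain k where "real n \<le> arrival_time \<omega> i k" using elim by blast
      ultimately show "\<exists>k. t \<le> arrival_time \<omega> i k" by (intro exI[of _ k]) simp
    qed
  qed
qed

lemma AE_regular:
  assumes "\<phi> \<in> admissible_policies"
  shows "AE \<omega> in D. regular_sample \<omega> \<phi>"
  using AE_positive_clocks AE_no_ties AE_unbounded
  by eventually_elim (simp add: regular_sample_def assms)

subsection \<open>Intensities of arrivals and expiries\<close>

text \<open>Changing gap \<open>k\<close> shifts the \<open>k\<close>-th and all later arrivals of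
  the type together with their expiries. As long as the gap is at least \<open>u\<close>, all of
  these happen no earlier than \<open>prev_arrival_time \<omega> i k + u\<close>.\<close>

lemma agree_until_set_gap:
  assumes pos: "positive_clocks \<omega>" and u: "0 < u" "u \<le> z"
  shows "agree_until (prev_arrival_time \<omega> i k + u) (set_gap (i, k) \<omega> z) (set_gap (i, k) \<omega> u)"
  unfolding agree_until_def
proof (intro allI conjI)
  fix j l
  have sm: "strict_mono (arrival_time \<omega> i)"
    using pos by (auto simp: strict_mono_Suc_iff arrival_time_Suc positive_clocks_def)
  have ge: "prev_arrival_time \<omega> i k + u \<le> arrival_time (set_gap (i, k) \<omega> y) j l"
    if "j = i" "k \<le> l" "u \<le> y" for y
    using that sm arrival_time_eq_prev[of \<omega> i k] strict_mono_less_eq[OF sm, of k l]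
    by (simp add: arrival_time_fun_upd)
  have s: "expiry_time (set_gap (i, k) \<omega> y) j l = arrival_time (set_gap (i, k) \<omega> y) j l + snd (\<omega> (j, l))" for y
    by (simp add: expiry_time_def)
  have s_pos: "0 < snd (\<omega> (j, l))" using pos by (simp add: positive_clocks_def)
  show "min (arrival_time (set_gap (i, k) \<omega> z) j l) (prev_arrival_time \<omega> i k + u) =
      min (arrival_time (set_gap (i, k) \<omega> u) j l) (prev_arrival_time \<omega> i k + u)"
  proof (cases "j = i \<and> k \<le> l")
    case True
    then show ?thesis using ge[of z] ge[of u] u by (simp add: min_absorb2)
  next
    case False
    then show ?thesis by (auto simp: arrival_time_fun_upd)
  qed
  show "min (expiry_time (set_gap (i, k) \<omega> z) j l) (prev_arrival_time \<omega> i k + u) =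
      min (expiry_time (set_gap (i, k) \<omega> u) j l) (prev_arrival_time \<omega> i k + u)"
  proof (cases "j = i \<and> k \<le> l")
    case True
    then have "prev_arrival_time \<omega> i k + u \<le> expiry_time (set_gap (i, k) \<omega> y) j l" if "u \<le> y" for y
      using ge[of y] that s_pos unfolding s by simp
    from this[of z] this[of u] show ?thesis using u by (simp add: min_absorb2)
  next
    case False
    then show ?thesis unfolding s by (auto simp: arrival_time_fun_upd)
  qed
qed

lemma agree_until_set_sojourn:
  assumes u: "0 < u" "u \<le> z"
  shows "agree_until (arrival_time \<omega> i k + u) (set_sojourn (i, k) \<omega> z) (set_sojourn (i, k) \<omega> u)"
  using u by (auto simp: agree_until_def expiry_time_def arrival_time_fun_upd)

text \<open>The compensator formula of the Poisson process for integrands that depend only on the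
  strict past: \<open>clock_intensity\<close> for each gap, summed over the gaps.\<close>

lemma arrival_intensity:
  fixes H :: "'n sample \<Rightarrow> real \<Rightarrow> ennreal"
  assumes H [measurable]: "(\<lambda>x. H (fst x) (snd x)) \<in> borel_measurable (D \<Otimes>\<^sub>M borel)"
    and loc: "\<And>\<omega> \<omega>' t. agree_until t \<omega> \<omega>' \<Longrightarrow> H \<omega> t = H \<omega>' t"
  shows "(\<integral>\<^sup>+\<omega>. (\<Sum>k. H \<omega> (arrival_time \<omega> i k)) \<partial>D) =
    ennreal (lam $ i) * (\<integral>\<^sup>+\<omega>. \<integral>\<^sup>+t. of_bool (0 < t) * H \<omega> t \<partial>lborel \<partial>D)"
proof -
  interpret L: sigma_finite_measure "lborel :: real measure" by (rule sigma_finite_lborel)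
  have H' [measurable (raw)]: "(\<lambda>x. H (f x) (g x)) \<in> borel_measurable N"
    if "f \<in> N \<rightarrow>\<^sub>M D" "g \<in> borel_measurable N" for f g and N :: "'x measure"
    using measurable_compose[OF measurable_Pair[OF that] H] by simp
  have step: "(\<integral>\<^sup>+\<omega>. H \<omega> (arrival_time \<omega> i k) \<partial>D) = ennreal (lam $ i) *
     (\<integral>\<^sup>+\<omega>. \<integral>\<^sup>+t. of_bool (prev_arrival_time \<omega> i k < t \<and> t \<le> arrival_time \<omega> i k) * H \<omega> t \<partial>lborel \<partial>D)" for k
    unfolding arrival_time_eq_prev
  proof (rule clock_intensity[where upd = "set_gap (i, k)"])
    show "(\<integral>\<^sup>+\<omega>. f \<omega> \<partial>D) = (\<integral>\<^sup>+\<omega>. \<integral>\<^sup>+z. f (set_gap (i, k) \<omega> z) \<partial>expo (lam $ i) \<partial>D)"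
      if "f \<in> borel_measurable D" for f
      using nn_integral_set_gap[OF that, of "(i, k)"] by simp
    show "prev_arrival_time (set_gap (i, k) \<omega> z) i k = prev_arrival_time \<omega> i k" for \<omega> z
      by (cases k) (simp_all add: prev_arrival_time_def arrival_time_fun_upd)
    show "AE \<omega> in D. \<forall>u z. 0 < u \<longrightarrow> u \<le> z \<longrightarrow>
        H (set_gap (i, k) \<omega> z) (prev_arrival_time \<omega> i k + u) =
        H (set_gap (i, k) \<omega> u) (prev_arrival_time \<omega> i k + u)"
      using AE_positive_clocks by eventually_elim (blast intro: loc agree_until_set_gap)
  qed (simp_all add: prob_space_D lam_pos)
  have "(\<integral>\<^sup>+\<omega>. (\<Sum>k. H \<omega> (arrival_time \<omega> i k)) \<partial>D) = (\<Sum>k. \<integral>\<^sup>+\<omega>. H \<omega> (arrival_time \<omega> i k) \<partial>D)"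
    by (rule nn_integral_suminf) measurable
  also have "\<dots> = ennreal (lam $ i) * (\<Sum>k. \<integral>\<^sup>+\<omega>. \<integral>\<^sup>+t. of_bool (prev_arrival_time \<omega> i k < t \<and>
      t \<le> arrival_time \<omega> i k) * H \<omega> t \<partial>lborel \<partial>D)"
    unfolding step by (rule ennreal_suminf_cmult)
  also have "(\<Sum>k. \<integral>\<^sup>+\<omega>. \<integral>\<^sup>+t. of_bool (prev_arrival_time \<omega> i k < t \<and>
      t \<le> arrival_time \<omega> i k) * H \<omega> t \<partial>lborel \<partial>D) =
    (\<integral>\<^sup>+\<omega>. \<integral>\<^sup>+t. (\<Sum>k. of_bool (prev_arrival_time \<omega> i k < t \<and>
      t \<le> arrival_time \<omega> i k) * H \<omega> t) \<partial>lborel \<partial>D)"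
    by (subst nn_integral_suminf[symmetric], measurable)
      (intro nn_integral_cong nn_integral_suminf[symmetric], measurable)
  also have "\<dots> = (\<integral>\<^sup>+\<omega>. \<integral>\<^sup>+t. of_bool (0 < t) * H \<omega> t \<partial>lborel \<partial>D)"
  proof (rule nn_integral_cong_AE)
    \<comment> \<open>Regularity is formulated for a policy, so the policy that never matches serves
      to obtain the facts about arrivals.\<close>
    have "(\<lambda>_ _. None) \<in> admissible_policies" by (simp add: admissible_policies_def)
    from AE_regular[OF this]
    show "AE \<omega> in D. (\<integral>\<^sup>+t. (\<Sum>k. of_bool (prev_arrival_time \<omega> i k < t \<and>
        t \<le> arrival_time \<omega> i k) * H \<omega> t) \<partial>lborel) = (\<integral>\<^sup>+t. of_bool (0 < t) * H \<omega> t \<partial>lborel)"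
    proof eventually_elim
      case (elim \<omega>)
      then interpret regular_sample \<omega> "\<lambda>_ _. None" .
      show ?case
      proof (rule nn_integral_cong)
        fix t :: real
        show "(\<Sum>k. of_bool (prev_arrival_time \<omega> i k < t \<and> t \<le> arrival_time \<omega> i k) * H \<omega> t) =
            of_bool (0 < t) * H \<omega> t"
        proof (cases "0 < t")
          case True
          then show ?thesis using sum_interarrival[OF True, of i] by (subst ennreal_suminf_multc) simp
        next
          case False
          then have "\<not> t > prev_arrival_time \<omega> i k" for k
            using arrival_time_pos[of i] by (auto simp: prev_arrival_time_def not_less split: nat.split
                intro: order.trans less_imp_le)
          then show ?thesis using False by simp
        qed
      qed
    qed
  qed
  finally show ?thesis .
qed

lemma expiry_intensity:
  fixes H :: "'n sample \<Rightarrow> real \<Rightarrow> ennreal"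
  assumes H [measurable]: "(\<lambda>x. H (fst x) (snd x)) \<in> borel_measurable (D \<Otimes>\<^sub>M borel)"
    and loc: "\<And>\<omega> \<omega>' t. agree_until t \<omega> \<omega>' \<Longrightarrow> H \<omega> t = H \<omega>' t"
  shows "(\<integral>\<^sup>+\<omega>. H \<omega> (expiry_time \<omega> i k) \<partial>D) = ennreal (th i) *
     (\<integral>\<^sup>+\<omega>. \<integral>\<^sup>+t. of_bool (arrival_time \<omega> i k < t \<and> t \<le> expiry_time \<omega> i k) * H \<omega> t \<partial>lborel \<partial>D)"
  unfolding expiry_time_def
proof (rule clock_intensity[where upd = "set_sojourn (i, k)"])
  show "(\<integral>\<^sup>+\<omega>. f \<omega> \<partial>D) = (\<integral>\<^sup>+\<omega>. \<integral>\<^sup>+z. f (set_sojourn (i, k) \<omega> z) \<partial>expo (th i) \<partial>D)"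
    if "f \<in> borel_measurable D" for f
    using nn_integral_set_sojourn[OF that, of "(i, k)"] by simp
  show "AE \<omega> in D. \<forall>u z. 0 < u \<longrightarrow> u \<le> z \<longrightarrow>
      H (set_sojourn (i, k) \<omega> z) (arrival_time \<omega> i k + u) =
      H (set_sojourn (i, k) \<omega> u) (arrival_time \<omega> i k + u)"
    by (blast intro: loc agree_until_set_sojourn AE_I2)
qed (simp_all add: prob_space_D th_pos arrival_time_fun_upd)

text \<open>Poisson arrivals see time averages, here in expectation and up to a finite time: the
  state just before an arrival does not depend on when the current gap ends.\<close>

lemma nn_integral_count_arrivals:
  assumes adm: "\<phi> \<in> admissible_policies"
  shows "(\<integral>\<^sup>+\<omega>. count_events (\<lambda>s v. v = Arrival i \<and> P (queue_lengths s)) \<phi> T \<omega> \<partial>D) = ennreal (lam $ i) *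
    (\<integral>\<^sup>+\<omega>. \<integral>\<^sup>+t. of_bool (0 < t \<and> t \<le> T \<and> P (queue_lengths (config_before \<phi> \<omega> t))) \<partial>lborel \<partial>D)"
proof -
  let ?H = "\<lambda>\<omega> t. of_bool (t \<le> T \<and> P (queue_lengths (config_before \<phi> \<omega> t))) :: ennreal"
  have "(\<integral>\<^sup>+\<omega>. count_events (\<lambda>s v. v = Arrival i \<and> P (queue_lengths s)) \<phi> T \<omega> \<partial>D) =
      (\<integral>\<^sup>+\<omega>. (\<Sum>k. ?H \<omega> (arrival_time \<omega> i k)) \<partial>D)"
    using AE_regular[OF adm]
    by (intro nn_integral_cong_AE, eventually_elim) (rule regular_sample.count_arrivals)
  also have "\<dots> = ennreal (lam $ i) * (\<integral>\<^sup>+\<omega>. \<integral>\<^sup>+t. of_bool (0 < t) * ?H \<omega> t \<partial>lborel \<partial>D)"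
  proof (rule arrival_intensity)
    have "Measurable.pred (D \<Otimes>\<^sub>M borel) (\<lambda>x. P (queue_lengths (config_before \<phi> (fst x) (snd x))))"
      by (rule measurable_compose[OF measurable_config_before]) simp
    then show "(\<lambda>x. ?H (fst x) (snd x)) \<in> borel_measurable (D \<Otimes>\<^sub>M borel)" by measurable
  qed (simp add: agree_until_config_before)
  also have "(\<integral>\<^sup>+\<omega>. \<integral>\<^sup>+t. of_bool (0 < t) * ?H \<omega> t \<partial>lborel \<partial>D) =
    (\<integral>\<^sup>+\<omega>. \<integral>\<^sup>+t. of_bool (0 < t \<and> t \<le> T \<and> P (queue_lengths (config_before \<phi> \<omega> t))) \<partial>lborel \<partial>D)"
    by (simp add: of_bool_conj)
  finally show ?thesis .
qed

lemma nn_integral_count_expiries: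
  assumes adm: "\<phi> \<in> admissible_policies"
  shows "(\<integral>\<^sup>+\<omega>. count_events (\<lambda>s v. \<exists>k. v = Expiry i k) \<phi> T \<omega> \<partial>D) = ennreal (th i) *
    (\<integral>\<^sup>+\<omega>. \<integral>\<^sup>+t. of_bool (0 < t \<and> t \<le> T) * of_nat (queue_lengths (config_before \<phi> \<omega> t) i) \<partial>lborel \<partial>D)"
proof -
  interpret L: sigma_finite_measure "lborel :: real measure" by (rule sigma_finite_lborel)
  let ?H = "\<lambda>k \<omega> t. of_bool (t \<le> T \<and> k \<in> set (snd (config_before \<phi> \<omega> t) i)) :: ennreal"
  have w: "Measurable.pred (D \<Otimes>\<^sub>M borel) (\<lambda>x. k \<in> set (snd (config_before \<phi> (fst x) (snd x)) i))" for k
    by (rule measurable_compose[OF measurable_config_before]) simp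
  then have H [measurable]: "(\<lambda>x. ?H k (fst x) (snd x)) \<in> borel_measurable (D \<Otimes>\<^sub>M borel)" for k
    by measurable
  have H' [measurable (raw)]: "(\<lambda>x. ?H k (f x) (g x)) \<in> borel_measurable N"
    if "f \<in> N \<rightarrow>\<^sub>M D" "g \<in> borel_measurable N" for f g k and N :: "'x measure"
    using measurable_compose[OF measurable_Pair[OF that] H] by simp
  have "(\<integral>\<^sup>+\<omega>. count_events (\<lambda>s v. \<exists>k. v = Expiry i k) \<phi> T \<omega> \<partial>D) =
      (\<integral>\<^sup>+\<omega>. (\<Sum>k. ?H k \<omega> (expiry_time \<omega> i k)) \<partial>D)"
    using AE_regular[OF adm]
    by (intro nn_integral_cong_AE, eventually_elim) (rule regular_sample.count_expiries)
  also have "\<dots> = (\<Sum>k. \<integral>\<^sup>+\<omega>. ?H k \<omega> (expiry_time \<omega> i k) \<partial>D)"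
    by (rule nn_integral_suminf) (rule H'; measurable)
  also have "\<dots> = (\<Sum>k. ennreal (th i) * (\<integral>\<^sup>+\<omega>. \<integral>\<^sup>+t.
      of_bool (arrival_time \<omega> i k < t \<and> t \<le> expiry_time \<omega> i k) * ?H k \<omega> t \<partial>lborel \<partial>D))"
    by (intro suminf_cong expiry_intensity H) (simp add: agree_until_config_before)
  also have "\<dots> = ennreal (th i) * (\<Sum>k. \<integral>\<^sup>+\<omega>. \<integral>\<^sup>+t.
      of_bool (arrival_time \<omega> i k < t \<and> t \<le> expiry_time \<omega> i k) * ?H k \<omega> t \<partial>lborel \<partial>D)"
    by (rule ennreal_suminf_cmult)
  also have "(\<Sum>k. \<integral>\<^sup>+\<omega>. \<integral>\<^sup>+t.
      of_bool (arrival_time \<omega> i k < t \<and> t \<le> expiry_time \<omega> i k) * ?H k \<omega> t \<partial>lborel \<partial>D) =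
    (\<integral>\<^sup>+\<omega>. \<integral>\<^sup>+t. (\<Sum>k. of_bool (arrival_time \<omega> i k < t \<and> t \<le> expiry_time \<omega> i k) * ?H k \<omega> t) \<partial>lborel \<partial>D)"
    by (subst nn_integral_suminf[symmetric], measurable)
      (intro nn_integral_cong nn_integral_suminf[symmetric], measurable)
  also have "\<dots> = (\<integral>\<^sup>+\<omega>. \<integral>\<^sup>+t. of_bool (0 < t \<and> t \<le> T) * of_nat (queue_lengths (config_before \<phi> \<omega> t) i) \<partial>lborel \<partial>D)"
  proof (rule nn_integral_cong_AE)
    from AE_regular[OF adm]
    show "AE \<omega> in D. (\<integral>\<^sup>+t. (\<Sum>k. of_bool (arrival_time \<omega> i k < t \<and> t \<le> expiry_time \<omega> i k) * ?H k \<omega> t) \<partial>lborel) =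
        (\<integral>\<^sup>+t. of_bool (0 < t \<and> t \<le> T) * of_nat (queue_lengths (config_before \<phi> \<omega> t) i) \<partial>lborel)"
    proof eventually_elim
      case (elim \<omega>)
      then interpret regular_sample \<omega> \<phi> .
      show ?case
      proof (rule nn_integral_cong)
        fix t :: real
        \<comment> \<open>A waiting demand is within its lifetime, so the running interval of its
          clock is absorbed and only the restriction of \<open>t\<close> to \<open>(0, T]\<close>
          remains. Summing over \<open>k\<close> then gives the queue length.\<close>
        have "of_bool (arrival_time \<omega> i k < t \<and> t \<le> expiry_time \<omega> i k) * ?H k \<omega> t =
            of_bool (0 < t \<and> t \<le> T) * of_bool (k \<in> set (snd (config_before \<phi> \<omega> t) i))" for k
          using waiting_bounds[of k t i] arrival_time_pos[of i k] by auto
        then show "(\<Sum>k. of_bool (arrival_time \<omega> i k < t \<and> t \<le> expiry_time \<omega> i k) * ?H k \<omega> t) =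
            of_bool (0 < t \<and> t \<le> T) * of_nat (queue_lengths (config_before \<phi> \<omega> t) i)"
          by (simp only: ennreal_suminf_cmult sum_waiting)
      qed
    qed
  qed
  finally show ?thesis .
qed

lemma nn_integral_all_arrivals:
  assumes adm: "\<phi> \<in> admissible_policies" and "0 \<le> T"
  shows "(\<integral>\<^sup>+\<omega>. count_events (\<lambda>s v. v = Arrival i) \<phi> T \<omega> \<partial>D) = ennreal (lam $ i * T)"
proof -
  interpret prob_space D by (rule prob_space_D)
  have "(\<integral>\<^sup>+t. of_bool (0 < t \<and> t \<le> T) \<partial>lborel) = (\<integral>\<^sup>+t. indicator {0<..T} t \<partial>lborel)"
    by (intro nn_integral_cong) (auto simp: indicator_def)
  also have "\<dots> = ennreal T" using assms(2) by simp
  finally show ?thesis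
    using nn_integral_count_arrivals[OF adm, of i "\<lambda>_. True" T] lam_pos[of i] assms(2) emeasure_space_1
    by (simp add: ennreal_mult)
qed

text \<open>The waiting demands are at most those that an infinite-server queue would hold.\<close>

lemma nn_integral_final_queue_le:
  assumes adm: "\<phi> \<in> admissible_policies"
  shows "(\<integral>\<^sup>+\<omega>. of_nat (final_queue \<phi> T \<omega> i) \<partial>D) \<le> ennreal (lam $ i / th i)"
proof -
  interpret prob_space D by (rule prob_space_D)
  let ?h = "\<lambda>t. of_bool (t \<le> T) * ennreal (exp (- th i * (T - t)))"
  have "(\<integral>\<^sup>+\<omega>. of_nat (final_queue \<phi> T \<omega> i) \<partial>D) \<le>
      (\<integral>\<^sup>+\<omega>. (\<Sum>k. of_bool (arrival_time \<omega> i k \<le> T \<and> T < expiry_time \<omega> i k)) \<partial>D)"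
    using AE_regular[OF adm]
    by (intro nn_integral_mono_AE, eventually_elim) (rule regular_sample.final_queue_le)
  also have "\<dots> = (\<Sum>k. \<integral>\<^sup>+\<omega>. of_bool (arrival_time \<omega> i k \<le> T \<and> T < expiry_time \<omega> i k) \<partial>D)"
    by (rule nn_integral_suminf) measurable
  also have "\<dots> = (\<Sum>k. \<integral>\<^sup>+\<omega>. ?h (arrival_time \<omega> i k) \<partial>D)"
  proof (intro suminf_cong)
    fix k
    have "(\<integral>\<^sup>+\<omega>. of_bool (arrival_time \<omega> i k \<le> T \<and> T < expiry_time \<omega> i k) \<partial>D) =
      (\<integral>\<^sup>+\<omega>. \<integral>\<^sup>+z. of_bool (arrival_time \<omega> i k \<le> T) * of_bool (T - arrival_time \<omega> i k < z) \<partial>expo (th i) \<partial>D)"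
      by (subst nn_integral_set_sojourn[where p = "(i, k)"])
        (auto intro!: nn_integral_cong simp: expiry_time_def arrival_time_fun_upd)
    also have "\<dots> = (\<integral>\<^sup>+\<omega>. ?h (arrival_time \<omega> i k) \<partial>D)"
    proof (rule nn_integral_cong)
      fix \<omega> :: "'n sample"
      show "(\<integral>\<^sup>+z. of_bool (arrival_time \<omega> i k \<le> T) * of_bool (T - arrival_time \<omega> i k < z) \<partial>expo (th i)) =
          ?h (arrival_time \<omega> i k)"
      proof (cases "arrival_time \<omega> i k \<le> T")
        case True
        then show ?thesis using expo_tail_less[OF th_pos, of "T - arrival_time \<omega> i k" i] by simp
      qed simp
    qed
    finally show "(\<integral>\<^sup>+\<omega>. of_bool (arrival_time \<omega> i k \<le> T \<and> T < expiry_time \<omega> i k) \<partial>D) = \<dots>" .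
  qed
  also have "\<dots> = (\<integral>\<^sup>+\<omega>. (\<Sum>k. ?h (arrival_time \<omega> i k)) \<partial>D)"
    by (rule nn_integral_suminf[symmetric]) measurable
  \<comment> \<open>After resampling the sojourn time, the weight of an arrival depends on its time
    alone, so it is trivially local.\<close>
  also have "\<dots> = ennreal (lam $ i) * (\<integral>\<^sup>+\<omega>. \<integral>\<^sup>+t. of_bool (0 < t) * ?h t \<partial>lborel \<partial>D)"
    by (rule arrival_intensity) simp_all
  also have "\<dots> = ennreal (lam $ i) * (\<integral>\<^sup>+t. of_bool (0 < t) * ?h t \<partial>lborel)"
    using emeasure_space_1 by simp
  also have "(\<integral>\<^sup>+t. of_bool (0 < t) * ?h t \<partial>lborel) \<le> ennreal (1 / th i)"
  proof -
    interpret E: prob_space "expo (th i)" by (rule prob_space_exponential_density[OF th_pos])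
    have "(\<integral>\<^sup>+t. of_bool (0 < t) * ?h t \<partial>lborel) \<le> (\<integral>\<^sup>+t. ?h t \<partial>lborel)"
      by (intro nn_integral_mono) (auto simp: of_bool_def)
    \<comment> \<open>The reflection \<open>t = T - u\<close> turns the weight into the exponential
      density divided by its rate, so the bound does not depend on \<open>T\<close>.\<close>
    also have "\<dots> = (\<integral>\<^sup>+u. ?h (T + - 1 * u) \<partial>lborel)"
      by (subst nn_integral_real_affine[where c = "- 1" and t = T]) auto
    also have "\<dots> = (\<integral>\<^sup>+u. ennreal (1 / th i) * ennreal (exponential_density (th i) u) \<partial>lborel)"
      using th_pos[of i]
      by (intro nn_integral_cong)
        (auto simp: exponential_density_def ennreal_mult[symmetric] ac_simps)
    also have "\<dots> = ennreal (1 / th i) * emeasure (expo (th i)) (space (expo (th i)))"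
      by (subst nn_integral_cmult) (auto simp: emeasure_density)
    finally show ?thesis using E.emeasure_space_1 by simp
  qed
  then have "ennreal (lam $ i) * (\<integral>\<^sup>+t. of_bool (0 < t) * ?h t \<partial>lborel) \<le>
      ennreal (lam $ i) * ennreal (1 / th i)"
    by (rule mult_left_mono) simp
  also have "\<dots> = ennreal (lam $ i / th i)"
    using lam_pos[of i] th_pos[of i] by (simp add: ennreal_mult[symmetric])
  finally show ?thesis .
qed

subsection \<open>Expected flows\<close>

text \<open>As for \<open>x i j\<close> in the program, the first index is the waiting type and the
  second the arriving one, which is opposite to the argument order of \<open>\<phi>\<close> and of
  the event costs.\<close>

definition flow :: "'n policy \<Rightarrow> real \<Rightarrow> 'n \<Rightarrow> 'n \<Rightarrow> real" where
  "flow \<phi> T i j = enn2real (\<integral>\<^sup>+\<omega>.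
     count_events (\<lambda>s v. v = Arrival j \<and> \<phi> j (queue_lengths s) = Some i) \<phi> T \<omega> \<partial>D)"

definition expired :: "'n policy \<Rightarrow> real \<Rightarrow> 'n \<Rightarrow> real" where
  "expired \<phi> T i = enn2real (\<integral>\<^sup>+\<omega>. count_events (\<lambda>s v. \<exists>k. v = Expiry i k) \<phi> T \<omega> \<partial>D)"

definition left_over :: "'n policy \<Rightarrow> real \<Rightarrow> 'n \<Rightarrow> real" where
  "left_over \<phi> T i = enn2real (\<integral>\<^sup>+\<omega>. of_nat (final_queue \<phi> T \<omega> i) \<partial>D)"

lemma flow_nonneg: "0 \<le> flow \<phi> T i j" "0 \<le> expired \<phi> T i" "0 \<le> left_over \<phi> T i"
  by (simp_all add: flow_def expired_def left_over_def)

context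
  fixes \<phi> :: "'n policy" and T :: real
  assumes adm: "\<phi> \<in> admissible_policies" and T: "0 \<le> T"
begin

lemma nn_integral_balance:
  "ennreal (lam $ i * T) =
     (\<Sum>j\<in>UNIV. \<integral>\<^sup>+\<omega>. count_events (\<lambda>s v. v = Arrival j \<and> \<phi> j (queue_lengths s) = Some i) \<phi> T \<omega> \<partial>D) +
     (\<Sum>j\<in>UNIV. \<integral>\<^sup>+\<omega>. count_events (\<lambda>s v. v = Arrival i \<and> \<phi> i (queue_lengths s) = Some j) \<phi> T \<omega> \<partial>D) +
     (\<integral>\<^sup>+\<omega>. count_events (\<lambda>s v. \<exists>k. v = Expiry i k) \<phi> T \<omega> \<partial>D) +
     (\<integral>\<^sup>+\<omega>. of_nat (final_queue \<phi> T \<omega> i) \<partial>D)"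
proof -
  have "ennreal (lam $ i * T) = (\<integral>\<^sup>+\<omega>. count_events (\<lambda>s v. v = Arrival i) \<phi> T \<omega> \<partial>D)"
    using nn_integral_all_arrivals[OF adm T] by simp
  also have "\<dots> = (\<integral>\<^sup>+\<omega>.
     (\<Sum>j\<in>UNIV. count_events (\<lambda>s v. v = Arrival j \<and> \<phi> j (queue_lengths s) = Some i) \<phi> T \<omega>) +
     (\<Sum>j\<in>UNIV. count_events (\<lambda>s v. v = Arrival i \<and> \<phi> i (queue_lengths s) = Some j) \<phi> T \<omega>) +
     count_events (\<lambda>s v. \<exists>k. v = Expiry i k) \<phi> T \<omega> + of_nat (final_queue \<phi> T \<omega> i) \<partial>D)"
    using AE_regular[OF adm]
    by (intro nn_integral_cong_AE, eventually_elim) (rule regular_sample.count_balance)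
  finally show ?thesis
    by (simp add: nn_integral_add nn_integral_sum)
qed

text \<open>Each quantity is a summand in a balance whose total is the finite expected number of
  arrivals.\<close>

lemma nn_integral_finite:
  "(\<integral>\<^sup>+\<omega>. count_events (\<lambda>s v. v = Arrival j \<and> \<phi> j (queue_lengths s) = Some i) \<phi> T \<omega> \<partial>D) < \<top>"
  "(\<integral>\<^sup>+\<omega>. count_events (\<lambda>s v. \<exists>k. v = Expiry i k) \<phi> T \<omega> \<partial>D) < \<top>"
  "(\<integral>\<^sup>+\<omega>. of_nat (final_queue \<phi> T \<omega> i) \<partial>D) < \<top>"
proof -
  have "ennreal (lam $ i * T) < \<top>" by simp
  then show "(\<integral>\<^sup>+\<omega>. count_events (\<lambda>s v. \<exists>k. v = Expiry i k) \<phi> T \<omega> \<partial>D) < \<top>"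
    "(\<integral>\<^sup>+\<omega>. of_nat (final_queue \<phi> T \<omega> i) \<partial>D) < \<top>"
    and "(\<integral>\<^sup>+\<omega>. count_events (\<lambda>s v. v = Arrival j \<and> \<phi> j (queue_lengths s) = Some i) \<phi> T \<omega> \<partial>D) < \<top>"
    unfolding nn_integral_balance[of i] by (simp_all add: ennreal_add_less_top)
qed

lemma ennreal_flow:
  "(\<integral>\<^sup>+\<omega>. count_events (\<lambda>s v. v = Arrival j \<and> \<phi> j (queue_lengths s) = Some i) \<phi> T \<omega> \<partial>D) =
     ennreal (flow \<phi> T i j)"
  "(\<integral>\<^sup>+\<omega>. count_events (\<lambda>s v. \<exists>k. v = Expiry i k) \<phi> T \<omega> \<partial>D) = ennreal (expired \<phi> T i)"
  "(\<integral>\<^sup>+\<omega>. of_nat (final_queue \<phi> T \<omega> i) \<partial>D) = ennreal (left_over \<phi> T i)"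
  using nn_integral_finite by (simp_all add: flow_def expired_def left_over_def)

lemma flow_balance:
  "(\<Sum>j\<in>UNIV. flow \<phi> T j i) + (\<Sum>j\<in>UNIV. flow \<phi> T i j) + expired \<phi> T i =
     lam $ i * T - left_over \<phi> T i"
proof -
  have "ennreal (lam $ i * T) = ennreal ((\<Sum>j\<in>UNIV. flow \<phi> T i j) + (\<Sum>j\<in>UNIV. flow \<phi> T j i) +
      expired \<phi> T i + left_over \<phi> T i)"
    using nn_integral_balance[of i] flow_nonneg
    by (simp add: ennreal_flow sum_nonneg sum_ennreal ennreal_plus[symmetric] del: ennreal_plus)
  then have "lam $ i * T = (\<Sum>j\<in>UNIV. flow \<phi> T i j) + (\<Sum>j\<in>UNIV. flow \<phi> T j i) +
      expired \<phi> T i + left_over \<phi> T i"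
    using lam_pos[of i] T flow_nonneg by (subst (asm) ennreal_inj) (auto intro!: add_nonneg_nonneg sum_nonneg)
  then show ?thesis by simp
qed

lemma left_over_le: "left_over \<phi> T i \<le> lam $ i / th i"
  using nn_integral_final_queue_le[OF adm, of T i] lam_pos[of i] th_pos[of i]
  by (simp add: ennreal_flow)

lemma scaled_flow_eq:
  "ennreal (th i * flow \<phi> T i j) = ennreal (th i) * ennreal (lam $ j) *
     (\<integral>\<^sup>+\<omega>. \<integral>\<^sup>+t. of_bool (0 < t \<and> t \<le> T \<and>
       \<phi> j (queue_lengths (config_before \<phi> \<omega> t)) = Some i) \<partial>lborel \<partial>D)"
  using nn_integral_count_arrivals[OF adm, of j "\<lambda>s. \<phi> j s = Some i" T]
    th_pos[of i] lam_pos[of j] flow_nonneg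
  by (simp add: ennreal_flow ennreal_mult ac_simps)

lemma scaled_expired_eq:
  "ennreal (lam $ j * expired \<phi> T i) = ennreal (th i) * ennreal (lam $ j) *
     (\<integral>\<^sup>+\<omega>. \<integral>\<^sup>+t. of_bool (0 < t \<and> t \<le> T) *
       of_nat (queue_lengths (config_before \<phi> \<omega> t) i) \<partial>lborel \<partial>D)"
  using nn_integral_count_expiries[OF adm, of i T] th_pos[of i] lam_pos[of j] flow_nonneg
  by (simp add: ennreal_flow ennreal_mult ac_simps)

text \<open>A policy can prescribe a match with \<open>i\<close> only while some \<open>i\<close>
  waits, so the indicator behind the flow is at most the queue length behind the expiries. Both
  intensities carry the same factor once scaled by \<open>th i\<close> and
  \<open>lam $ j\<close>.\<close>

lemma flow_le: "th i * flow \<phi> T i j \<le> lam $ j * expired \<phi> T i"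
proof -
  have "(of_bool (\<phi> j (queue_lengths (config_before \<phi> \<omega> t)) = Some i) :: ennreal) \<le>
      of_nat (queue_lengths (config_before \<phi> \<omega> t) i)" for \<omega> t
  proof (cases "\<phi> j (queue_lengths (config_before \<phi> \<omega> t)) = Some i")
    case True
    then have "1 \<le> queue_lengths (config_before \<phi> \<omega> t) i"
      using adm by (simp add: admissible_policies_def Suc_le_eq)
    then have "of_nat 1 \<le> (of_nat (queue_lengths (config_before \<phi> \<omega> t) i) :: ennreal)"
      by (simp only: of_nat_le_iff)
    then show ?thesis using True by simp
  qed simp
  then have "ennreal (th i * flow \<phi> T i j) \<le> ennreal (lam $ j * expired \<phi> T i)"
    unfolding scaled_flow_eq scaled_expired_eq
    by (intro mult_left_mono nn_integral_mono) (auto simp: of_bool_conj)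
  then show ?thesis
    using lam_pos[of j] flow_nonneg by (subst (asm) ennreal_le_iff) (auto intro!: mult_nonneg_nonneg less_imp_le)
qed

text \<open>Equality holds when the queue of \<open>i\<close> never exceeds one and an arriving
  \<open>j\<close> takes a waiting \<open>i\<close> whenever there is one.\<close>

lemma flow_saturated:
  assumes "\<And>\<omega> t. regular_sample \<omega> \<phi> \<Longrightarrow>
     of_bool (\<phi> j (queue_lengths (config_before \<phi> \<omega> t)) = Some i) = queue_lengths (config_before \<phi> \<omega> t) i"
  shows "th i * flow \<phi> T i j = lam $ j * expired \<phi> T i"
proof -
  have "ennreal (th i * flow \<phi> T i j) = ennreal (lam $ j * expired \<phi> T i)"
    unfolding scaled_flow_eq scaled_expired_eq
  proof (rule arg_cong2[where f = "(*)", OF refl], rule nn_integral_cong_AE,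
      use AE_regular[OF adm] in eventually_elim)
    case (elim \<omega>)
    have "of_nat (queue_lengths (config_before \<phi> \<omega> t) i) =
        (of_bool (\<phi> j (queue_lengths (config_before \<phi> \<omega> t)) = Some i) :: ennreal)" for t
      unfolding assms[OF elim, symmetric] by simp
    then show ?case by (simp add: of_bool_conj mult.assoc)
  qed
  then show ?thesis
    using th_pos[of i] lam_pos[of j] flow_nonneg
    by (subst (asm) ennreal_inj) (auto intro!: mult_nonneg_nonneg less_imp_le)
qed

lemma flow_eq_0:
  assumes "\<And>s. \<phi> j s \<noteq> Some i"
  shows "flow \<phi> T i j = 0"
  by (simp add: flow_def assms count_events_def)

end

text \<open>The outer index is the waiting type, to agree with \<open>flow\<close>, whereas costs
  name the arriving type first; hence \<open>c2 j i\<close>. Symmetry of the costs later identifies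
  the result with \<open>lp_cost\<close>.\<close>

lemma total_cost_eq:
  assumes c1: "\<And>i. 0 \<le> c1 i" and c2: "\<And>i j. 0 \<le> c2 i j"
  shows "total_cost c1 c2 \<phi> T \<omega> =
    (\<Sum>i\<in>UNIV. \<Sum>j\<in>UNIV. ennreal (c2 j i) *
       count_events (\<lambda>s v. v = Arrival j \<and> \<phi> j (queue_lengths s) = Some i) \<phi> T \<omega>) +
    (\<Sum>i\<in>UNIV. ennreal (c1 i) * count_events (\<lambda>s v. \<exists>k. v = Expiry i k) \<phi> T (\<omega> :: 'n sample))"
proof -
  let ?s = "config_after \<phi> \<omega>" and ?v = "nth_event \<phi> \<omega>" and ?t = "nth_time \<phi> \<omega>"
  have "total_cost c1 c2 \<phi> T \<omega> =
     (\<Sum>n. if ?t n \<le> T then ennreal (event_cost c1 c2 \<phi> (?s n) (?v n)) else 0)"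
    unfolding total_cost_def nth_event_def nth_time_def Let_def by (rule refl)
  also have "\<dots> = (\<Sum>n. (\<Sum>i\<in>UNIV. \<Sum>j\<in>UNIV. ennreal (c2 j i) *
        of_bool (?t n \<le> T \<and> ?v n = Arrival j \<and> \<phi> j (queue_lengths (?s n)) = Some i)) +
      (\<Sum>i\<in>UNIV. ennreal (c1 i) * of_bool (?t n \<le> T \<and> (\<exists>k. ?v n = Expiry i k))))"
  proof (intro suminf_cong)
    fix n
    have delta: "(\<Sum>i\<in>UNIV. f i * of_bool (P \<and> a = i \<and> Q i)) = f a * (of_bool (P \<and> Q a) :: ennreal)"
      for f :: "'n \<Rightarrow> ennreal" and a P Q
    proof -
      have "(\<Sum>i\<in>UNIV. f i * of_bool (P \<and> a = i \<and> Q i)) = (\<Sum>i\<in>{a}. f i * of_bool (P \<and> a = i \<and> Q i))"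
        by (rule sum.mono_neutral_right) auto
      then show ?thesis by simp
    qed
    show "(if ?t n \<le> T then ennreal (event_cost c1 c2 \<phi> (?s n) (?v n)) else 0) =
      (\<Sum>i\<in>UNIV. \<Sum>j\<in>UNIV. ennreal (c2 j i) *
        of_bool (?t n \<le> T \<and> ?v n = Arrival j \<and> \<phi> j (queue_lengths (?s n)) = Some i)) +
      (\<Sum>i\<in>UNIV. ennreal (c1 i) * of_bool (?t n \<le> T \<and> (\<exists>k. ?v n = Expiry i k)))"
    proof (cases "?v n")
      case (Arrival l)
      have "(\<Sum>i\<in>UNIV. \<Sum>j\<in>UNIV. ennreal (c2 j i) *
          of_bool (?t n \<le> T \<and> l = j \<and> \<phi> j (queue_lengths (?s n)) = Some i)) =
        (\<Sum>i\<in>UNIV. ennreal (c2 l i) * of_bool (?t n \<le> T \<and> \<phi> l (queue_lengths (?s n)) = Some i))"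
        by (simp only: delta)
      also have "\<dots> = (if ?t n \<le> T then ennreal (event_cost c1 c2 \<phi> (?s n) (?v n)) else 0)"
        using delta[of "\<lambda>i. ennreal (c2 l i)" "?t n \<le> T" _ "\<lambda>_. True"] Arrival
        by (cases "\<phi> l (queue_lengths (?s n))") (simp_all add: event_cost_alt)
      finally show ?thesis using Arrival by simp
    next
      case (Expiry l k)
      then show ?thesis
        using delta[of "\<lambda>i. ennreal (c1 i)" "?t n \<le> T" l "\<lambda>_. True"] by (simp add: event_cost_alt)
    qed
  qed
  also have "\<dots> = (\<Sum>i\<in>UNIV. \<Sum>j\<in>UNIV. ennreal (c2 j i) *
       count_events (\<lambda>s v. v = Arrival j \<and> \<phi> j (queue_lengths s) = Some i) \<phi> T \<omega>) +
    (\<Sum>i\<in>UNIV. ennreal (c1 i) * count_events (\<lambda>s v. \<exists>k. v = Expiry i k) \<phi> T \<omega>)"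
    by (simp only: count_events_def ennreal_suminf_cmult[symmetric]
        suminf_add[OF summableI summableI, symmetric] suminf_sum[OF summableI])
  finally show ?thesis .
qed

lemma nn_integral_total_cost:
  assumes "\<And>i. 0 \<le> c1 i" "\<And>i j. 0 \<le> c2 i j" "\<And>i j. c2 i j = c2 j i"
    and "\<phi> \<in> admissible_policies" "0 \<le> T"
  shows "(\<integral>\<^sup>+\<omega>. total_cost c1 c2 \<phi> T \<omega> \<partial>D) = ennreal (lp_cost c1 c2 (flow \<phi> T) (expired \<phi> T))"
proof -
  have "(\<integral>\<^sup>+\<omega>. total_cost c1 c2 \<phi> T \<omega> \<partial>D) =
     (\<Sum>i\<in>UNIV. \<Sum>j\<in>UNIV. ennreal (c2 j i) * ennreal (flow \<phi> T i j)) +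
     (\<Sum>i\<in>UNIV. ennreal (c1 i) * ennreal (expired \<phi> T i))"
    using assms by (simp add: total_cost_eq nn_integral_add nn_integral_sum nn_integral_cmult ennreal_flow)
  also have "\<dots> = ennreal (lp_cost c1 c2 (flow \<phi> T) (expired \<phi> T))"
    using assms(1,2) flow_nonneg
    by (simp add: lp_cost_def assms(3)[of _ i for i] ennreal_mult[symmetric] sum_ennreal sum_nonneg
        ennreal_plus[symmetric] del: ennreal_plus)
  finally show ?thesis .
qed

end

subsection \<open>The value of the decision process\<close>

lemma (in demand_model) average_cost_eq:
  assumes "\<And>i. 0 \<le> c1 i" "\<And>i j. 0 \<le> c2 i j" "\<And>i j. c2 i j = c2 j i"
    and "\<phi> \<in> admissible_policies"
  shows "average_cost c1 c2 th lam \<phi> =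
    Limsup at_top (\<lambda>T. ereal (lp_cost c1 c2 (flow \<phi> T) (expired \<phi> T) / T))"
  unfolding average_cost_def
proof (rule Limsup_eq)
  show "\<forall>\<^sub>F T in at_top. enn2ereal (\<integral>\<^sup>+\<omega>. total_cost c1 c2 \<phi> T \<omega> \<partial>D) / ereal T =
      ereal (lp_cost c1 c2 (flow \<phi> T) (expired \<phi> T) / T)"
    using eventually_gt_at_top[of "0 :: real"]
  proof eventually_elim
    case (elim T)
    have "0 \<le> lp_cost c1 c2 (flow \<phi> T) (expired \<phi> T)"
      unfolding lp_cost_def using assms flow_nonneg
      by (intro add_nonneg_nonneg sum_nonneg mult_nonneg_nonneg) auto
    then show ?case
      using elim nn_integral_total_cost[OF assms, of T] by simp
  qed
qed

section \<open>The greedy policy within pairs\<close>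

definition pairing_policy :: "('n \<Rightarrow> 'n) \<Rightarrow> 'n policy" where
  "pairing_policy m j s =
     (if 0 < s j then Some j else if 0 < s (m j) then Some (m j) else None)"

lemma pairing_policy_admissible: "pairing_policy m \<in> admissible_policies"
  by (auto simp: admissible_policies_def pairing_policy_def split: if_splits)

text \<open>A demand joins the queue only if its whole group is empty. The conditional counts the
  group \<open>{i, m i}\<close> without repetition when \<open>i\<close> is unpaired.\<close>

lemma pairing_policy_queue:
  fixes \<omega> :: "'n::finite sample"
  assumes "regular_sample \<omega> (pairing_policy m)" and inv: "\<And>i. m (m i) = i"
  shows "queue_lengths (config_after (pairing_policy m) \<omega> n) i +
    (if m i = i then 0 else queue_lengths (config_after (pairing_policy m) \<omega> n) (m i)) \<le> 1"
proof (induction n arbitrary: i)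
  case 0
  then show ?case by (simp add: queue_lengths_def)
next
  case (Suc n)
  interpret regular_sample \<omega> "pairing_policy m" by fact
  note s = config_after_Suc event_effect_alt queue_lengths_def
  show ?case
  proof (cases "nth_event (pairing_policy m) \<omega> n")
    case (Expiry j k)
    have "queue_lengths (\<sigma> (Suc n)) l \<le> queue_lengths (\<sigma> n) l" for l
      using Expiry by (auto simp: s length_remove1)
    from this[of i] this[of "m i"] Suc[of i] show ?thesis by (auto split: if_splits)
  next
    case (Arrival j)
    show ?thesis
    proof (cases "pairing_policy m j (queue_lengths (\<sigma> n))")
      case (Some l)
      have "queue_lengths (\<sigma> (Suc n)) l \<le> queue_lengths (\<sigma> n) l" for l
        using Arrival Some by (auto simp: s)
      from this[of i] this[of "m i"] Suc[of i] show ?thesis by (auto split: if_splits)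
    next
      case None
      then have 0: "queue_lengths (\<sigma> n) j = 0" "queue_lengths (\<sigma> n) (m j) = 0"
        by (auto simp: pairing_policy_def split: if_splits)
      have l: "queue_lengths (\<sigma> (Suc n)) l = queue_lengths (\<sigma> n) l + (if l = j then 1 else 0)" for l
        using Arrival None by (auto simp: s)
      show ?thesis
        using 0 inv Suc[of i] unfolding l by (cases "i = j"; cases "m i = j") auto
    qed
  qed
qed

text \<open>With at most one demand waiting in the group, the queue length of \<open>i\<close> is an
  indicator, and it is 1 exactly when an arrival \<open>j\<close> in the group is matched with
  \<open>i\<close>.\<close>

lemma pairing_policy_saturated:
  fixes \<omega> :: "'n::finite sample"
  assumes reg: "regular_sample \<omega> (pairing_policy m)" and inv: "\<And>i. m (m i) = i"
    and j: "j = i \<or> j = m i"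
  shows "of_bool (pairing_policy m j (queue_lengths (config_before (pairing_policy m) \<omega> t)) = Some i) =
    queue_lengths (config_before (pairing_policy m) \<omega> t) i"
proof -
  obtain n where n: "config_before (pairing_policy m) \<omega> t = config_after (pairing_policy m) \<omega> n"
    using regular_sample.config_before_cases[OF reg, of t] by metis
  show ?thesis
    using pairing_policy_queue[OF reg inv, of n i] j inv[of i] unfolding n
    by (auto simp: pairing_policy_def split: if_splits)
qed

context cost_model
begin

context
  fixes lam :: "real ^ 'n"
  assumes lam: "\<And>i. 0 < lam $ i"
    and unique: "\<And>i j k. profitable lam i j \<Longrightarrow> profitable lam i k \<Longrightarrow> j = k"
begin

interpretation demand_model lam "\<lambda>_. \<theta>"
  using lam \<theta>_pos by unfold_locales

lemma c_nonneg: "0 \<le> c1 i" "0 \<le> c2 i j"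
  using c1_pos[of i] c1_le[of i j] by simp_all

text \<open>Pricing all arrivals up to \<open>T\<close> gives \<open>T\<close> times the pair value
  exactly. The correction prices the left-over demands, whose expected number is bounded uniformly
  in \<open>T\<close>.\<close>

lemma price_flow_near_value:
  assumes adm: "\<phi> \<in> admissible_policies" and T: "0 < T"
  shows "\<bar>(\<Sum>i\<in>UNIV. price m lam i * (lam $ i * T - left_over \<phi> T i)) / T - pair_value m lam\<bar> \<le>
    (\<Sum>i\<in>UNIV. \<bar>price m lam i\<bar> * (lam $ i / \<theta>)) / T"
proof -
  have "(\<Sum>i\<in>UNIV. price m lam i * (lam $ i * T - left_over \<phi> T i)) / T - pair_value m lam =
      - (\<Sum>i\<in>UNIV. price m lam i * left_over \<phi> T i) / T"
    using T by (simp add: pair_value_def field_simps sum_subtractf sum_distrib_left sum_distrib_right)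
  moreover have "\<bar>\<Sum>i\<in>UNIV. price m lam i * left_over \<phi> T i\<bar> \<le>
      (\<Sum>i\<in>UNIV. \<bar>price m lam i\<bar> * (lam $ i / \<theta>))"
    using left_over_le[OF adm] T flow_nonneg(3)
    by (intro order.trans[OF sum_abs] sum_mono) (auto simp: abs_mult simp del: times_divide_eq_right intro!: mult_left_mono)
  ultimately show ?thesis using T by (simp add: divide_right_mono abs_divide)
qed

lemma average_cost_ge:
  assumes adm: "\<phi> \<in> admissible_policies"
  shows "ereal (pair_value (optimal_partner lam) lam) \<le> average_cost c1 c2 (\<lambda>_. \<theta>) lam \<phi>"
proof -
  let ?m = "optimal_partner lam"
  let ?K = "\<Sum>i\<in>UNIV. \<bar>price ?m lam i\<bar> * (lam $ i / \<theta>)"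
  have "((\<lambda>T. pair_value ?m lam - ?K / T) \<longlongrightarrow> pair_value ?m lam - 0) at_top"
    by (intro tendsto_intros tendsto_divide_0[OF tendsto_const] filterlim_at_top_imp_at_infinity filterlim_ident)
  then have lim: "Limsup at_top (\<lambda>T. ereal (pair_value ?m lam - ?K / T)) = ereal (pair_value ?m lam)"
    by (intro lim_imp_Limsup) simp_all
  have le: "Limsup at_top (\<lambda>T. ereal (pair_value ?m lam - ?K / T)) \<le>
      Limsup at_top (\<lambda>T. ereal (lp_cost c1 c2 (flow \<phi> T) (expired \<phi> T) / T))"
  proof (rule Limsup_mono)
    show "\<forall>\<^sub>F T in at_top. ereal (pair_value ?m lam - ?K / T) \<le>
        ereal (lp_cost c1 c2 (flow \<phi> T) (expired \<phi> T) / T)"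
      using eventually_gt_at_top[of "0 :: real"]
    proof eventually_elim
      case (elim T)
      \<comment> \<open>The expected flows satisfy every constraint of the program except that the
        right-hand side of the balance is reduced by the left-over demands.\<close>
      have "(\<Sum>i\<in>UNIV. price ?m lam i * (lam $ i * T - left_over \<phi> T i)) \<le>
          lp_cost c1 c2 (flow \<phi> T) (expired \<phi> T)"
        using elim flow_balance[OF adm] flow_le[OF adm] flow_nonneg
        by (intro optimal_lower_bound[OF lam unique]) auto
      then have "(\<Sum>i\<in>UNIV. price ?m lam i * (lam $ i * T - left_over \<phi> T i)) / T \<le>
          lp_cost c1 c2 (flow \<phi> T) (expired \<phi> T) / T"
        using elim by (simp add: divide_right_mono)
      then show ?case using price_flow_near_value[OF adm elim, of ?m] by simp
    qed
  qed
  show ?thesis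
    unfolding average_cost_eq[OF c_nonneg c2_sym adm] lim[symmetric] by (rule le)
qed

text \<open>Complementary slackness makes the expected cost up to each \<open>T\<close> equal to the
  priced arrivals minus left-overs, so the average converges to the pair value.\<close>

lemma average_cost_pairing_policy:
  assumes inv: "\<And>i. m (m i) = i"
  shows "average_cost c1 c2 (\<lambda>_. \<theta>) lam (pairing_policy m) = ereal (pair_value m lam)"
proof -
  let ?\<phi> = "pairing_policy m"
  let ?f = "\<lambda>T. lp_cost c1 c2 (flow ?\<phi> T) (expired ?\<phi> T) / T"
  note adm = pairing_policy_admissible[of m]
  let ?K = "\<Sum>i\<in>UNIV. \<bar>price m lam i\<bar> * (lam $ i / \<theta>)"
  have "((\<lambda>T. ?K / T) \<longlongrightarrow> 0) at_top"
    by (intro tendsto_divide_0[OF tendsto_const] filterlim_at_top_imp_at_infinity filterlim_ident)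
  moreover have "\<forall>\<^sub>F T in at_top. norm (?f T - pair_value m lam) \<le> ?K / T"
    using eventually_gt_at_top[of "0 :: real"]
  proof eventually_elim
    case (elim T)
    have "lp_cost c1 c2 (flow ?\<phi> T) (expired ?\<phi> T) =
        (\<Sum>i\<in>UNIV. price m lam i * (lam $ i * T - left_over ?\<phi> T i))"
    proof (rule saturated_cost[OF inv lam])
      show "\<theta> * flow ?\<phi> T i j = lam $ j * expired ?\<phi> T i" if "j = i \<or> j = m i" for i j
        using elim by (intro flow_saturated[OF adm] pairing_policy_saturated inv that) auto
      show "flow ?\<phi> T i j = 0" if "j \<noteq> i" "j \<noteq> m i" for i j
        using that inv elim by (intro flow_eq_0[OF adm]) (auto simp: pairing_policy_def split: if_splits)
    qed (use flow_balance[OF adm] elim in auto)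
    then show ?case using price_flow_near_value[OF adm elim, of m] by simp
  qed
  ultimately have "((\<lambda>T. ?f T - pair_value m lam) \<longlongrightarrow> 0) at_top"
    by (rule Lim_null_comparison[rotated])
  then have "(?f \<longlongrightarrow> pair_value m lam) at_top"
    by (simp add: LIM_zero_iff)
  then have "Limsup at_top (\<lambda>T. ereal (?f T)) = ereal (pair_value m lam)"
    by (intro lim_imp_Limsup) simp_all
  then show ?thesis
    using average_cost_eq[of c1 c2 ?\<phi>] c_nonneg c2_sym adm by metis
qed

lemma mdp_value_eq: "mdp_value c1 c2 (\<lambda>_. \<theta>) lam = ereal (lp_value c1 c2 (\<lambda>_. \<theta>) lam)"
proof -
  let ?m = "optimal_partner lam"
  have "mdp_value c1 c2 (\<lambda>_. \<theta>) lam = ereal (pair_value ?m lam)"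
    unfolding mdp_value_def
  proof (rule antisym)
    show "(INF \<phi>\<in>admissible_policies. average_cost c1 c2 (\<lambda>_. \<theta>) lam \<phi>) \<le> ereal (pair_value ?m lam)"
      using average_cost_pairing_policy[OF optimal_partner_inv[OF lam unique]]
      by (intro INF_lower2[OF pairing_policy_admissible[of ?m]]) auto
    show "ereal (pair_value ?m lam) \<le> (INF \<phi>\<in>admissible_policies. average_cost c1 c2 (\<lambda>_. \<theta>) lam \<phi>)"
      by (intro INF_greatest average_cost_ge)
  qed
  then show ?thesis using lp_value_eq[OF lam unique] by simp
qed

end

end

theorem proposition7:
  fixes c1 :: "'n::finite \<Rightarrow> real" and c2 :: "'n \<Rightarrow> 'n \<Rightarrow> real"
    and th :: "'n \<Rightarrow> real" and \<theta> :: real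
    and lo hi :: "real ^ 'n"
  assumes "\<And>i. c1 i > 0" and "\<And>i j. c2 i j > 0"
    and "\<And>i. c1 i = c2 i i" and "\<And>i j. c2 i i \<le> c2 i j" and "\<And>i j. c2 i j = c2 j i"
    and "\<And>i. th i > 0" and "\<And>i. th i = \<theta>"
    and "\<And>i. lo $ i > 0"
    and "\<And>k. k \<ge> 2 \<Longrightarrow> critical_efficiency c1 c2 k < 1 / 2"
    and "\<And>i. lo $ i > \<theta> * (critical_efficiency c1 c2 3 / (1 - 2 * critical_efficiency c1 c2 3))"
  shows "concave_on (cbox lo hi) (lp_value c1 c2 th) \<and>
    (\<forall>lam\<in>cbox lo hi. ereal (lp_value c1 c2 th lam) = mdp_value c1 c2 th lam)"
proof -
  have th: "th = (\<lambda>_. \<theta>)" using assms(7) by auto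
  have "0 < \<theta>" using assms(6,7) by metis
  interpret cost_model c1 c2 \<theta>
  proof
    show "c1 i \<le> c2 i j" for i j using assms(3)[of i] assms(4)[of i j] by simp
  qed (use assms(1,3,5) \<open>0 < \<theta>\<close> in auto)
  have lo: "lo $ i \<le> lam $ i" if "lam \<in> cbox lo hi" for lam i
    using that by (simp add: mem_box_cart)
  have pos: "0 < lam $ i" if "lam \<in> cbox lo hi" for lam i
    using assms(8)[of i] lo[OF that, of i] by simp
  \<comment> \<open>The bound at the lower corner passes to every point of the box, so partners are
    unique throughout it.\<close>
  have unique: "j = k" if "lam \<in> cbox lo hi" "profitable lam i j" "profitable lam i k" for lam i j k
    using assms(9)[of 3] pos[OF that(1)] less_le_trans[OF assms(10) lo[OF that(1)]] that(2,3)
    by (intro profitable_unique) auto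
  show ?thesis
    unfolding th
  proof
    show "concave_on (cbox lo hi) (lp_value c1 c2 (\<lambda>_. \<theta>))"
      using pos unique by (intro concave_on_lp_value convex_box) blast+
    show "\<forall>lam\<in>cbox lo hi. ereal (lp_value c1 c2 (\<lambda>_. \<theta>) lam) = mdp_value c1 c2 (\<lambda>_. \<theta>) lam"
      using mdp_value_eq[symmetric] pos unique by blast
  qed
qed

end
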